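(* There is a universal constant $C>0$ such that for every integer $N\ge2$, every $\gamma\in[1/\sqrt N,1]$ and every $\delta>0$ there is a quantum algorithm that uses at most $C/\gamma$ applications of the advice unitary and its inverse, and solves $\mathsf{maxQPE}_{N,\delta}$ with an advice unitary of overlap at least $\gamma$ in the unknown-eigenbasis case (and hence also in the known-eigenbasis case) with cost at most $C\,\frac{\max\{1,\log(1/\gamma)\}}{\gamma\delta}$.
   Context: Model of computation. The input is an unknown $N$-dimensional unitary $U$. The state space is $\mathbb{C}^N\otimes W$, where the first register is $N$-dimensional with computational basis $|0\rangle,\dots,|N-1\rangle$ and $W$ is an arbitrarily large (finite-dimensional) workspace. The algorithm starts in $|0\rangle|0\rangle$; it may apply $U$ and $U^{-1}$ to the first register (possibly controlled by a qubit of the workspace), and arbitrary unitaries independent of $U$ to the whole space, and it may use the advice unitary as described below; at the end it performs a POVM (independent of $U$) which determines the classical output. The cost of the algorithm is the total number of applications of $U$ and $U^{-1}$ (including controlled versions); all other operations, including uses of the advice unitary, do not count towards the cost. Logarithms are base 2. The task $\mathsf{maxQPE}_{N,\delta}$ with an advice unitary of overlap at least $\gamma$. Let $U=\sum_{j=0}^{N-1}e^{i\theta_j}|u_j\rangle\langle u_j|$ with orthonormal eigenbasis $(|u_j\rangle)$ and $\theta_j\in[0,2\pi)$, let $\theta_{\max}=\max_j\theta_j$, and let $S$ be the span of all eigenstates with eigenphase $\theta_{\max}$. Input promise: $\theta_{\max}\in[0,2\pi-2\delta)$. In the known-eigenbasis case $U$ is moreover promised to be diagonal in the computational basis; in the unknown-eigenbasis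 case the eigenbasis is arbitrary and unknown. Advice: the algorithm has black-box access to a unitary $A$ (and $A^{-1}$) with $A|0\rangle=|\alpha\rangle$, where $\|P_S|\alpha\rangle\|^2\ge\gamma^2$ and $P_S$ is the orthogonal projection onto $S$. Output: with probability at least $2/3$, a value in $[\theta_{\max}-\delta,\theta_{\max}+\delta]$ modulo $2\pi$. The algorithm (which may depend on $N,\delta,\gamma$) must be correct for every $U$ satisfying the promise and every valid $A$. *)

theory Defs
  imports
    Complex_Main
    "Jordan_Normal_Form.Matrix"
    "Jordan_Normal_Form.VS_Connect"
    "Jordan_Normal_Form.Schur_Decomposition"
begin

text \<open>Dimensions are quantified inside the theorem, so vectors and matrices are those of
  Jordan\_Normal\_Form. Note that \<open>v \<bullet>c w\<close> is conjugate-linear in its second argument, i.e. it is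
  the physicists' \<open>\<langle>w|v\<rangle>\<close>.\<close>

definition unitary_of_dim :: "nat \<Rightarrow> complex mat \<Rightarrow> bool" where
  "unitary_of_dim n G \<longleftrightarrow>
     G \<in> carrier_mat n n \<and> mat_adjoint G * G = 1\<^sub>m n \<and> G * mat_adjoint G = 1\<^sub>m n"

definition psd_of_dim :: "nat \<Rightarrow> complex mat \<Rightarrow> bool" where
  "psd_of_dim n E \<longleftrightarrow>
     E \<in> carrier_mat n n \<and> mat_adjoint E = E \<and> (\<forall>v \<in> carrier_vec n. 0 \<le> Re ((E *\<^sub>v v) \<bullet>c v))"

definition norm_sq :: "complex vec \<Rightarrow> real" where
  "norm_sq v = (\<Sum>i<dim_vec v. (cmod (v $ i))\<^sup>2)"

definition cspan :: "nat \<Rightarrow> complex vec set \<Rightarrow> complex vec set" where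
  "cspan n X = LinearCombinations.module.span class_ring (module_vec TYPE(complex) n) X"

definition is_orth_proj :: "nat \<Rightarrow> complex mat \<Rightarrow> complex vec set \<Rightarrow> bool" where
  "is_orth_proj n P S \<longleftrightarrow>
     P \<in> carrier_mat n n \<and> P * P = P \<and> mat_adjoint P = P \<and> (\<lambda>v. P *\<^sub>v v) ` carrier_vec n = S"

text \<open>In a tensor product of dimensions \<open>p\<close> and \<open>q\<close>, the basis vector \<open>|i\<rangle>|j\<rangle>\<close> has index
  \<open>i * q + j\<close>.\<close>

definition kron :: "complex mat \<Rightarrow> complex mat \<Rightarrow> complex mat" where
  "kron X Y = mat (dim_row X * dim_row Y) (dim_col X * dim_col Y)
     (\<lambda>(i, j). X $$ (i div dim_row Y, j div dim_col Y) * Y $$ (i mod dim_row Y, j mod dim_col Y))"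

text \<open>\<open>Free G\<close> is an input-independent unitary on the whole space. The parameters \<open>a b\<close> of a
  controlled query select a qubit of the workspace through a factorisation
  \<open>W = \<complex>\<^sup>a \<otimes> \<complex>\<^sup>2 \<otimes> \<complex>\<^sup>b\<close>; the query is performed iff that qubit is \<open>|1\<rangle>\<close>.\<close>

datatype gate =
    Free "complex mat"
  | QueryU
  | QueryU_inv
  | CtrlU nat nat
  | CtrlU_inv nat nat
  | Advice
  | Advice_inv

text \<open>\<open>work_dim\<close> is the dimension of the workspace. The final POVM has the elements
  \<open>povm k\<close> for \<open>k < num_outcomes\<close>; outcome \<open>k\<close> makes the algorithm return \<open>out_val k\<close>.\<close>

record qalg =
  work_dim :: nat
  gates :: "gate list"
  num_outcomes :: nat
  povm :: "nat \<Rightarrow> complex mat"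
  out_val :: "nat \<Rightarrow> real"

definition basis_proj :: "nat \<Rightarrow> complex mat" where
  "basis_proj c = mat 2 2 (\<lambda>(i, j). if i = c \<and> j = c then 1 else 0)"

definition qubit_proj :: "nat \<Rightarrow> nat \<Rightarrow> nat \<Rightarrow> complex mat" where
  "qubit_proj a b c = kron (kron (1\<^sub>m a) (basis_proj c)) (1\<^sub>m b)"

definition controlled :: "nat \<Rightarrow> nat \<Rightarrow> nat \<Rightarrow> complex mat \<Rightarrow> complex mat" where
  "controlled N a b V = kron (1\<^sub>m N) (qubit_proj a b 0) + kron V (qubit_proj a b 1)"

text \<open>The inverse of a unitary is its adjoint.\<close>

fun gate_op :: "nat \<Rightarrow> nat \<Rightarrow> complex mat \<Rightarrow> complex mat \<Rightarrow> gate \<Rightarrow> complex mat" where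
  "gate_op N m U A (Free G) = G"
| "gate_op N m U A QueryU = kron U (1\<^sub>m m)"
| "gate_op N m U A QueryU_inv = kron (mat_adjoint U) (1\<^sub>m m)"
| "gate_op N m U A (CtrlU a b) = controlled N a b U"
| "gate_op N m U A (CtrlU_inv a b) = controlled N a b (mat_adjoint U)"
| "gate_op N m U A Advice = kron A (1\<^sub>m m)"
| "gate_op N m U A Advice_inv = kron (mat_adjoint A) (1\<^sub>m m)"

fun wf_gate :: "nat \<Rightarrow> nat \<Rightarrow> gate \<Rightarrow> bool" where
  "wf_gate N m (Free G) \<longleftrightarrow> unitary_of_dim (N * m) G"
| "wf_gate N m (CtrlU a b) \<longleftrightarrow> m = a * 2 * b"
| "wf_gate N m (CtrlU_inv a b) \<longleftrightarrow> m = a * 2 * b"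
| "wf_gate N m _ \<longleftrightarrow> True"

definition is_povm :: "nat \<Rightarrow> nat \<Rightarrow> (nat \<Rightarrow> complex mat) \<Rightarrow> bool" where
  "is_povm n r E \<longleftrightarrow>
     (\<forall>k<r. psd_of_dim n (E k)) \<and>
     mat n n (\<lambda>(i, j). \<Sum>k<r. E k $$ (i, j)) = 1\<^sub>m n"

definition wf_qalg :: "nat \<Rightarrow> qalg \<Rightarrow> bool" where
  "wf_qalg N alg \<longleftrightarrow>
     0 < work_dim alg \<and>
     (\<forall>g \<in> set (gates alg). wf_gate N (work_dim alg) g) \<and>
     is_povm (N * work_dim alg) (num_outcomes alg) (povm alg)"

definition final_state :: "nat \<Rightarrow> qalg \<Rightarrow> complex mat \<Rightarrow> complex mat \<Rightarrow> complex vec" where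
  "final_state N alg U A =
     fold (\<lambda>g \<psi>. gate_op N (work_dim alg) U A g *\<^sub>v \<psi>) (gates alg)
       (unit_vec (N * work_dim alg) 0)"

definition prob_output :: "nat \<Rightarrow> qalg \<Rightarrow> complex mat \<Rightarrow> complex mat \<Rightarrow> real set \<Rightarrow> real" where
  "prob_output N alg U A Y =
     (let \<psi> = final_state N alg U A in
      \<Sum>k | k < num_outcomes alg \<and> out_val alg k \<in> Y. Re ((povm alg k *\<^sub>v \<psi>) \<bullet>c \<psi>))"

fun is_U_query :: "gate \<Rightarrow> bool" where
  "is_U_query QueryU = True"
| "is_U_query QueryU_inv = True"
| "is_U_query (CtrlU a b) = True"
| "is_U_query (CtrlU_inv a b) = True"
| "is_U_query _ = False"

fun is_advice_query :: "gate \<Rightarrow> bool" where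
  "is_advice_query Advice = True"
| "is_advice_query Advice_inv = True"
| "is_advice_query _ = False"

definition cost :: "qalg \<Rightarrow> nat" where
  "cost alg = length (filter is_U_query (gates alg))"

definition advice_uses :: "qalg \<Rightarrow> nat" where
  "advice_uses alg = length (filter is_advice_query (gates alg))"

text \<open>Entrywise form of \<open>U = (\<Sum>j<N. exp (\<i> * \<theta> j) |u j\<rangle>\<langle>u j|)\<close> with \<open>u\<close> orthonormal.\<close>

definition spectral_decomp ::
  "nat \<Rightarrow> complex mat \<Rightarrow> (nat \<Rightarrow> real) \<Rightarrow> (nat \<Rightarrow> complex vec) \<Rightarrow> bool" where
  "spectral_decomp N U \<theta> u \<longleftrightarrow>
     (\<forall>j<N. 0 \<le> \<theta> j \<and> \<theta> j < 2 * pi) \<and>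
     (\<forall>j<N. u j \<in> carrier_vec N) \<and>
     (\<forall>i<N. \<forall>j<N. u i \<bullet>c u j = (if i = j then 1 else 0)) \<and>
     U = mat N N (\<lambda>(a, b). \<Sum>j<N. exp (\<i> * complex_of_real (\<theta> j)) * (u j $ a) * cnj (u j $ b))"

definition theta_max :: "nat \<Rightarrow> (nat \<Rightarrow> real) \<Rightarrow> real" where
  "theta_max N \<theta> = Max (\<theta> ` {..<N})"

definition top_space :: "nat \<Rightarrow> (nat \<Rightarrow> real) \<Rightarrow> (nat \<Rightarrow> complex vec) \<Rightarrow> complex vec set" where
  "top_space N \<theta> u = cspan N {u j | j. j < N \<and> \<theta> j = theta_max N \<theta>}"

definition valid_advice :: "nat \<Rightarrow> real \<Rightarrow> complex vec set \<Rightarrow> complex mat \<Rightarrow> bool" where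
  "valid_advice N \<gamma> S A \<longleftrightarrow>
     unitary_of_dim N A \<and>
     (\<exists>P. is_orth_proj N P S \<and> norm_sq (P *\<^sub>v (A *\<^sub>v unit_vec N 0)) \<ge> \<gamma>\<^sup>2)"

definition correct_outputs :: "real \<Rightarrow> real \<Rightarrow> real set" where
  "correct_outputs \<delta> t = {y. \<exists>k::int. \<bar>y - t - 2 * pi * of_int k\<bar> \<le> \<delta>}"

datatype eigenbasis = Known | Unknown

text \<open>In the known-eigenbasis case \<open>U\<close> is promised to be diagonal in the computational basis;
  in the unknown case there is no restriction.\<close>

definition solves_maxQPE_advice ::
  "eigenbasis \<Rightarrow> nat \<Rightarrow> real \<Rightarrow> real \<Rightarrow> qalg \<Rightarrow> bool" where
  "solves_maxQPE_advice e N \<delta> \<gamma> alg \<longleftrightarrow>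
     (\<forall>U \<theta> u A.
        spectral_decomp N U \<theta> u \<longrightarrow>
        (e = Known \<longrightarrow> diagonal_mat U) \<longrightarrow>
        theta_max N \<theta> < 2 * pi - 2 * \<delta> \<longrightarrow>
        valid_advice N \<gamma> (top_space N \<theta> u) A \<longrightarrow>
        prob_output N alg U A (correct_outputs \<delta> (theta_max N \<theta>)) \<ge> 2 / 3)"

end

theory Submission
  imports Defs
begin

text \<open>Phase estimation on the advice state, with outcome \<open>y\<close>, produces an estimate that lies within
  \<open>\<delta>\<close> of \<open>\<theta>\<^sub>m\<^sub>a\<^sub>x\<close> with probability about \<open>\<gamma>\<^sup>2\<close> and exceeds \<open>\<theta>\<^sub>m\<^sub>a\<^sub>x + \<delta>\<close> with a tiny probability \<open>\<epsilon>\<close>. The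
  maximum is found by repeated amplitude amplification of the estimates above the largest one seen so
  far. The schedule is fixed in advance: stage \<open>k\<close> uses \<open>2\<^sup>k / 4\<close> Grover iterations to bring the
  probability of an estimate above the threshold from \<open>4\<^sup>-\<^sup>k\<close> below \<open>4\<^sup>-\<^sup>(\<^sup>k\<^sup>+\<^sup>1\<^sup>)\<close>. A round succeeds with constant
  probability, so that repeating stage \<open>k\<close> of \<open>K = log (1/\<gamma>) + O(1)\<close> about \<open>K - k\<close> times makes the
  failure probabilities sum to a constant while the number of advice uses stays \<open>O(2\<^sup>K) = O(1/\<gamma>)\<close>.
  A round with \<open>j\<close> iterations overshoots with probability at most \<open>(2 j + 1)\<^sup>2 \<epsilon>\<close>, so \<open>\<epsilon> = O(4\<^sup>-\<^sup>K)\<close>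
  suffices. It is achieved with \<open>O(K / \<delta>)\<close> queries by taking as window for the phase register the
  coefficients of \<open>(1 + z + \<dots> + z\<^sup>n\<^sup>-\<^sup>1)\<^sup>r\<close>, whose Fourier transform is the \<open>r\<close>-th power of the Dirichlet
  kernel, with \<open>n = O(1/\<delta>)\<close> and \<open>r = O(K)\<close>.\<close>

section \<open>Grover amplitudes\<close>

text \<open>Two obstacles shape the proof. The probability that a round should amplify is unknown,
  so no iteration count can be tuned to it. A fixed count still works: a tail of at most 4^-k keeps
  the Grover rotation from turning too far, and a round started with a smaller tail cannot undo
  progress, because the threshold is a running maximum. Only a jump too high is irreversible; hence
  the bound on \<epsilon> must beat the sum of (2 j + 1)^2 over all rounds. Moreover, the model
  measures only once. All rounds run coherently, each reading its threshold from the stored record.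
  The output distribution is shown to be exactly that of a classical Markov process, so the
  probability estimates for maximum finding are made without quantum states. Phases also wrap
  around: an eigenphase near 0 may be read as nearly 2 pi and would win the maximum. The gap of 2
  \<delta> below 2 pi in the promise is what allows such readings to be discarded.\<close>

fun grov :: "real \<Rightarrow> nat \<Rightarrow> real \<times> real" where
  "grov p 0 = (1, 1)"
| "grov p (Suc j) = (let (x, z) = grov p j in
     ((1 - 2 * p) * x + 2 * (1 - p) * z, (1 - 2 * p) * z - 2 * p * x))"

text \<open>With \<open>p\<close> = sin^2 \<phi>, the pair is (sin ((2 j + 1) \<phi>) / sin \<phi>,
  cos ((2 j + 1) \<phi>) / cos \<phi>): the factors that \<open>j\<close> Grover iterations put on
  the amplitudes of the marked and the unmarked part. The invariant is sin^2 + cos^2 = 1. The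
  recurrence also covers \<open>p = 0\<close> and \<open>p = 1\<close>, where these quotients break
  down.\<close>

lemma grov_norm: "p * (fst (grov p j))\<^sup>2 + (1 - p) * (snd (grov p j))\<^sup>2 = 1"
proof (induction j)
  case (Suc j)
  obtain x z where xz: "grov p j = (x, z)" by fastforce
  have "p * (a * x + 2 * q * z)\<^sup>2 + q * (a * z - 2 * p * x)\<^sup>2
      = (a\<^sup>2 + 4 * p * q) * (p * x\<^sup>2 + q * z\<^sup>2)" for a q
    by (simp add: power2_eq_square algebra_simps)
  moreover have "(1 - 2 * p)\<^sup>2 + 4 * p * (1 - p) = 1" by (simp add: power2_eq_square algebra_simps)
  ultimately have "p * ((1 - 2 * p) * x + 2 * (1 - p) * z)\<^sup>2 + (1 - p) * ((1 - 2 * p) * z - 2 * p * x)\<^sup>2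
      = p * x\<^sup>2 + (1 - p) * z\<^sup>2" by (simp only: mult_1_left)
  then show ?case using Suc xz by simp
qed simp

text \<open>The invariant gives |(1 - p) z| \<le> 1, so an iteration adds at most 2 to the marked
  factor. This limits how far rare overshoots are amplified.\<close>

lemma grov_upper:
  assumes "0 \<le> p" "p \<le> 1"
  shows "\<bar>fst (grov p j)\<bar> \<le> 2 * real j + 1"
proof (induction j)
  case (Suc j)
  obtain x z where xz: "grov p j = (x, z)" by fastforce
  have "(1 - p) * z\<^sup>2 \<le> 1" using grov_norm[of p j] xz assms mult_nonneg_nonneg[of p "x\<^sup>2"] by (simp del: mult_nonneg_nonneg)
  then have "((1 - p) * z)\<^sup>2 \<le> 1\<^sup>2"
    using assms mult_mono[of "1 - p" 1 "(1 - p) * z\<^sup>2" 1] mult_nonneg_nonneg[of "1 - p" "z\<^sup>2"]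
    by (simp add: power_mult_distrib power2_eq_square mult_ac)
  then have z: "\<bar>(1 - p) * z\<bar> \<le> 1" by (metis abs_le_square_iff abs_1)
  have "\<bar>1 - 2 * p\<bar> \<le> 1" using assms by auto
  then have "\<bar>(1 - 2 * p) * x\<bar> \<le> \<bar>x\<bar>"
    by (metis abs_mult abs_ge_zero mult_left_le_one_le)
  then have "\<bar>(1 - 2 * p) * x + 2 * (1 - p) * z\<bar> \<le> \<bar>x\<bar> + 2" using z by linarith
  then show ?case using Suc xz by simp
qed simp

text \<open>The hypothesis keeps the rotation in its nearly linear phase: \<open>z\<close> \<ge> 7/8
  and \<open>p * x\<close> \<le> 3/16, so an iteration gains at least 2 (15/16) (7/8) - 6/16 > 1.
  The other bounds travel along because the gain depends on them; the one on \<open>z\<close> sums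
  the losses 2 p (x + z) \<le> 4 p (s + 1).\<close>

lemma grov_lower:
  assumes "0 \<le> p" "p * (16 * (real j)\<^sup>2) \<le> 1" "s \<le> j"
  shows "1 + real s \<le> fst (grov p s) \<and> fst (grov p s) \<le> 2 * real s + 1
    \<and> 1 - 2 * p * (real s * (real s + 1)) \<le> snd (grov p s) \<and> snd (grov p s) \<le> 1"
  using assms(3)
proof (induction s)
  case (Suc s)
  obtain x z where xz: "grov p s = (x, z)" by fastforce
  have IH: "1 + real s \<le> x" "x \<le> 2 * real s + 1" "1 - 2 * p * (real s * (real s + 1)) \<le> z" "z \<le> 1"
    using Suc xz by auto
  have sj: "real s + 1 \<le> real j" using Suc by simp
  have j1: "real j \<ge> 1" using sj by linarith
  have pj: "p * real j \<le> 1/16"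
  proof -
    have "real j \<le> (real j)\<^sup>2" using j1 by (simp add: power2_eq_square)
    then have "p * real j \<le> p * (real j)\<^sup>2" using assms by (intro mult_left_mono) auto
    then show ?thesis using assms by simp
  qed
  have p16: "p \<le> 1/16"
  proof -
    have "p * 1 \<le> p * real j" using j1 assms by (intro mult_left_mono) auto
    then show ?thesis using pj by simp
  qed
  have ps: "p * (real s * (real s + 1)) \<le> 1/16"
  proof -
    have "real s * (real s + 1) \<le> (real j)\<^sup>2" using sj unfolding power2_eq_square by (intro mult_mono) auto
    then have "p * (real s * (real s + 1)) \<le> p * (real j)\<^sup>2" using assms by (intro mult_left_mono) auto
    then show ?thesis using assms by simp
  qed
  have z: "z \<ge> 7/8" using IH ps by linarith
  have psj: "p * real s \<le> p * real j" using sj assms by (intro mult_left_mono) auto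
  have px: "p * x \<le> p * (2 * real s + 1)" using IH assms by (intro mult_left_mono) auto
  then have px2: "p * x \<le> 3/16" using psj pj p16 by (simp add: algebra_simps)
  have px0: "0 \<le> p * x" using IH assms by auto
  have qz: "(1 - p) * z \<ge> (15/16) * (7/8)" using z p16 by (intro mult_mono) auto
  have qz1: "(1 - p) * z \<le> 1" using mult_mono[of "1-p" 1 z 1] z p16 IH assms by auto
  have pz0: "0 \<le> p * z" using z assms by auto
  have pz: "p * z \<le> p" using mult_left_mono[of z 1 p] IH assms by auto
  have e1: "(1 - 2 * p) * x + 2 * (1 - p) * z = x + 2 * ((1 - p) * z) - 2 * (p * x)" by (simp add: algebra_simps)
  have e2: "(1 - 2 * p) * z - 2 * p * x = z - 2 * (p * z) - 2 * (p * x)" by (simp add: algebra_simps)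
  have "1 - 2 * p * (real (Suc s) * (real (Suc s) + 1)) = 1 - 2 * p * (real s * (real s + 1)) - 4 * (p * real s) - 4 * p"
    by (simp add: algebra_simps)
  then have "1 - 2 * p * (real (Suc s) * (real (Suc s) + 1)) \<le> z - 2 * (p * z) - 2 * (p * x)"
    using IH px pz by (simp add: algebra_simps)
  moreover have "x + 2 * ((1 - p) * z) - 2 * (p * x) \<ge> 1 + real (Suc s)" using IH qz px2 by simp
  moreover have "x + 2 * ((1 - p) * z) - 2 * (p * x) \<le> 2 * real (Suc s) + 1" using IH qz1 px0 by simp
  moreover have "z - 2 * (p * z) - 2 * (p * x) \<le> 1" using IH pz0 px0 by simp
  ultimately show ?case unfolding grov.simps xz Let_def prod.case e1 e2 by simp
qed simp

section \<open>The classical process behind maximum finding\<close>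

locale max_finding =
  fixes P :: "nat \<Rightarrow> real" and est :: "nat \<Rightarrow> real" and M :: nat
  assumes P_nonneg: "y < M \<Longrightarrow> 0 \<le> P y" and P_sum: "(\<Sum>y<M. P y) = 1"
begin

definition tail :: "real \<Rightarrow> real" where
  "tail t = (\<Sum>y | y < M \<and> t < est y. P y)"

definition amp :: "nat \<Rightarrow> real \<Rightarrow> nat \<Rightarrow> real" where
  "amp j t y = (if t < est y then fst (grov (tail t) j) else snd (grov (tail t) j))"

text \<open>Backward Markov operator of one round: the expected value of \<open>g\<close> at the new
  threshold when the amplified state is measured, outcome \<open>y\<close> having probability
  \<open>P y * (amp j t y)\<^sup>2\<close>. Being backward, it composes with the first round
  outermost, which is the order of \<open>foldr\<close> in \<open>run\<close>.\<close>

definition step :: "nat \<Rightarrow> (real \<Rightarrow> real) \<Rightarrow> real \<Rightarrow> real" where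
  "step j g t = (\<Sum>y<M. P y * (amp j t y)\<^sup>2 * g (max t (est y)))"

definition run :: "nat list \<Rightarrow> (real \<Rightarrow> real) \<Rightarrow> real \<Rightarrow> real" where
  "run js = foldr step js"

lemma run_simps [simp]: "run [] g = g" "run (j # js) g = step j (run js g)"
  "run (js @ js') g = run js (run js' g)"
  by (simp_all add: run_def)

lemma tail_mono: "s \<le> t \<Longrightarrow> tail t \<le> tail s"
  unfolding tail_def by (rule sum_mono2) (auto simp: P_nonneg)

lemma tail_nonneg: "0 \<le> tail t"
  unfolding tail_def by (rule sum_nonneg) (auto simp: P_nonneg)

lemma tail_le_1: "tail t \<le> 1"
  unfolding tail_def P_sum[symmetric] by (rule sum_mono2) (auto simp: P_nonneg)

lemma tail_compl: "(\<Sum>y | y < M \<and> \<not> t < est y. P y) = 1 - tail t"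
proof -
  have "(\<Sum>y<M. P y) = tail t + (\<Sum>y | y < M \<and> \<not> t < est y. P y)"
    unfolding tail_def by (subst sum.union_disjoint[symmetric]) (auto intro: sum.cong)
  then show ?thesis using P_sum by simp
qed

lemma step_split:
  "step j g t = (\<Sum>y | y < M \<and> t < est y. P y * (fst (grov (tail t) j))\<^sup>2 * g (est y))
     + (\<Sum>y | y < M \<and> \<not> t < est y. P y * (snd (grov (tail t) j))\<^sup>2 * g t)"
proof -
  have "step j g t = (\<Sum>y | y < M \<and> t < est y. P y * (amp j t y)\<^sup>2 * g (max t (est y)))
     + (\<Sum>y | y < M \<and> \<not> t < est y. P y * (amp j t y)\<^sup>2 * g (max t (est y)))"
    unfolding step_def by (subst sum.union_disjoint[symmetric]) (auto intro: sum.cong)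
  also have "(\<Sum>y | y < M \<and> t < est y. P y * (amp j t y)\<^sup>2 * g (max t (est y)))
     = (\<Sum>y | y < M \<and> t < est y. P y * (fst (grov (tail t) j))\<^sup>2 * g (est y))"
    by (intro sum.cong) (auto simp: amp_def)
  also have "(\<Sum>y | y < M \<and> \<not> t < est y. P y * (amp j t y)\<^sup>2 * g (max t (est y)))
     = (\<Sum>y | y < M \<and> \<not> t < est y. P y * (snd (grov (tail t) j))\<^sup>2 * g t)"
    by (intro sum.cong) (auto simp: amp_def max_def)
  finally show ?thesis .
qed

lemma amp_norm: "(\<Sum>y<M. P y * (amp j t y)\<^sup>2) = 1"
proof -
  have "(\<Sum>y<M. P y * (amp j t y)\<^sup>2) = step j (\<lambda>_. 1) t" by (simp add: step_def)
  also have "\<dots> = tail t * (fst (grov (tail t) j))\<^sup>2 + (1 - tail t) * (snd (grov (tail t) j))\<^sup>2"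
    unfolding step_split using tail_compl[of t] by (simp add: tail_def flip: sum_distrib_right)
  finally show ?thesis using grov_norm by simp
qed

text \<open>Only thresholds from \<open>t\<close> upwards matter, since a round takes a maximum.
  This lets a bound on the tail at the start survive an induction over rounds.\<close>

lemma step_mono: "(\<And>s. t \<le> s \<Longrightarrow> g s \<le> h s) \<Longrightarrow> step j g t \<le> step j h t"
  unfolding step_def by (intro sum_mono mult_left_mono) (auto simp: P_nonneg)

lemma step_add: "step j (\<lambda>s. g s + h s) t = step j g t + step j h t"
  unfolding step_def by (simp add: algebra_simps sum.distrib)

lemma step_const: "step j (\<lambda>_. c) t = c"
  unfolding step_def using amp_norm by (simp flip: sum_distrib_right)

lemma step_scale: "step j (\<lambda>s. c * g s) t = c * step j g t"
  unfolding step_def by (simp add: sum_distrib_left algebra_simps)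

lemma run_mono: "(\<And>s. g s \<le> h s) \<Longrightarrow> run js g t \<le> run js h t"
  by (induction js arbitrary: t) (auto intro: step_mono)

lemma run_add: "run js (\<lambda>s. g s + h s) = (\<lambda>t. run js g t + run js h t)"
  by (induction js) (auto simp: step_add)

lemma run_const: "run js (\<lambda>_. c) = (\<lambda>_. c)"
  by (induction js) (auto simp: step_const)

text \<open>Union bound over the rounds: below \<open>hi\<close>, all outcomes above the current
  threshold are amplified by the same factor, at most \<open>(2 * real j + 1)\<^sup>2\<close>, and
  those above \<open>hi\<close> are among them. The accumulated constant passes through
  \<open>step\<close> because a round preserves total probability.\<close>

lemma run_overshoot:
  "run js (\<lambda>t. of_bool (hi < t)) t \<le> of_bool (hi < t) + (\<Sum>j\<leftarrow>js. (2 * real j + 1)\<^sup>2) * tail hi"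
proof (induction js arbitrary: t)
  case (Cons j js)
  let ?c = "(\<Sum>j\<leftarrow>js. (2 * real j + 1)\<^sup>2) * tail hi"
  have "step j (run js (\<lambda>t. of_bool (hi < t))) t \<le> step j (\<lambda>t. of_bool (hi < t) + ?c) t"
    using Cons by (intro step_mono)
  also have "\<dots> = step j (\<lambda>t. of_bool (hi < t)) t + ?c"
    by (simp add: step_add step_const)
  also have "step j (\<lambda>t. of_bool (hi < t)) t \<le> of_bool (hi < t) + (2 * real j + 1)\<^sup>2 * tail hi"
  proof (cases "hi < t")
    case True
    have "step j (\<lambda>t. of_bool (hi < t)) t \<le> step j (\<lambda>_. 1) t" by (intro step_mono) auto
    then show ?thesis using True tail_nonneg[of hi] by (simp add: step_const add_increasing2)
  next
    case False
    have sq: "(fst (grov (tail t) j))\<^sup>2 \<le> (2 * real j + 1)\<^sup>2"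
      using grov_upper[OF tail_nonneg tail_le_1, of t j] by (intro abs_le_square_iff[THEN iffD1]) auto
    have "step j (\<lambda>t. of_bool (hi < t)) t
      = (\<Sum>y | y < M \<and> t < est y. P y * (fst (grov (tail t) j))\<^sup>2 * of_bool (hi < est y))"
      unfolding step_split using False by simp
    also have "\<dots> = (\<Sum>y | y < M \<and> hi < est y. P y * (fst (grov (tail t) j))\<^sup>2)"
      using False by (intro sum.mono_neutral_cong_right) auto
    also have "\<dots> \<le> (\<Sum>y | y < M \<and> hi < est y. P y * (2 * real j + 1)\<^sup>2)"
      using sq by (intro sum_mono mult_left_mono) (auto simp: P_nonneg)
    finally show ?thesis using False by (simp add: tail_def sum_distrib_right mult.commute)
  qed
  finally show ?case by (simp add: algebra_simps)
qed simp

text \<open>If every outcome above \<open>t\<close> has a small tail, their mass is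
  \<open>tail t\<close>. Otherwise let \<open>b\<close> have the largest estimate among those with
  tail above \<open>s\<close>: everything strictly above \<open>b\<close> qualifies and already has
  mass \<open>tail (est b)\<close>. The strict inequality in \<open>tail\<close> makes this work for
  atoms of any size.\<close>

lemma quantile_mass:
  assumes "0 \<le> s" "s < tail t"
  shows "s \<le> (\<Sum>y | y < M \<and> t < est y \<and> tail (est y) \<le> s. P y)"
proof -
  define Y where "Y = {y. y < M \<and> t < est y \<and> tail (est y) \<le> s}"
  show ?thesis
  proof (cases "{y. y < M \<and> t < est y} = Y")
    case True
    then show ?thesis using assms unfolding tail_def Y_def by simp
  next
    case False
    define B where "B = {y. y < M \<and> t < est y \<and> \<not> tail (est y) \<le> s}"
    have "finite B" "B \<noteq> {}" using False by (auto simp: B_def Y_def)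
    then have "Max (est ` B) \<in> est ` B" by (intro Max_in) auto
    then obtain b where b: "b \<in> B" "Max (est ` B) = est b" by auto
    then have bmax: "est y \<le> est b" if "y \<in> B" for y
      using Max_ge[of "est ` B" "est y"] \<open>finite B\<close> that by simp
    have "tail (est b) \<le> (\<Sum>y\<in>Y. P y)"
      unfolding tail_def[of "est b"] Y_def
    proof (rule sum_mono2, goal_cases)
      case 2
      have "est b < est y \<Longrightarrow> y \<notin> B" for y using bmax[of y] by linarith
      then show ?case using b(1) unfolding B_def by (auto simp: not_le) force
    qed (auto simp: P_nonneg)
    then show ?thesis using b by (simp add: B_def Y_def)
  qed
qed

text \<open>Origin of 63/64: the outcomes that push the tail below 4^-(k+1) have mass at least
  4^-(k+1), and the amplification factor is at least (1 + j)^2 \<ge> 4^k / 16, which makes 1/64.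
  Rounding down in \<open>2 ^ k div 4\<close> gives 4 j \<le> 2^k, as the lower Grover bound
  requires, and still 4 (j + 1) \<ge> 2^k.\<close>

lemma step_progress:
  assumes "tail t \<le> 1 / 4 ^ k" "j = 2 ^ k div 4"
  shows "step j (\<lambda>s. of_bool (1 / 4 ^ Suc k < tail s)) t
    \<le> 63/64 * of_bool (1 / 4 ^ Suc k < tail t)"
proof (cases "1 / 4 ^ Suc k < tail t")
  case False
  have "step j (\<lambda>s. of_bool (1 / 4 ^ Suc k < tail s)) t \<le> step j (\<lambda>_. 0) t"
    using False tail_mono by (intro step_mono) (force simp: not_less)
  then show ?thesis using False by (simp add: step_const)
next
  case True
  let ?s = "1 / 4 ^ Suc k :: real" and ?x = "fst (grov (tail t) j)"
  have j4: "4 * real j \<le> 2 ^ k"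
  proof -
    have "4 * j \<le> 2 ^ k" using assms(2) by simp
    then have "real (4 * j) \<le> real (2 ^ k)" by (simp only: of_nat_le_iff)
    then show ?thesis by simp
  qed
  have j4': "4 * (1 + real j) \<ge> 2 ^ k"
  proof -
    have "n \<le> 4 * (n div 4 + 1)" for n :: nat by presburger
    then have "2 ^ k \<le> 4 * (j + 1)" unfolding assms(2) .
    then have "real (2 ^ k) \<le> real (4 * (j + 1))" by (simp only: of_nat_le_iff)
    then show ?thesis by simp
  qed
  have p4: "(2 ^ k)\<^sup>2 = (4 ^ k :: real)" by (simp add: power2_eq_square flip: power_mult_distrib)
  have "16 * (real j)\<^sup>2 = (4 * real j)\<^sup>2" by (simp add: power_mult_distrib)
  also have "\<dots> \<le> 4 ^ k" using j4 unfolding p4[symmetric] by (intro power_mono) auto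
  finally have "tail t * (16 * (real j)\<^sup>2) \<le> 1 / 4 ^ k * 4 ^ k"
    using assms(1) tail_nonneg by (intro mult_mono) auto
  then have lo: "1 + real j \<le> ?x" using grov_lower[OF tail_nonneg, of t j j] by simp
  have "4 ^ k \<le> (4 * (1 + real j))\<^sup>2" using j4' unfolding p4[symmetric] by (intro power_mono) auto
  also have "\<dots> = 16 * (1 + real j)\<^sup>2" by (simp only: power_mult_distrib) simp
  also have "\<dots> \<le> 16 * ?x\<^sup>2" using lo by (intro mult_left_mono power_mono) auto
  finally have x2: "?x\<^sup>2 \<ge> 4 ^ k / 16" by simp
  have "1/64 = ?s * (4 ^ k / 16)" by simp
  also have "\<dots> \<le> (\<Sum>y | y < M \<and> t < est y \<and> tail (est y) \<le> ?s. P y) * ?x\<^sup>2"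
    using quantile_mass[of ?s t] x2 True by (intro mult_mono) (auto simp: P_nonneg intro!: sum_nonneg)
  also have "\<dots> = (\<Sum>y | y < M \<and> t < est y. P y * ?x\<^sup>2 * of_bool (tail (est y) \<le> ?s))"
    unfolding sum_distrib_right by (intro sum.mono_neutral_cong_left) auto
  also have "\<dots> \<le> step j (\<lambda>s. of_bool (tail s \<le> ?s)) t"
    unfolding step_split by (auto simp: P_nonneg intro!: sum_nonneg)
  finally have ge: "1/64 \<le> step j (\<lambda>s. of_bool (tail s \<le> ?s)) t" .
  have "step j (\<lambda>s. of_bool (tail s \<le> ?s) + of_bool (?s < tail s)) t = step j (\<lambda>_. 1) t"
    by (rule arg_cong[where f="\<lambda>g. step j g t"]) auto
  then have "step j (\<lambda>s. of_bool (?s < tail s)) t = 1 - step j (\<lambda>s. of_bool (tail s \<le> ?s)) t"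
    unfolding step_add step_const by linarith
  then show ?thesis using ge True by simp
qed

text \<open>A stage fails only if it was entered with too large a tail, which is charged in full, or
  if all its \<open>r\<close> rounds fail.\<close>

lemma run_stage:
  assumes "j = 2 ^ k div 4"
  shows "run (replicate r j) (\<lambda>s. of_bool (1 / 4 ^ Suc k < tail s)) t
    \<le> (63/64) ^ r + of_bool (1 / 4 ^ k < tail t)"
proof (cases "tail t \<le> 1 / 4 ^ k")
  case True
  have "tail t \<le> 1 / 4 ^ k \<Longrightarrow> run (replicate r j) (\<lambda>s. of_bool (1 / 4 ^ Suc k < tail s)) t
    \<le> (63/64) ^ r * of_bool (1 / 4 ^ Suc k < tail t)" for t
  proof (induction r arbitrary: t)
    case (Suc r)
    let ?g = "\<lambda>s. of_bool (1 / 4 ^ Suc k < tail s) :: real"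
    have "step j (run (replicate r j) ?g) t \<le> step j (\<lambda>s. (63/64) ^ r * ?g s) t"
      using Suc tail_mono by (intro step_mono Suc.IH) force
    also have "\<dots> \<le> (63/64) ^ r * (63/64 * ?g t)"
      unfolding step_scale using step_progress[OF Suc.prems assms] by (intro mult_left_mono) auto
    finally show ?case by (simp add: algebra_simps)
  qed simp
  from this[OF True] show ?thesis
    using True by (elim order_trans) auto
next
  case False
  have "run (replicate r j) (\<lambda>s. of_bool (1 / 4 ^ Suc k < tail s)) t \<le> run (replicate r j) (\<lambda>_. 1) t"
    by (intro run_mono) auto
  then show ?thesis using False by (simp add: run_const add_increasing)
qed

end

section \<open>The stage schedule: failure probability and total amplification\<close>

definition schedule :: "nat \<Rightarrow> nat \<Rightarrow> nat list" where
  "schedule K k = concat (map (\<lambda>i. replicate (256 * (K - i)) (2 ^ i div 4)) [0..<k])"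

lemma schedule_simps: "schedule K 0 = []"
  "schedule K (Suc k) = schedule K k @ replicate (256 * (K - k)) (2 ^ k div 4)"
  by (simp_all add: schedule_def)

text \<open>Bernoulli's inequality gives (65/64)^64 \<ge> 2, while (65/64) (63/64) < 1.\<close>

lemma power_63_64: "(63/64 :: real) ^ 64 \<le> 1/2"
proof -
  have "(65/64 :: real) ^ 64 \<ge> 1 + 64 * (1/64)" using Bernoulli_inequality[of "1/64::real" 64] by simp
  then have "2 * (63/64 :: real) ^ 64 \<le> (65/64) ^ 64 * (63/64) ^ 64"
    by (intro mult_right_mono) auto
  also have "\<dots> = (65/64 * (63/64)) ^ 64" by (simp only: power_mult_distrib)
  also have "\<dots> \<le> 1" by (intro power_le_one) auto
  finally show ?thesis by simp
qed

text \<open>Reason for the 256 in the schedule: 64 rounds halve the failure probability, so 256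
  divide it by 16. The \<open>K - i\<close> repetitions of this block leave stage failures that form
  a geometric series ending with 1/16.\<close>

lemma stage_failure: "(63/64 :: real) ^ (256 * d) \<le> (1/16) ^ d"
proof -
  have "(63/64 :: real) ^ (256 * d) = (((63/64) ^ 64) ^ 4) ^ d"
    by (simp only: power_mult[symmetric]) simp
  also have "\<dots> \<le> ((1/2) ^ 4) ^ d" by (intro power_mono power_63_64) auto
  finally show ?thesis by (simp add: power_divide)
qed

context max_finding
begin

lemma run_schedule_aux:
  "run (schedule K k) (\<lambda>s. of_bool (1 / 4 ^ k < tail s)) t \<le> (\<Sum>i<k. (1/16) ^ (K - i))"
proof (induction k)
  case 0
  \<comment> \<open>Stage 0 asks for a tail of at most 4^0, which always holds.\<close>
  then show ?case using tail_le_1[of t] by (simp add: schedule_simps)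
next
  case (Suc k)
  let ?c = "(1/16) ^ (K - k) :: real"
  have "run (schedule K (Suc k)) (\<lambda>s. of_bool (1 / 4 ^ Suc k < tail s)) t
    = run (schedule K k) (run (replicate (256 * (K - k)) (2 ^ k div 4)) (\<lambda>s. of_bool (1 / 4 ^ Suc k < tail s))) t"
    by (simp add: schedule_simps)
  also have "\<dots> \<le> run (schedule K k) (\<lambda>s. ?c + of_bool (1 / 4 ^ k < tail s)) t"
    by (intro run_mono order_trans[OF run_stage[OF refl]] add_right_mono stage_failure)
  also have "\<dots> = ?c + run (schedule K k) (\<lambda>s. of_bool (1 / 4 ^ k < tail s)) t"
    by (simp add: run_add run_const)
  finally show ?case using Suc by simp
qed

lemma run_schedule: "run (schedule K K) (\<lambda>s. of_bool (1 / 4 ^ K < tail s)) t \<le> 1/15"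
proof -
  \<comment> \<open>Closed form of the geometric series, with the remainder kept so that the
    induction goes through.\<close>
  have "15 * (\<Sum>i<k. (1/16::real) ^ (k - i)) + (1/16)^k = 1" for k
  proof (induction k)
    case (Suc k)
    have "(\<Sum>i<Suc k. (1/16::real) ^ (Suc k - i)) = 1/16 * ((\<Sum>i<k. (1/16) ^ (k - i)) + 1)"
      by (simp add: Suc_diff_le sum_divide_distrib[symmetric])
    then show ?case using Suc by (simp add: algebra_simps)
  qed simp
  from this[of K] have "15 * (\<Sum>i<K. (1/16::real) ^ (K - i)) \<le> 1"
    using zero_le_power[of "1/16::real" K] by linarith
  then show ?thesis using run_schedule_aux[of K K t] by linarith
qed

end

text \<open>The number 2 j + 1 is both the count of preparations in a round and the square root of
  its overshoot factor. The cases \<open>k < 2\<close> have no iterations at all.\<close>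

lemma query_count_le: "2 * real (2 ^ k div 4) + 1 \<le> 2 ^ k"
proof -
  have "2 * (2 ^ k div 4) + 1 \<le> (2::nat) ^ k"
  proof (cases "k < 2")
    case True
    then show ?thesis by (auto simp: less_2_cases_iff)
  next
    case False
    then have "(2::nat)^2 dvd 2 ^ k" by (intro le_imp_power_dvd) auto
    moreover have "(2::nat)^1 \<le> 2 ^ k" using False by (intro power_increasing) auto
    ultimately show ?thesis by (auto elim!: dvdE)
  qed
  then have "real (2 * (2 ^ k div 4) + 1) \<le> real (2 ^ k)" by (simp only: of_nat_le_iff)
  then show ?thesis by simp
qed

text \<open>The weights \<open>K - i\<close> grow only linearly towards the cheap stages, so the
  last stages dominate: the sum of (K - i) 4^i is below (4/9) 4^K, rounded up here to 4^K /
  2.\<close>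

lemma sum_schedule_sq: "(\<Sum>j\<leftarrow>schedule K K. (2 * real j + 1)\<^sup>2) \<le> 128 * 4 ^ K"
proof -
  have "(\<Sum>j\<leftarrow>schedule K k. (2 * real j + 1)\<^sup>2) \<le> (\<Sum>i<k. 256 * real (K - i) * 4 ^ i)" for k
  proof (induction k)
    case (Suc k)
    have "(2 * real (2 ^ k div 4) + 1)\<^sup>2 \<le> (2 ^ k)\<^sup>2" using query_count_le[of k] by (intro power_mono) auto
    also have "\<dots> = (4::real) ^ k" by (simp add: power2_eq_square flip: power_mult_distrib)
    finally have "256 * real (K - k) * (2 * real (2 ^ k div 4) + 1)\<^sup>2 \<le> 256 * real (K - k) * 4 ^ k"
      by (intro mult_left_mono) auto
    then show ?case using Suc by (simp add: schedule_simps sum_list_replicate)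
  qed (simp add: schedule_simps)
  note this[of K]
  also have "(\<Sum>i<K. 256 * real (K - i) * 4 ^ i) = 256 * (\<Sum>i<K. real (K - i) * 4 ^ i)"
    by (simp only: sum_distrib_left mult.assoc)
  also have "9 * (\<Sum>i<k. real (k - i) * 4 ^ i) = 4 ^ Suc k - 4 - 3 * real k" for k
  proof (induction k)
    case (Suc k)
    have g: "3 * (\<Sum>i<m. 4 ^ i) = (4::real) ^ m - 1" for m by (induction m) auto
    have "(\<Sum>i<k. real (Suc k - i) * 4 ^ i) = (\<Sum>i<k. real (k - i) * 4 ^ i) + (\<Sum>i<k. 4 ^ i)"
      unfolding sum.distrib[symmetric] by (intro sum.cong) (auto simp: Suc_diff_le algebra_simps)
    then show ?case using Suc g[of k] by (simp add: algebra_simps)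
  qed simp
  from this[of K] have "(\<Sum>i<K. real (K - i) * 4 ^ i) \<le> 4 ^ K / 2"
    using zero_le_power[of "4::real" K] unfolding power_Suc by linarith
  finally show ?thesis by simp
qed

lemma sum_schedule: "(\<Sum>j\<leftarrow>schedule K K. 2 * real j + 1) \<le> 512 * 2 ^ K"
proof -
  have "(\<Sum>j\<leftarrow>schedule K k. 2 * real j + 1) \<le> (\<Sum>i<k. 256 * real (K - i) * 2 ^ i)" for k
  proof (induction k)
    case (Suc k)
    have "256 * real (K - k) * (2 * real (2 ^ k div 4) + 1) \<le> 256 * real (K - k) * 2 ^ k"
      using query_count_le[of k] by (intro mult_left_mono) auto
    then show ?case using Suc by (simp add: schedule_simps sum_list_replicate)
  qed (simp add: schedule_simps)
  note this[of K]
  also have "(\<Sum>i<K. 256 * real (K - i) * 2 ^ i) = 256 * (\<Sum>i<K. real (K - i) * 2 ^ i)"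
    by (simp only: sum_distrib_left mult.assoc)
  also have "(\<Sum>i<k. real (k - i) * 2 ^ i) = 2 ^ Suc k - 2 - real k" for k
  proof (induction k)
    case (Suc k)
    have g: "(\<Sum>i<m. 2 ^ i) = (2::real) ^ m - 1" for m by (induction m) auto
    have "(\<Sum>i<k. real (Suc k - i) * 2 ^ i) = (\<Sum>i<k. real (k - i) * 2 ^ i) + (\<Sum>i<k. 2 ^ i)"
      unfolding sum.distrib[symmetric] by (intro sum.cong) (auto simp: Suc_diff_le algebra_simps)
    then show ?case using Suc g[of k] by (simp add: algebra_simps)
  qed simp
  finally show ?thesis by simp
qed

context max_finding
begin

text \<open>A final threshold outside the window is above \<open>hi\<close>, or below
  \<open>lo\<close>, and then its tail contains the mass assumed for \<open>lo\<close> and exceeds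
  4^-K. The first has probability at most 128 / 4^5 = 1/8, the second at most 1/15. The assumption
  on \<open>hi\<close> places the initial threshold 0 below it.\<close>

lemma run_schedule_correct:
  assumes "tail hi \<le> 1 / 4 ^ (K + 5)" "0 \<le> hi"
    and "1 / 4 ^ K < (\<Sum>y | y < M \<and> lo \<le> est y. P y)"
  shows "2/3 \<le> run (schedule K K) (\<lambda>t. of_bool (lo \<le> t \<and> t \<le> hi)) 0"
proof -
  let ?js = "schedule K K"
  have low: "1 / 4 ^ K < tail t" if "t < lo" for t
  proof -
    have "(\<Sum>y | y < M \<and> lo \<le> est y. P y) \<le> tail t"
      unfolding tail_def using that by (intro sum_mono2) (auto simp: P_nonneg)
    then show ?thesis using assms by linarith
  qed
  have "1 = run ?js (\<lambda>_. 1) 0" by (simp add: run_const)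
  also have "\<dots> \<le> run ?js (\<lambda>t. of_bool (lo \<le> t \<and> t \<le> hi) +
      (of_bool (hi < t) + of_bool (1 / 4 ^ K < tail t))) 0"
    using low by (intro run_mono) (force simp: not_le not_less)
  also have "\<dots> = run ?js (\<lambda>t. of_bool (lo \<le> t \<and> t \<le> hi)) 0
      + (run ?js (\<lambda>t. of_bool (hi < t)) 0 + run ?js (\<lambda>t. of_bool (1 / 4 ^ K < tail t)) 0)"
    by (simp only: run_add)
  also have "run ?js (\<lambda>t. of_bool (hi < t)) 0 \<le> (\<Sum>j\<leftarrow>?js. (2 * real j + 1)\<^sup>2) * tail hi"
    using run_overshoot[of ?js hi 0] assms by simp
  also have "\<dots> \<le> 128 * 4 ^ K * (1 / 4 ^ (K + 5))"
    using sum_schedule_sq assms tail_nonneg by (intro mult_mono) auto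
  also have "\<dots> = 1/8" by (simp add: power_add)
  finally show ?thesis using run_schedule[of K 0] by simp
qed

end

section \<open>Phase estimation\<close>

text \<open>Parseval for a matrix with orthonormal columns. It serves both the discrete Fourier
  transform and changes between the computational basis and the eigenbasis.\<close>

lemma isometry_sum:
  fixes V :: "'a \<Rightarrow> 'b \<Rightarrow> complex"
  assumes "finite K" "\<And>k l. k \<in> K \<Longrightarrow> l \<in> K \<Longrightarrow> (\<Sum>y\<in>Y. V y k * cnj (V y l)) = of_bool (k = l)"
  shows "(\<Sum>y\<in>Y. (cmod (\<Sum>k\<in>K. V y k * f k))\<^sup>2) = (\<Sum>k\<in>K. (cmod (f k))\<^sup>2)"
proof -
  have "complex_of_real (\<Sum>y\<in>Y. (cmod (\<Sum>k\<in>K. V y k * f k))\<^sup>2)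
    = (\<Sum>y\<in>Y. (\<Sum>k\<in>K. V y k * f k) * cnj (\<Sum>l\<in>K. V y l * f l))"
    by (simp only: of_real_sum complex_norm_square)
  also have "\<dots> = (\<Sum>y\<in>Y. \<Sum>k\<in>K. \<Sum>l\<in>K. f k * cnj (f l) * (V y k * cnj (V y l)))"
    by (simp add: sum_product mult_ac)
  also have "\<dots> = (\<Sum>k\<in>K. \<Sum>l\<in>K. \<Sum>y\<in>Y. f k * cnj (f l) * (V y k * cnj (V y l)))"
    by (subst sum.swap) (intro sum.cong refl sum.swap)
  also have "\<dots> = (\<Sum>k\<in>K. \<Sum>l\<in>K. f k * cnj (f l) * of_bool (k = l))"
    by (intro sum.cong refl) (simp only: sum_distrib_left[symmetric] assms)
  also have "\<dots> = (\<Sum>k\<in>K. f k * cnj (f k))"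
    using assms(1) by (simp add: of_bool_def if_distrib sum.delta cong: if_cong)
  also have "\<dots> = complex_of_real (\<Sum>k\<in>K. (cmod (f k))\<^sup>2)"
    by (simp only: of_real_sum complex_norm_square)
  finally show ?thesis by (simp only: of_real_eq_iff)
qed

text \<open>The inverse Fourier transform: the negative sign makes an input with phases cis
  \<theta>^k concentrate on those \<open>y\<close> with 2 pi y / M close to \<theta>.\<close>

definition dft :: "nat \<Rightarrow> nat \<Rightarrow> nat \<Rightarrow> complex" where
  "dft M y k = cis (- 2 * pi * real y * real k / real M) / of_real (sqrt (real M))"

lemma dft_sym: "dft M y k = dft M k y"
  by (simp add: dft_def mult_ac)

lemma dft_orthonormal:
  assumes "k < M" "l < M"
  shows "(\<Sum>y<M. dft M y k * cnj (dft M y l)) = of_bool (k = l)"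
proof -
  define w where "w = cis (2 * pi * (real l - real k) / real M)"
  have M: "0 < real M" using assms by simp
  have "dft M y k * cnj (dft M y l) = w ^ y / of_real (real M)" for y
  proof -
    have "dft M y k * cnj (dft M y l)
      = cis (- 2 * pi * real y * real k / real M) * cis (2 * pi * real y * real l / real M)
        / (of_real (sqrt (real M)) * of_real (sqrt (real M)))"
      by (simp add: dft_def cis_cnj)
    also have "of_real (sqrt (real M)) * of_real (sqrt (real M)) = (of_real (real M) :: complex)"
      by (simp flip: of_real_mult)
    also have "cis (- 2 * pi * real y * real k / real M) * cis (2 * pi * real y * real l / real M) = w ^ y"
      unfolding w_def by (simp add: cis_mult Complex.DeMoivre diff_divide_distrib algebra_simps)
    finally show ?thesis .
  qed
  then have s: "(\<Sum>y<M. dft M y k * cnj (dft M y l)) = (\<Sum>y<M. w ^ y) / of_real (real M)"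
    by (simp add: sum_divide_distrib)
  show ?thesis
  proof (cases "k = l")
    case True
    then have "w = 1" by (simp add: w_def)
    then show ?thesis using s True M by simp
  next
    case False
    have "w \<noteq> 1"
    proof
      assume "w = 1"
      then have "cos (2 * pi * (real l - real k) / real M) = 1" by (simp add: w_def complex_eq_iff)
      then obtain n :: int where "2 * pi * (real l - real k) / real M = of_int n * 2 * pi"
        unfolding cos_one_2pi_int by auto
      then have "(2 * pi) * (real l - real k) = (2 * pi) * (of_int n * real M)" using M by (simp add: field_simps)
      then have "real l - real k = of_int n * real M" by (simp only: mult_cancel_left) simp
      then have "of_int (int l - int k) = (of_int (n * int M) :: real)" by simp
      then have e: "int l - int k = n * int M" by (simp only: of_int_eq_iff)
      then have "n \<noteq> 0" using False by auto
      then have "1 * int M \<le> \<bar>n\<bar> * int M" by (intro mult_right_mono) auto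
      then have "\<bar>n * int M\<bar> \<ge> int M" by (simp add: abs_mult)
      moreover have "\<bar>int l - int k\<bar> < int M" using assms by auto
      ultimately show False using e by simp
    qed
    moreover have "w ^ M = 1"
    proof -
      have "w ^ M = cis (2 * pi * (real l - real k))" unfolding w_def using M by (simp add: Complex.DeMoivre)
      also have "\<dots> = 1" using cis_multiple_2pi[of "real l - real k"] by simp
      finally show ?thesis .
    qed
    ultimately have "(\<Sum>y<M. w ^ y) = 0" by (simp add: geometric_sum)
    then show ?thesis using s False by simp
  qed
qed

section \<open>The window on the phase register and its Fourier decay\<close>

lemma window_exists:
  "\<exists>c::nat \<Rightarrow> real. \<forall>z::complex. (\<Sum>k<Suc r * n. of_real (c k) * z ^ k) = (\<Sum>s<n. z ^ s) ^ Suc r"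
proof (induction r)
  case 0
  show ?case by (rule exI[of _ "\<lambda>_. 1"]) simp
next
  case (Suc r)
  then obtain c :: "nat \<Rightarrow> real" where c: "\<And>z::complex. (\<Sum>k<Suc r * n. of_real (c k) * z ^ k) = (\<Sum>s<n. z ^ s) ^ Suc r"
    by blast
  \<comment> \<open>Convolution with the all-ones sequence of length \<open>n\<close>, i.e.
    multiplication of the polynomial by 1 + z + ... + z^(n-1). The length \<open>Suc r * n\<close>
    exceeds the degree plus one; the excess coefficients are zero.\<close>
  define c' where "c' k = (\<Sum>s<n. if s \<le> k \<and> k - s < Suc r * n then c (k - s) else 0)" for k
  have "(\<Sum>k<Suc (Suc r) * n. of_real (c' k) * z ^ k) = (\<Sum>s<n. z ^ s) ^ Suc (Suc r)" for z :: complex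
  proof -
    have "(\<Sum>k<Suc (Suc r) * n. of_real (c' k) * z ^ k)
      = (\<Sum>k<Suc (Suc r) * n. \<Sum>s<n. if s \<le> k \<and> k - s < Suc r * n then of_real (c (k - s)) * z ^ k else 0)"
      unfolding c'_def of_real_sum sum_distrib_right by (intro sum.cong) auto
    also have "\<dots> = (\<Sum>s<n. \<Sum>k<Suc (Suc r) * n. if s \<le> k \<and> k - s < Suc r * n then of_real (c (k - s)) * z ^ k else 0)"
      by (rule sum.swap)
    also have "\<dots> = (\<Sum>s<n. \<Sum>k<Suc r * n. of_real (c k) * z ^ (k + s))"
    proof (rule sum.cong[OF refl])
      fix s assume s: "s \<in> {..<n}"
      have "(\<Sum>k<Suc (Suc r) * n. if s \<le> k \<and> k - s < Suc r * n then of_real (c (k - s)) * z ^ k else 0)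
        = (\<Sum>k | k < Suc (Suc r) * n \<and> s \<le> k \<and> k - s < Suc r * n. of_real (c (k - s)) * z ^ k)"
        by (subst sum.inter_filter[symmetric]) (auto intro: sum.cong)
      also have "\<dots> = (\<Sum>k<Suc r * n. of_real (c k) * z ^ (k + s))"
        by (rule sum.reindex_bij_witness[of _ "\<lambda>k. k + s" "\<lambda>k. k - s"]) (use s in auto)
      finally show "(\<Sum>k<Suc (Suc r) * n. if s \<le> k \<and> k - s < Suc r * n then of_real (c (k - s)) * z ^ k else 0)
        = (\<Sum>k<Suc r * n. of_real (c k) * z ^ (k + s))" .
    qed
    also have "\<dots> = (\<Sum>s<n. z ^ s) * (\<Sum>k<Suc r * n. of_real (c k) * z ^ k)"
      unfolding sum_product by (intro sum.cong refl) (simp add: power_add)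
    finally show ?thesis unfolding c by simp
  qed
  then show ?case by blast
qed

text \<open>A weak Jordan inequality: sin t \<ge> t - t^3 / 6, and t^2 \<le> 4 on this
  interval.\<close>

lemma sin_ge_third:
  assumes "0 \<le> t" "t \<le> pi / 2"
  shows "t / 3 \<le> sin (t::real)"
proof -
  have "\<bar>sin t - (\<Sum>m<3. sin_coeff m * t ^ m)\<bar> \<le> inverse (fact 3) * \<bar>t\<bar> ^ 3"
    by (rule Maclaurin_sin_bound)
  moreover have "(\<Sum>m<3. sin_coeff m * t ^ m) = t" by (simp add: eval_nat_numeral sin_coeff_def)
  ultimately have "t - t ^ 3 / 6 \<le> sin t" using assms unfolding abs_le_iff by (simp add: fact_numeral)
  moreover have "t * t \<le> 2 * 2" using assms pi_less_4 by (intro mult_mono) auto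
  then have "t * (t * t) \<le> t * 4" using assms by (intro mult_left_mono) auto
  ultimately show ?thesis by (simp add: power3_eq_cube)
qed

lemma sin_half_ge:
  assumes "\<delta> \<le> x" "x \<le> 2 * pi - \<delta>" "0 < \<delta>" "\<delta> < pi"
  shows "\<delta> / 6 \<le> sin (x / 2)"
proof -
  have "sin (\<delta> / 2) \<le> sin (x / 2)"
  proof (cases "x \<le> pi")
    case True
    then show ?thesis using assms by (intro sin_monotone_2pi_le) auto
  next
    case False
    have "sin (\<delta> / 2) \<le> sin (pi - x / 2)" using assms False by (intro sin_monotone_2pi_le) auto
    then show ?thesis by simp
  qed
  then show ?thesis using sin_ge_third[of "\<delta> / 2"] assms by simp
qed

text \<open>The geometric sum is (1 - z^n) / (1 - z); its numerator has modulus at most 2, and |1 -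
  cis x| = 2 |sin (x / 2)| \<ge> \<delta> / 3.\<close>

lemma dirichlet_bound:
  assumes "\<delta> \<le> \<bar>x\<bar>" "\<bar>x\<bar> \<le> 2 * pi - \<delta>" "0 < \<delta>" "\<delta> < pi"
  shows "cmod (\<Sum>s<n. cis x ^ s) \<le> 6 / \<delta>"
proof -
  have "(cmod (1 - cis x))\<^sup>2 = (1 - cos x)\<^sup>2 + (sin x)\<^sup>2" by (simp add: cmod_power2)
  also have "\<dots> = 2 - 2 * cos (2 * (\<bar>x\<bar> / 2))"
    using sin_cos_squared_add[of x] by (simp add: power2_eq_square algebra_simps)
  also have "\<dots> = (2 * sin (\<bar>x\<bar> / 2))\<^sup>2" by (simp only: cos_double_sin) (simp add: power2_eq_square)
  finally have e: "(cmod (1 - cis x))\<^sup>2 = (2 * sin (\<bar>x\<bar> / 2))\<^sup>2" .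
  have sp: "\<delta> / 6 \<le> sin (\<bar>x\<bar> / 2)" using sin_half_ge assms by blast
  have d: "\<delta> / 3 \<le> cmod (1 - cis x)"
    using power2_le_imp_le[of "2 * sin (\<bar>x\<bar> / 2)" "cmod (1 - cis x)"] e sp by simp
  then have "cis x \<noteq> 1" using assms by auto
  then have "cmod (\<Sum>s<n. cis x ^ s) = cmod (1 - cis x ^ n) / cmod (1 - cis x)"
    by (simp add: geometric_sum norm_divide norm_minus_commute)
  also have "\<dots> \<le> 2 / (\<delta> / 3)"
  proof (rule frac_le)
    show "cmod (1 - cis x ^ n) \<le> 2"
      using norm_triangle_ineq4[of 1 "cis x ^ n"] by (simp add: norm_power)
  qed (use d assms in auto)
  finally show ?thesis by simp
qed

text \<open>The amplitude at \<open>y\<close> is the (r+1)-st power of the Dirichlet kernel over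
  sqrt (M S). In its square, \<open>r\<close> of the squared factors are bounded pointwise by
  (6/\<delta>)^2 \<le> (n/4)^2, which is why 24/\<delta> is required of \<open>n\<close>. The
  remaining one is summed by Parseval, so no factor \<open>M\<close> is lost to counting outcomes.
  With S \<ge> n^(2r+2) / M this yields (r+1) / 16^r.\<close>

lemma qpe_window:
  assumes "0 < \<delta>" "\<delta> < pi" "24 / \<delta> \<le> real n" "M = Suc r * n"
  shows "\<exists>a::nat \<Rightarrow> real. (\<Sum>k<M. (a k)\<^sup>2) = 1 \<and>
    (\<forall>\<theta>. (\<Sum>y | y < M \<and> \<delta> \<le> \<bar>\<theta> - 2 * pi * real y / real M\<bar> \<and> \<bar>\<theta> - 2 * pi * real y / real M\<bar> \<le> 2 * pi - \<delta>.
       (cmod (\<Sum>k<M. dft M y k * (of_real (a k) * cis \<theta> ^ k)))\<^sup>2) \<le> 1 / 4 ^ r)"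
proof -
  have "0 < 24 / \<delta>" using assms by simp
  then have n0: "0 < real n" using assms by linarith
  then have M0: "0 < real M" unfolding assms(4) by (simp add: add_pos_nonneg)
  obtain c :: "nat \<Rightarrow> real" where c: "\<And>z::complex. (\<Sum>k<M. of_real (c k) * z ^ k) = (\<Sum>s<n. z ^ s) ^ Suc r"
    using window_exists[of r n] assms(4) by blast
  define S where "S = (\<Sum>k<M. (c k)\<^sup>2)"
  have "complex_of_real (\<Sum>k<M. c k) = of_real (real n ^ Suc r)" using c[of 1] by simp
  then have cs: "(\<Sum>k<M. c k) = real n ^ Suc r" by (simp only: of_real_eq_iff)
  define T where "T = (\<Sum>k<M. c k)"
  \<comment> \<open>Cauchy-Schwarz in the form of a nonnegative variance; the sum of the
    coefficients is the value of the window polynomial at 1.\<close>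
  have "0 \<le> (\<Sum>k<M. (c k - T / M)\<^sup>2)" by (intro sum_nonneg) auto
  also have "\<dots> = S - 2 * (T / M) * T + real M * (T / M)\<^sup>2"
    by (simp add: power2_diff sum.distrib sum_subtractf S_def T_def sum_distrib_left sum_distrib_right
        sum_divide_distrib mult_ac)
  also have "\<dots> = S - T\<^sup>2 / M" using M0 by (simp add: power2_eq_square field_simps)
  finally have S: "(real n ^ Suc r)\<^sup>2 \<le> S * real M" using cs M0 by (simp add: T_def field_simps)
  have S0: "0 < S"
  proof (rule ccontr)
    assume "\<not> 0 < S"
    then have "S * real M \<le> 0" using M0 by (simp add: mult_le_0_iff)
    moreover have "0 < (real n ^ Suc r)\<^sup>2" using n0 by simp
    ultimately show False using S by linarith
  qed
  define a where "a k = c k / sqrt S" for k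
  have "(\<Sum>k<M. (a k)\<^sup>2) = 1"
    using S0 unfolding a_def S_def by (simp add: power_divide flip: sum_divide_distrib)
  moreover have "(\<Sum>y | y < M \<and> \<delta> \<le> \<bar>\<theta> - 2 * pi * real y / real M\<bar> \<and> \<bar>\<theta> - 2 * pi * real y / real M\<bar> \<le> 2 * pi - \<delta>.
       (cmod (\<Sum>k<M. dft M y k * (of_real (a k) * cis \<theta> ^ k)))\<^sup>2) \<le> 1 / 4 ^ r" (is "sum _ ?Y \<le> _") for \<theta>
  proof -
    define D where "D y = (\<Sum>s<n. cis (\<theta> - 2 * pi * real y / real M) ^ s)" for y
    have tw: "dft M y k * cis \<theta> ^ k = cis (\<theta> - 2 * pi * real y / real M) ^ k / of_real (sqrt (real M))" for y k
      unfolding dft_def by (simp add: Complex.DeMoivre cis_mult algebra_simps)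
    have amp: "(\<Sum>k<M. dft M y k * (of_real (a k) * cis \<theta> ^ k)) = D y ^ Suc r / of_real (sqrt (real M) * sqrt S)" for y
    proof -
      have "(\<Sum>k<M. dft M y k * (of_real (a k) * cis \<theta> ^ k))
        = (\<Sum>k<M. of_real (c k) * (dft M y k * cis \<theta> ^ k) / of_real (sqrt S))"
        by (simp add: a_def mult_ac)
      also have "\<dots> = (\<Sum>k<M. of_real (c k) * cis (\<theta> - 2 * pi * real y / real M) ^ k) / of_real (sqrt (real M) * sqrt S)"
        unfolding tw by (simp add: sum_divide_distrib)
      finally show ?thesis unfolding c D_def .
    qed
    have ampsq: "(cmod (\<Sum>k<M. dft M y k * (of_real (a k) * cis \<theta> ^ k)))\<^sup>2 = (cmod (D y))\<^sup>2 / M * (((cmod (D y))\<^sup>2) ^ r / S)" for y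
      unfolding amp using S0 M0
      by (simp add: norm_divide norm_mult norm_power power_divide power_mult_distrib flip: power_mult)
         (simp add: mult.commute)
    \<comment> \<open>Parseval for the rectangular window of length \<open>n\<close>, padded to
      length \<open>M\<close>: its transform is a single Dirichlet kernel.\<close>
    have "(\<Sum>y<M. (cmod (\<Sum>k<M. dft M y k * (if k < n then cis \<theta> ^ k else 0)))\<^sup>2)
      = (\<Sum>k<M. (cmod (if k < n then cis \<theta> ^ k else 0))\<^sup>2)"
      by (rule isometry_sum) (auto simp: dft_orthonormal)
    also have "\<dots> = (\<Sum>k<n. 1)"
      using assms(4) by (intro sum.mono_neutral_cong_right) (auto simp: norm_power)
    finally have pars': "(\<Sum>y<M. (cmod (\<Sum>k<M. dft M y k * (if k < n then cis \<theta> ^ k else 0)))\<^sup>2) = real n" by simp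
    have "(\<Sum>k<M. dft M y k * (if k < n then cis \<theta> ^ k else 0)) = D y / of_real (sqrt (real M))" for y
    proof -
      have "(\<Sum>k<M. dft M y k * (if k < n then cis \<theta> ^ k else 0)) = (\<Sum>k<n. dft M y k * cis \<theta> ^ k)"
        using assms(4) by (intro sum.mono_neutral_cong_right) auto
      then show ?thesis unfolding tw D_def by (simp add: sum_divide_distrib)
    qed
    then have pars: "(\<Sum>y<M. (cmod (D y))\<^sup>2 / M) = real n"
      using M0 pars' by (simp add: norm_divide power_divide)
    have "sum (\<lambda>y. (cmod (\<Sum>k<M. dft M y k * (of_real (a k) * cis \<theta> ^ k)))\<^sup>2) ?Y
       \<le> (\<Sum>y\<in>?Y. (cmod (D y))\<^sup>2 / M * (((6 / \<delta>)\<^sup>2) ^ r / S))"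
      unfolding ampsq D_def using S0 M0 assms
      by (intro sum_mono mult_left_mono divide_right_mono power_mono dirichlet_bound) auto
    also have "\<dots> = (\<Sum>y\<in>?Y. (cmod (D y))\<^sup>2 / M) * (((6 / \<delta>)\<^sup>2) ^ r / S)" by (simp only: sum_distrib_right)
    also have "\<dots> \<le> (\<Sum>y<M. (cmod (D y))\<^sup>2 / M) * (((6 / \<delta>)\<^sup>2) ^ r / S)"
      using S0 assms M0 by (intro mult_right_mono sum_mono2) auto
    also have "\<dots> = real n * ((6 / \<delta>)\<^sup>2) ^ r / S" unfolding pars by simp
    also have "\<dots> \<le> real n * ((real n / 4)\<^sup>2) ^ r / S"
    proof -
      have "6 / \<delta> \<le> real n / 4" using assms by simp
      then show ?thesis using S0 n0 assms by (intro divide_right_mono mult_left_mono power_mono) auto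
    qed
    also have "\<dots> \<le> real n * ((real n / 4)\<^sup>2) ^ r / ((real n ^ Suc r)\<^sup>2 / real M)"
      using S M0 n0 S0 by (intro divide_left_mono) (auto simp: field_simps)
    also have "\<dots> = real (Suc r) / 16 ^ r"
    proof -
      have "((real n / 4)\<^sup>2) ^ r = (real n ^ r)\<^sup>2 / 16 ^ r"
        by (simp add: power_divide flip: power_mult) (simp add: mult.commute)
      then show ?thesis unfolding assms(4) using n0 by (simp add: power2_eq_square power_mult_distrib power_divide field_simps)
    qed
    also have "\<dots> \<le> 4 ^ r / 16 ^ r"
    proof -
      have "Suc r \<le> 4 ^ r" by (induction r) auto
      then have "real (Suc r) \<le> real (4 ^ r)" by (simp only: of_nat_le_iff)
      then show ?thesis by (intro divide_right_mono) auto
    qed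
    also have "\<dots> = 1 / 4 ^ r"
    proof -
      have "(16::real) ^ r = 4 ^ r * 4 ^ r" by (simp flip: power_mult_distrib)
      then show ?thesis by simp
    qed
    finally show ?thesis .
  qed
  ultimately show ?thesis by blast
qed

section \<open>Adjoints and unitaries\<close>

lemma mat_adjoint_index [simp]:
  "i < dim_col A \<Longrightarrow> j < dim_row A \<Longrightarrow> mat_adjoint (A :: complex mat) $$ (i, j) = cnj (A $$ (j, i))"
  by (simp add: mat_adjoint_def mat_of_rows_def)

lemma mat_adjoint_dim [simp]: "dim_row (mat_adjoint A) = dim_col A" "dim_col (mat_adjoint A) = dim_row A"
  by (auto simp: mat_adjoint_def mat_of_rows_def)

lemma mat_adjoint_carrier [simp]: "A \<in> carrier_mat n k \<Longrightarrow> mat_adjoint A \<in> carrier_mat k n"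
  by (intro carrier_matI) auto

lemma mat_adjoint_adjoint [simp]: "mat_adjoint (mat_adjoint (A :: complex mat)) = A"
  by (rule eq_matI) auto

lemma mult_vec_index:
  "i < dim_row A \<Longrightarrow> dim_col A = dim_vec v \<Longrightarrow> (A *\<^sub>v v) $ i = (\<Sum>j<dim_vec v. A $$ (i, j) * v $ j)"
  by (simp add: scalar_prod_def lessThan_atLeast0)

lemma cscalar_prod_sum: "dim_vec v = dim_vec w \<Longrightarrow> v \<bullet>c w = (\<Sum>i<dim_vec w. v $ i * cnj (w $ i))" for v w :: "complex vec"
  by (simp add: scalar_prod_def lessThan_atLeast0)

lemma mat_adjoint_cscalar_prod:
  fixes A :: "complex mat"
  assumes "A \<in> carrier_mat n k" "v \<in> carrier_vec k" "w \<in> carrier_vec n"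
  shows "(A *\<^sub>v v) \<bullet>c w = v \<bullet>c (mat_adjoint A *\<^sub>v w)"
proof -
  have "(A *\<^sub>v v) \<bullet>c w = (\<Sum>i<n. \<Sum>j<k. A $$ (i, j) * v $ j * cnj (w $ i))"
    using assms by (simp add: cscalar_prod_sum mult_vec_index sum_distrib_right del: index_mult_mat_vec)
  also have "\<dots> = (\<Sum>j<k. \<Sum>i<n. A $$ (i, j) * v $ j * cnj (w $ i))" by (rule sum.swap)
  also have "\<dots> = v \<bullet>c (mat_adjoint A *\<^sub>v w)"
    using assms by (simp add: cscalar_prod_sum mult_vec_index sum_distrib_left mult_ac del: index_mult_mat_vec)
  finally show ?thesis .
qed

lemma unitary_of_dimI:
  assumes "G \<in> carrier_mat n n" "G * mat_adjoint G = 1\<^sub>m n"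
  shows "unitary_of_dim n G"
  using assms mat_mult_left_right_inverse[OF assms(1) mat_adjoint_carrier[OF assms(1)] assms(2)]
  unfolding unitary_of_dim_def by blast

lemma unitary_of_dim_adjoint: "unitary_of_dim n G \<Longrightarrow> unitary_of_dim n (mat_adjoint G)"
  by (auto simp: unitary_of_dim_def)

lemma unitary_cscalar_prod:
  assumes "unitary_of_dim n G" "v \<in> carrier_vec n" "w \<in> carrier_vec n"
  shows "(G *\<^sub>v v) \<bullet>c (G *\<^sub>v w) = v \<bullet>c w"
proof -
  have G: "G \<in> carrier_mat n n" "mat_adjoint G * G = 1\<^sub>m n" using assms by (auto simp: unitary_of_dim_def)
  have "mat_adjoint G *\<^sub>v (G *\<^sub>v w) = w"
    using G assms by (subst assoc_mult_mat_vec[symmetric, of _ n n _ n]) auto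
  then show ?thesis using assms G mat_adjoint_cscalar_prod[of G n n v "G *\<^sub>v w"] by simp
qed

section \<open>Labelled basis states\<close>

lemma pair_code_less: "i < p \<Longrightarrow> j < q \<Longrightarrow> i * q + j < p * (q::nat)"
  using mult_le_mono1[of "Suc i" p q] by simp

text \<open>The basis of \<open>\<complex>\<^sup>N \<otimes> W\<close> is labelled by \<open>(i, y, hs, c)\<close>: the main register, the phase register,
  the \<open>R\<close> past measurement records, and the control qubit.\<close>

type_synonym label = "nat \<times> nat \<times> (nat \<times> nat) list \<times> nat"

locale layout =
  fixes N M R :: nat
  assumes N_pos: "0 < N" and M_pos: "0 < M"
begin

definition Hist :: "(nat \<times> nat) list set" where
  "Hist = {hs. set hs \<subseteq> {..<N} \<times> {..<M} \<and> length hs = R}"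

definition rest :: "(nat \<times> (nat \<times> nat) list \<times> nat) set" where
  "rest = {..<M} \<times> Hist \<times> {..<2}"

definition labels :: "label set" where
  "labels = {..<N} \<times> rest"

definition hist0 :: "(nat \<times> nat) list" where
  "hist0 = replicate R (0, 0)"

lemma finite_Hist [simp]: "finite Hist"
  unfolding Hist_def by (rule finite_lists_length_eq) simp

lemma hist0_in [simp]: "hist0 \<in> Hist"
  using N_pos M_pos by (auto simp: Hist_def hist0_def)

lemma finite_labels [simp]: "finite labels" "finite rest"
  by (auto simp: labels_def rest_def)

lemma hist_code_exists: "\<exists>f. bij_betw f Hist {..<card Hist} \<and> f hist0 = 0"
proof -
  obtain g where g: "bij_betw g (Hist - {hist0}) {0..<card (Hist - {hist0})}"
    using ex_bij_betw_finite_nat[of "Hist - {hist0}"] by auto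
  define f where "f x = (if x = hist0 then 0 else Suc (g x))" for x
  have c: "card Hist = Suc (card (Hist - {hist0}))" using card.remove[of Hist hist0] by simp
  have "inj_on f Hist" using g by (auto simp: inj_on_def f_def bij_betw_def)
  moreover have "f ` Hist \<subseteq> {..<card Hist}"
    using bij_betwE[OF g] unfolding c by (auto simp: f_def)
  ultimately have "bij_betw f Hist {..<card Hist}"
    by (simp add: bij_betw_def card_image card_subset_eq)
  then show ?thesis by (intro exI[of _ f]) (simp add: f_def)
qed

text \<open>Any numbering of the records will do, provided that the initial record gets 0: the
  algorithm starts in basis vector 0, which must carry the label with all registers at their initial
  values.\<close>

definition hist_code :: "(nat \<times> nat) list \<Rightarrow> nat" where
  "hist_code = (SOME f. bij_betw f Hist {..<card Hist} \<and> f hist0 = 0)"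

lemma hist_code: "bij_betw hist_code Hist {..<card Hist}" "hist_code hist0 = 0"
  using someI_ex[OF hist_code_exists] unfolding hist_code_def by auto

lemma hist_code_less: "hs \<in> Hist \<Longrightarrow> hist_code hs < card Hist"
  using bij_betwE[OF hist_code(1)] by auto

lemma hist_code_eq: "hs \<in> Hist \<Longrightarrow> hs' \<in> Hist \<Longrightarrow> hist_code hs = hist_code hs' \<longleftrightarrow> hs = hs'"
  using hist_code(1) by (auto simp: bij_betw_def inj_on_def)

definition L :: nat where "L = M * card Hist"

text \<open>Written in the shape \<open>a * 2 * b\<close> of a controlled query with
  \<open>a = L\<close> and \<open>b = 1\<close>: the control qubit is the last digit of the
  code.\<close>

definition W :: nat where "W = L * 2 * 1"

fun rest_code :: "nat \<times> (nat \<times> nat) list \<times> nat \<Rightarrow> nat" where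
  "rest_code (y, hs, c) = (y * card Hist + hist_code hs) * 2 + c"

declare rest_code.simps [simp del]

fun code :: "label \<Rightarrow> nat" where
  "code (i, r) = i * W + rest_code r"

lemma W_pos: "0 < W"
proof -
  have "Hist \<noteq> {}" using hist0_in by blast
  then show ?thesis using M_pos by (auto simp: W_def L_def card_gt_0_iff)
qed

lemma rest_code_less: "r \<in> rest \<Longrightarrow> rest_code r < W"
proof -
  assume "r \<in> rest"
  then obtain y hs c where "r = (y, hs, c)" "y < M" "hs \<in> Hist" "c < 2" by (auto simp: rest_def)
  then show ?thesis using pair_code_less[of _ _ c 2, OF pair_code_less[OF _ hist_code_less]]
    by (simp add: W_def L_def rest_code.simps)
qed

lemma rest_code_mod2: "(y, hs, c) \<in> rest \<Longrightarrow> rest_code (y, hs, c) mod 2 = c"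
  unfolding rest_code.simps mod_mult_self3 by (auto simp: rest_def)

lemma pair_code_eq:
  assumes "j < q" "j' < (q::nat)" shows "i * q + j = i' * q + j' \<longleftrightarrow> i = i' \<and> j = j'"
proof
  assume "i * q + j = i' * q + j'"
  then have "(i * q + j) div q = (i' * q + j') div q" "(i * q + j) mod q = (i' * q + j') mod q" by simp_all
  then show "i = i' \<and> j = j'" using assms by simp
qed simp

lemma rest_code_eq: "r \<in> rest \<Longrightarrow> r' \<in> rest \<Longrightarrow> rest_code r = rest_code r' \<longleftrightarrow> r = r'"
  by (auto simp: rest_def rest_code.simps pair_code_eq hist_code_less hist_code_eq simp del: distrib_right_numeral)

lemma code_less: "x \<in> labels \<Longrightarrow> code x < N * W"
  by (auto simp: labels_def intro!: pair_code_less rest_code_less)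

lemma code_div_mod: "r \<in> rest \<Longrightarrow> code (i, r) div W = i" "r \<in> rest \<Longrightarrow> code (i, r) mod W = rest_code r"
  using rest_code_less[of r] by auto

lemma bij_code: "bij_betw code labels {..<N * W}"
proof -
  have "inj_on code labels"
    by (auto simp: inj_on_def labels_def pair_code_eq rest_code_less rest_code_eq)
  moreover have "code ` labels \<subseteq> {..<N * W}" using code_less by auto
  moreover have "card labels = N * W"
    by (simp add: labels_def rest_def card_cartesian_product W_def L_def)
  ultimately show ?thesis by (simp add: bij_betw_def card_image card_subset_eq)
qed

definition decode :: "nat \<Rightarrow> label" where
  "decode = inv_into labels code"

lemma decode_code [simp]: "x \<in> labels \<Longrightarrow> decode (code x) = x"
  unfolding decode_def using bij_code by (simp add: bij_betw_def)

lemma code_decode [simp]: "k < N * W \<Longrightarrow> code (decode k) = k"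
  unfolding decode_def using bij_betw_inv_into_right[OF bij_code] by simp

lemma decode_in [simp]: "k < N * W \<Longrightarrow> decode k \<in> labels"
  unfolding decode_def using bij_betwE[OF bij_betw_inv_into[OF bij_code]] by simp

lemma bij_decode: "bij_betw decode {..<N * W} labels"
  unfolding decode_def by (rule bij_betw_inv_into[OF bij_code])

lemma sum_decode: "(\<Sum>k<N * W. f (decode k)) = (\<Sum>x\<in>labels. f x)"
  using sum.reindex_bij_betw[OF bij_decode] by simp

lemma sum_labels: "(\<Sum>x\<in>labels. f x) = (\<Sum>i<N. \<Sum>r\<in>rest. f (i, r))"
  unfolding labels_def by (simp add: sum.cartesian_product)

lemma sum_rest: "(\<Sum>r\<in>rest. f r) = (\<Sum>y<M. \<Sum>hs\<in>Hist. \<Sum>c<2. f (y, hs, c))"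
  unfolding rest_def by (simp add: sum.cartesian_product)

section \<open>States and operators as functions of labels\<close>

definition vec_of :: "(label \<Rightarrow> complex) \<Rightarrow> complex vec" where
  "vec_of \<Psi> = vec (N * W) (\<lambda>k. \<Psi> (decode k))"

definition mat_of :: "(label \<Rightarrow> label \<Rightarrow> complex) \<Rightarrow> complex mat" where
  "mat_of g = mat (N * W) (N * W) (\<lambda>(k, l). g (decode k) (decode l))"

lemma vec_of_carrier [simp]: "vec_of \<Psi> \<in> carrier_vec (N * W)" "dim_vec (vec_of \<Psi>) = N * W"
  by (simp_all add: vec_of_def)

lemma mat_of_carrier [simp]: "mat_of g \<in> carrier_mat (N * W) (N * W)"
  by (simp add: mat_of_def)

lemma vec_of_index [simp]: "k < N * W \<Longrightarrow> vec_of \<Psi> $ k = \<Psi> (decode k)"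
  by (simp add: vec_of_def)

lemma vec_of_eq_iff: "vec_of \<Psi> = vec_of \<Phi> \<longleftrightarrow> (\<forall>x\<in>labels. \<Psi> x = \<Phi> x)"
proof
  assume e: "vec_of \<Psi> = vec_of \<Phi>"
  show "\<forall>x\<in>labels. \<Psi> x = \<Phi> x"
  proof
    fix x assume "x \<in> labels"
    then show "\<Psi> x = \<Phi> x" using arg_cong[OF e, of "\<lambda>v. v $ code x"] by (simp add: code_less)
  qed
qed (auto intro!: eq_vecI)

lemma vec_of_cong: "(\<And>x. x \<in> labels \<Longrightarrow> \<Psi> x = \<Phi> x) \<Longrightarrow> vec_of \<Psi> = vec_of \<Phi>"
  by (simp add: vec_of_eq_iff)

lemma vec_of_exists:
  assumes "v \<in> carrier_vec (N * W)" obtains \<Psi> where "v = vec_of \<Psi>"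
proof
  show "v = vec_of (\<lambda>x. v $ code x)" using assms by (intro eq_vecI) auto
qed

lemma vec_of_add: "vec_of \<Psi> + vec_of \<Phi> = vec_of (\<lambda>x. \<Psi> x + \<Phi> x)"
  by (rule eq_vecI) auto

lemma vec_of_smult: "a \<cdot>\<^sub>v vec_of \<Psi> = vec_of (\<lambda>x. a * \<Psi> x)"
  by (rule eq_vecI) auto

lemma vec_of_cscalar_prod: "vec_of \<Psi> \<bullet>c vec_of \<Phi> = (\<Sum>x\<in>labels. \<Psi> x * cnj (\<Phi> x))"
  by (simp add: cscalar_prod_sum sum_decode[of "\<lambda>x. \<Psi> x * cnj (\<Phi> x)", symmetric])

lemma mat_of_mult_vec: "mat_of g *\<^sub>v vec_of \<Psi> = vec_of (\<lambda>x. \<Sum>x'\<in>labels. g x x' * \<Psi> x')"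
proof (rule eq_vecI)
  fix k assume "k < dim_vec (vec_of (\<lambda>x. \<Sum>x'\<in>labels. g x x' * \<Psi> x'))"
  then show "(mat_of g *\<^sub>v vec_of \<Psi>) $ k = vec_of (\<lambda>x. \<Sum>x'\<in>labels. g x x' * \<Psi> x') $ k"
    by (subst mult_vec_index) (auto simp: mat_of_def sum_decode[of "\<lambda>x. g (decode k) x * \<Psi> x", symmetric])
qed (simp add: mat_of_def)

lemma mat_of_adjoint: "mat_adjoint (mat_of g) = mat_of (\<lambda>x x'. cnj (g x' x))"
  by (rule eq_matI) (auto simp: mat_of_def)

lemma mat_of_mult: "mat_of g * mat_of h = mat_of (\<lambda>x x'. \<Sum>z\<in>labels. g x z * h z x')"
proof (rule eq_matI)
  fix k l assume "k < dim_row (mat_of (\<lambda>x x'. \<Sum>z\<in>labels. g x z * h z x'))"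
    "l < dim_col (mat_of (\<lambda>x x'. \<Sum>z\<in>labels. g x z * h z x'))"
  then show "(mat_of g * mat_of h) $$ (k, l) = mat_of (\<lambda>x x'. \<Sum>z\<in>labels. g x z * h z x') $$ (k, l)"
    by (auto simp: mat_of_def scalar_prod_def lessThan_atLeast0[symmetric]
        sum_decode[of "\<lambda>z. g (decode k) z * h z (decode l)", symmetric])
qed (auto simp: mat_of_def)

lemma mat_of_unitary:
  assumes "\<And>x x'. x \<in> labels \<Longrightarrow> x' \<in> labels \<Longrightarrow> (\<Sum>z\<in>labels. g x z * cnj (g x' z)) = of_bool (x = x')"
  shows "unitary_of_dim (N * W) (mat_of g)"
proof (rule unitary_of_dimI)
  show "mat_of g * mat_adjoint (mat_of g) = 1\<^sub>m (N * W)"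
    unfolding mat_of_adjoint mat_of_mult
  proof (rule eq_matI)
    fix k l assume kl: "k < dim_row (1\<^sub>m (N * W) :: complex mat)" "l < dim_col (1\<^sub>m (N * W) :: complex mat)"
    then have "decode k = decode l \<longleftrightarrow> k = l" using bij_decode by (auto simp: bij_betw_def inj_on_def)
    then show "mat_of (\<lambda>x x'. \<Sum>z\<in>labels. g x z * cnj (g x' z)) $$ (k, l) = 1\<^sub>m (N * W) $$ (k, l)"
      using kl assms by (auto simp: mat_of_def)
  qed (auto simp: mat_of_def)
qed simp

text \<open>An operator on the main register that may depend on the basis state of the rest; this
  covers the advice unitary and controlled queries alike.\<close>

definition main_kernel :: "(nat \<times> (nat \<times> nat) list \<times> nat \<Rightarrow> nat \<Rightarrow> nat \<Rightarrow> complex) \<Rightarrow> label \<Rightarrow> label \<Rightarrow> complex" where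
  "main_kernel V = (\<lambda>(i, r) (i', r'). if r = r' then V r i i' else 0)"

definition phase_kernel :: "(nat \<Rightarrow> nat \<Rightarrow> complex) \<Rightarrow> label \<Rightarrow> label \<Rightarrow> complex" where
  "phase_kernel V = (\<lambda>(i, y, r) (i', y', r'). if i = i' \<and> r = r' then V y y' else 0)"

text \<open>As a matrix this pulls amplitudes back along \<open>p\<close>, so the basis state
  \<open>p x\<close> is sent to \<open>x\<close>: the gate performs the inverse of
  \<open>p\<close>.\<close>

definition perm_kernel :: "(label \<Rightarrow> label) \<Rightarrow> label \<Rightarrow> label \<Rightarrow> complex" where
  "perm_kernel p x x' = of_bool (p x = x')"

definition diag_kernel :: "(label \<Rightarrow> complex) \<Rightarrow> label \<Rightarrow> label \<Rightarrow> complex" where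
  "diag_kernel s x x' = (if x = x' then s x else 0)"

lemma main_kernel_sum:
  assumes "r \<in> rest"
  shows "(\<Sum>x'\<in>labels. main_kernel V (i, r) x' * \<Psi> x') = (\<Sum>i'<N. V r i i' * \<Psi> (i', r))"
proof -
  have "(\<Sum>x'\<in>labels. main_kernel V (i, r) x' * \<Psi> x')
    = (\<Sum>i'<N. \<Sum>r'\<in>rest. if r = r' then V r i i' * \<Psi> (i', r) else 0)"
    unfolding sum_labels by (intro sum.cong refl) (auto simp: main_kernel_def)
  then show ?thesis using assms by (simp add: sum.delta')
qed

lemma phase_kernel_sum:
  assumes "(i, y, hs, c) \<in> labels"
  shows "(\<Sum>x'\<in>labels. phase_kernel V (i, y, hs, c) x' * \<Psi> x') = (\<Sum>y'<M. V y y' * \<Psi> (i, y', hs, c))"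
proof -
  have i: "i < N" "hs \<in> Hist" "c < 2" using assms by (auto simp: labels_def rest_def)
  have "(\<Sum>x'\<in>labels. phase_kernel V (i, y, hs, c) x' * \<Psi> x')
    = (\<Sum>i'<N. \<Sum>y'<M. \<Sum>hs'\<in>Hist. \<Sum>c'<2. if c' = c then if hs' = hs then if i' = i then V y y' * \<Psi> (i', y', hs', c') else 0 else 0 else 0)"
    unfolding sum_labels sum_rest by (intro sum.cong refl) (auto simp: phase_kernel_def)
  also have "\<dots> = (\<Sum>i'<N. \<Sum>y'<M. if i' = i then V y y' * \<Psi> (i', y', hs, c) else 0)"
    using i by (simp add: sum.delta)
  also have "\<dots> = (\<Sum>y'<M. \<Sum>i'<N. if i' = i then V y y' * \<Psi> (i', y', hs, c) else 0)"
    by (rule sum.swap)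
  finally show ?thesis using i by (simp add: sum.delta)
qed

lemma perm_kernel_sum: "p x \<in> labels \<Longrightarrow> (\<Sum>x'\<in>labels. perm_kernel p x x' * \<Psi> x') = \<Psi> (p x)"
proof -
  assume "p x \<in> labels"
  moreover have "(\<Sum>x'\<in>labels. perm_kernel p x x' * \<Psi> x') = (\<Sum>x'\<in>labels. if p x = x' then \<Psi> (p x) else 0)"
    by (intro sum.cong refl) (auto simp: perm_kernel_def)
  ultimately show ?thesis by (simp add: sum.delta')
qed

lemma diag_kernel_sum: "x \<in> labels \<Longrightarrow> (\<Sum>x'\<in>labels. diag_kernel s x x' * \<Psi> x') = s x * \<Psi> x"
proof -
  assume "x \<in> labels"
  moreover have "(\<Sum>x'\<in>labels. diag_kernel s x x' * \<Psi> x') = (\<Sum>x'\<in>labels. if x = x' then s x * \<Psi> x else 0)"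
    by (intro sum.cong refl) (auto simp: diag_kernel_def)
  ultimately show ?thesis by (simp add: sum.delta')
qed

lemma main_kernel_unitary:
  assumes "\<And>r i i'. r \<in> rest \<Longrightarrow> i < N \<Longrightarrow> i' < N \<Longrightarrow> (\<Sum>z<N. V r i z * cnj (V r i' z)) = of_bool (i = i')"
  shows "unitary_of_dim (N * W) (mat_of (main_kernel V))"
proof (rule mat_of_unitary)
  fix x x' assume x: "x \<in> labels" "x' \<in> labels"
  obtain i r i' r' where e: "x = (i, r)" "x' = (i', r')" by (cases x; cases x')
  have r: "r \<in> rest" "i < N" "i' < N" using x e by (auto simp: labels_def)
  have "(\<Sum>z\<in>labels. main_kernel V x z * cnj (main_kernel V x' z)) = (\<Sum>z<N. V r i z * cnj (main_kernel V x' (z, r)))"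
    unfolding e(1) by (rule main_kernel_sum[OF r(1)])
  also have "\<dots> = of_bool (x = x')"
    using assms[OF r] by (cases "r = r'") (auto simp: e main_kernel_def)
  finally show "(\<Sum>z\<in>labels. main_kernel V x z * cnj (main_kernel V x' z)) = of_bool (x = x')" .
qed

lemma phase_kernel_unitary:
  assumes "\<And>i i'. i < M \<Longrightarrow> i' < M \<Longrightarrow> (\<Sum>z<M. V i z * cnj (V i' z)) = of_bool (i = i')"
  shows "unitary_of_dim (N * W) (mat_of (phase_kernel V))"
proof (rule mat_of_unitary)
  fix x x' assume x: "x \<in> labels" "x' \<in> labels"
  obtain i y hs c i' y' r' where e: "x = (i, y, hs, c)" "x' = (i', y', r')" by (cases x; cases x')
  have r: "(i, y, hs, c) \<in> labels" "y < M" "y' < M" using x e by (auto simp: labels_def rest_def)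
  have "(\<Sum>z\<in>labels. phase_kernel V x z * cnj (phase_kernel V x' z)) = (\<Sum>z<M. V y z * cnj (phase_kernel V x' (i, z, hs, c)))"
    unfolding e(1) by (rule phase_kernel_sum[OF r(1)])
  also have "\<dots> = of_bool (x = x')"
    using assms[OF r(2,3)] by (cases "i = i' \<and> r' = (hs, c)") (auto simp: e phase_kernel_def)
  finally show "(\<Sum>z\<in>labels. phase_kernel V x z * cnj (phase_kernel V x' z)) = of_bool (x = x')" .
qed

lemma perm_kernel_unitary:
  assumes "inj_on p labels" "p ` labels \<subseteq> labels"
  shows "unitary_of_dim (N * W) (mat_of (perm_kernel p))"
proof (rule mat_of_unitary)
  fix x x' assume x: "x \<in> labels" "x' \<in> labels"
  have "(\<Sum>z\<in>labels. perm_kernel p x z * cnj (perm_kernel p x' z)) = cnj (perm_kernel p x' (p x))"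
    using x assms by (intro perm_kernel_sum) auto
  then show "(\<Sum>z\<in>labels. perm_kernel p x z * cnj (perm_kernel p x' z)) = of_bool (x = x')"
    using x assms by (auto simp: perm_kernel_def inj_on_def)
qed

lemma diag_kernel_unitary:
  assumes "\<And>x. x \<in> labels \<Longrightarrow> s x * cnj (s x) = 1"
  shows "unitary_of_dim (N * W) (mat_of (diag_kernel s))"
proof (rule mat_of_unitary)
  fix x x' assume x: "x \<in> labels" "x' \<in> labels"
  have "(\<Sum>z\<in>labels. diag_kernel s x z * cnj (diag_kernel s x' z)) = s x * cnj (diag_kernel s x' x)"
    using diag_kernel_sum[OF x(1), of s "\<lambda>z. cnj (diag_kernel s x' z)"] .
  then show "(\<Sum>z\<in>labels. diag_kernel s x z * cnj (diag_kernel s x' z)) = of_bool (x = x')"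
    using x assms by (auto simp: diag_kernel_def)
qed

lemma kron_main:
  assumes "A \<in> carrier_mat N N"
  shows "kron A (1\<^sub>m W) = mat_of (main_kernel (\<lambda>r i i'. A $$ (i, i')))"
proof (rule eq_matI)
  fix k l assume "k < dim_row (mat_of (main_kernel (\<lambda>r i i'. A $$ (i, i'))))"
    "l < dim_col (mat_of (main_kernel (\<lambda>r i i'. A $$ (i, i'))))"
  then have kl: "k < N * W" "l < N * W" by (auto simp: mat_of_def)
  obtain i r i' r' where e: "decode k = (i, r)" "decode l = (i', r')" by (cases "decode k"; cases "decode l")
  have r: "r \<in> rest" "r' \<in> rest" using decode_in[OF kl(1)] decode_in[OF kl(2)] e by (auto simp: labels_def)
  have c: "code (i, r) = k" "code (i', r') = l" using code_decode[OF kl(1)] code_decode[OF kl(2)] unfolding e .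
  have "kron A (1\<^sub>m W) $$ (k, l) = A $$ (k div W, l div W) * of_bool (k mod W = l mod W)"
    using assms kl W_pos by (simp add: kron_def)
  also have "\<dots> = A $$ (i, i') * of_bool (r = r')"
    unfolding c[symmetric] code_div_mod[OF r(1)] code_div_mod[OF r(2)] rest_code_eq[OF r] ..
  finally show "kron A (1\<^sub>m W) $$ (k, l) = mat_of (main_kernel (\<lambda>r i i'. A $$ (i, i'))) $$ (k, l)"
    using kl by (simp add: mat_of_def main_kernel_def e)
qed (use assms in \<open>auto simp: kron_def mat_of_def\<close>)

lemma kron_one: "kron X (1\<^sub>m 1) = X"
  by (rule eq_matI) (auto simp: kron_def)

lemma qubit_proj_index:
  assumes "w < W" "w' < W"
  shows "qubit_proj L 1 c $$ (w, w') = of_bool (w = w' \<and> w mod 2 = c)"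
proof -
  have d: "w div 2 < L" "w' div 2 < L" "w < L * 2" "w' < L * 2" using assms by (auto simp: W_def)
  have e: "w = w'" if "w div 2 = w' div 2" "w mod 2 = w' mod 2"
  proof -
    have "w = w div 2 * 2 + w mod 2" by (rule div_mult_mod_eq[symmetric])
    also have "\<dots> = w'" unfolding that by (rule div_mult_mod_eq)
    finally show ?thesis .
  qed
  have "qubit_proj L 1 c $$ (w, w') = 1\<^sub>m L $$ (w div 2, w' div 2) * basis_proj c $$ (w mod 2, w' mod 2)"
    unfolding qubit_proj_def kron_one using d(3,4) by (simp add: kron_def basis_proj_def)
  also have "\<dots> = of_bool (w div 2 = w' div 2) * of_bool (w mod 2 = c \<and> w' mod 2 = c)"
    using d(1,2) by (simp add: basis_proj_def)
  also have "\<dots> = of_bool (w = w' \<and> w mod 2 = c)" using e by (cases "w = w'") auto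
  finally show ?thesis .
qed

lemma qubit_proj_dim: "dim_row (qubit_proj L 1 c) = W" "dim_col (qubit_proj L 1 c) = W"
  unfolding qubit_proj_def kron_one by (simp_all add: kron_def basis_proj_def W_def)

lemma controlled_main:
  assumes "V \<in> carrier_mat N N"
  shows "controlled N L 1 V
    = mat_of (main_kernel (\<lambda>(y, hs, c) i i'. if c = 0 then of_bool (i = i') else V $$ (i, i')))"
    (is "_ = mat_of (main_kernel ?V)")
proof (rule eq_matI)
  fix k l assume "k < dim_row (mat_of (main_kernel ?V))" "l < dim_col (mat_of (main_kernel ?V))"
  then have kl: "k < N * W" "l < N * W" by (auto simp: mat_of_def)
  obtain i y hs c i' r' where e: "decode k = (i, (y, hs, c))" "decode l = (i', r')"
    by (cases "decode k"; cases "decode l")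
  have r: "(y, hs, c) \<in> rest" "r' \<in> rest" "i < N" "i' < N"
    using decode_in[OF kl(1)] decode_in[OF kl(2)] e by (auto simp: labels_def)
  have cc: "c < 2" using r by (auto simp: rest_def)
  have cd: "code (i, (y, hs, c)) = k" "code (i', r') = l" using code_decode[OF kl(1)] code_decode[OF kl(2)] unfolding e .
  have dm: "k div W = i" "l div W = i'" "k mod W = rest_code (y, hs, c)" "l mod W = rest_code r'"
    unfolding cd[symmetric] using code_div_mod r by blast+
  have "controlled N L 1 V $$ (k, l)
     = 1\<^sub>m N $$ (k div W, l div W) * qubit_proj L 1 0 $$ (k mod W, l mod W)
       + V $$ (k div W, l div W) * qubit_proj L 1 1 $$ (k mod W, l mod W)"
    using assms kl by (simp add: controlled_def kron_def qubit_proj_dim del: One_nat_def)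
  also have "\<dots> = of_bool (i = i') * of_bool ((y, hs, c) = r' \<and> c = 0) + V $$ (i, i') * of_bool ((y, hs, c) = r' \<and> c = 1)"
    unfolding dm using r rest_code_less[OF r(1)] rest_code_less[OF r(2)]
    by (simp add: qubit_proj_index rest_code_eq[OF r(1,2)] rest_code_mod2 del: One_nat_def)
  finally show "controlled N L 1 V $$ (k, l) = mat_of (main_kernel ?V) $$ (k, l)"
    using kl cc by (auto simp: mat_of_def main_kernel_def e)
qed (use assms in \<open>auto simp: controlled_def kron_def mat_of_def qubit_proj_dim simp del: One_nat_def\<close>)

end

section \<open>The circuit\<close>

fun gate_inv :: "gate \<Rightarrow> gate" where
  "gate_inv (Free G) = Free (mat_adjoint G)"
| "gate_inv QueryU = QueryU_inv"
| "gate_inv QueryU_inv = QueryU"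
| "gate_inv (CtrlU a b) = CtrlU_inv a b"
| "gate_inv (CtrlU_inv a b) = CtrlU a b"
| "gate_inv Advice = Advice_inv"
| "gate_inv Advice_inv = Advice"

lemma gate_inv_query [simp]: "is_U_query (gate_inv g) = is_U_query g" "is_advice_query (gate_inv g) = is_advice_query g"
  by (cases g; simp)+

text \<open>The Householder reflection exchanging the basis vector 0 with the real unit vector
  \<open>a\<close>, so that a single input-independent unitary prepares the window. If
  \<open>a\<close> is that basis vector, the denominator is 0, and division by zero turns the
  formula into the identity.\<close>

definition householder :: "nat \<Rightarrow> (nat \<Rightarrow> real) \<Rightarrow> nat \<Rightarrow> nat \<Rightarrow> real" where
  "householder M a y z = of_bool (y = z) -
     2 * (of_bool (y = 0) - a y) * (of_bool (z = 0) - a z) / (\<Sum>k<M. (of_bool (k = 0) - a k)\<^sup>2)"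

lemma householder_orthonormal:
  assumes "y < M" "z < M"
  shows "(\<Sum>k<M. householder M a y k * householder M a z k) = of_bool (y = z)"
proof -
  define w where "w k = of_bool (k = 0) - a k" for k
  define S where "S = (\<Sum>k<M. (w k)\<^sup>2)"
  have h: "householder M a y k = of_bool (y = k) - 2 * w y * w k / S" for y k
    by (simp add: householder_def w_def S_def)
  have "(\<Sum>k<M. householder M a y k * householder M a z k)
    = (\<Sum>k<M. of_bool (y = k) * of_bool (z = k) - 2 * w z / S * (of_bool (y = k) * w k)
        - 2 * w y / S * (of_bool (z = k) * w k) + 4 * w y * w z / S\<^sup>2 * (w k)\<^sup>2)"
    unfolding h by (intro sum.cong refl) (simp add: algebra_simps power2_eq_square)
  also have "\<dots> = (\<Sum>k<M. of_bool (y = k) * of_bool (z = k)) - 2 * w z / S * (\<Sum>k<M. of_bool (y = k) * w k)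
        - 2 * w y / S * (\<Sum>k<M. of_bool (z = k) * w k) + 4 * w y * w z / S\<^sup>2 * S"
    by (simp only: sum.distrib sum_subtractf sum_distrib_left S_def)
  also have "(\<Sum>k<M. of_bool (y = k) * w k) = w y" using assms by (simp add: of_bool_def if_distrib[of "\<lambda>x. x * w _"] sum.delta' cong: if_cong)
  also have "(\<Sum>k<M. of_bool (z = k) * w k) = w z" using assms by (simp add: of_bool_def if_distrib[of "\<lambda>x. x * w _"] sum.delta' cong: if_cong)
  also have "(\<Sum>k<M. of_bool (y = k) * of_bool (z = k)) = (\<Sum>k<M. if y = k then of_bool (y = z) else (0::real))"
    by (intro sum.cong refl) auto
  also have "\<dots> = of_bool (y = z)" using assms by (simp add: sum.delta')
  also have "of_bool (y = z) - 2 * w z / S * w y - 2 * w y / S * w z + 4 * w y * w z / S\<^sup>2 * S = of_bool (y = z)"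
    by (cases "S = 0") (simp_all add: power2_eq_square field_simps)
  finally show ?thesis .
qed

lemma householder_0:
  assumes "(\<Sum>k<M. (a k)\<^sup>2) = 1" "y < M"
  shows "householder M a y 0 = a y"
proof -
  define w where "w k = of_bool (k = 0) - a k" for k
  define S where "S = (\<Sum>k<M. (w k)\<^sup>2)"
  have "S = (\<Sum>k<M. (if k = 0 then 1 - 2 * a 0 else 0) + (a k)\<^sup>2)"
    unfolding S_def w_def by (intro sum.cong refl) (auto simp: power2_eq_square algebra_simps)
  also have "\<dots> = 2 * (1 - a 0)" using assms by (simp add: sum.distrib sum.delta)
  \<comment> \<open>The squared distance of two unit vectors is twice one minus their inner product,
    here \<open>a 0\<close>.\<close>
  finally have S: "S = 2 * w 0" by (simp add: w_def)
  have h: "householder M a y 0 = of_bool (y = 0) - 2 * w y * w 0 / S"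
    by (simp add: householder_def w_def S_def)
  show ?thesis
  proof (cases "S = 0")
    case True
    then have "w y = 0" using assms(2) unfolding S_def by (subst (asm) sum_nonneg_eq_0_iff) auto
    then show ?thesis unfolding h by (simp add: w_def)
  next
    case False
    then have "2 * w y * w 0 / S = w y" unfolding S by simp
    then show ?thesis unfolding h by (simp add: w_def)
  qed
qed

context layout
begin

fun ok_gate :: "gate \<Rightarrow> bool" where
  "ok_gate (Free G) \<longleftrightarrow> unitary_of_dim (N * W) G"
| "ok_gate (CtrlU a b) \<longleftrightarrow> a = L \<and> b = 1"
| "ok_gate (CtrlU_inv a b) \<longleftrightarrow> a = L \<and> b = 1"
| "ok_gate _ \<longleftrightarrow> True"

lemma ok_gate_wf: "ok_gate g \<Longrightarrow> wf_gate N W g"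
  by (cases g) (auto simp: W_def)

lemma ok_gate_inv: "ok_gate g \<Longrightarrow> ok_gate (gate_inv g)"
  by (cases g) (auto simp: unitary_of_dim_adjoint)

text \<open>Computes the comparison \<open>s < y\<close> into the control qubit. It is an involution
  on labels, so repeating it after the controlled query uncomputes the bit.\<close>

definition toggle :: "nat \<Rightarrow> label \<Rightarrow> label" where
  "toggle s = (\<lambda>(i, y, hs, c). (i, y, hs, if s < y then 1 - c else c))"

definition phase_gate :: "(nat \<Rightarrow> nat \<Rightarrow> complex) \<Rightarrow> gate" where
  "phase_gate V = Free (mat_of (phase_kernel V))"

definition toggle_gate :: "nat \<Rightarrow> gate" where
  "toggle_gate s = Free (mat_of (perm_kernel (toggle s)))"

definition sign_gate :: "(label \<Rightarrow> bool) \<Rightarrow> gate" where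
  "sign_gate Q = Free (mat_of (diag_kernel (\<lambda>x. if Q x then - 1 else 1)))"

definition power_gates :: "nat \<Rightarrow> gate list" where
  "power_gates k = concat (map (\<lambda>s. [toggle_gate s, CtrlU L 1, toggle_gate s]) [0..<k])"

text \<open>Phase estimation of \<open>U\<close> on the advice state, with window \<open>a\<close> on the phase register; the
  controlled powers apply \<open>U\<close> at step \<open>s\<close> iff \<open>s\<close> is below the content of the phase register.\<close>

definition prep :: "(nat \<Rightarrow> real) \<Rightarrow> gate list" where
  "prep a = [phase_gate (\<lambda>y z. of_real (householder M a y z)), Advice]
     @ power_gates M @ [phase_gate (dft M)]"

text \<open>The record is left unconstrained, so that the reflection acts separately within each
  branch of past outcomes.\<close>

definition at_origin :: "label \<Rightarrow> bool" where
  "at_origin = (\<lambda>(i, y, hs, c). i = 0 \<and> y = 0 \<and> c = 0)"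

definition reflect :: "(nat \<Rightarrow> real) \<Rightarrow> gate list" where
  "reflect a = rev (map gate_inv (prep a)) @ [sign_gate (\<lambda>x. \<not> at_origin x)] @ prep a"

lemma toggle_in: "x \<in> labels \<Longrightarrow> toggle s x \<in> labels"
  by (auto simp: toggle_def labels_def rest_def)

lemma toggle_inj: "inj_on (toggle s) labels"
  by (auto simp: inj_on_def toggle_def labels_def rest_def split: if_splits)

lemma ok_toggle_gate: "ok_gate (toggle_gate s)"
  unfolding toggle_gate_def ok_gate.simps by (intro perm_kernel_unitary toggle_inj image_subsetI toggle_in)

lemma ok_sign_gate: "ok_gate (sign_gate Q)"
  unfolding sign_gate_def ok_gate.simps by (intro diag_kernel_unitary) auto

lemma ok_power_gates: "list_all ok_gate (power_gates k)"
  by (auto simp: power_gates_def list_all_iff ok_toggle_gate)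

lemma ok_phase_householder: "ok_gate (phase_gate (\<lambda>y z. of_real (householder M a y z)))"
  unfolding phase_gate_def ok_gate.simps
  by (intro phase_kernel_unitary)
    (simp flip: of_real_mult of_real_sum add: householder_orthonormal)

lemma ok_phase_dft: "ok_gate (phase_gate (dft M))"
  unfolding phase_gate_def ok_gate.simps
proof (intro phase_kernel_unitary)
  fix i i' assume "i < M" "i' < M"
  then show "(\<Sum>z<M. dft M i z * cnj (dft M i' z)) = of_bool (i = i')"
    using dft_orthonormal[of i M i'] by (simp add: dft_sym[of M i] dft_sym[of M i'])
qed

lemma ok_prep: "list_all ok_gate (prep a)"
  by (simp add: prep_def ok_power_gates ok_phase_householder ok_phase_dft)

lemma ok_reflect: "list_all ok_gate (reflect a)"
  using ok_prep[of a] by (auto simp: reflect_def ok_sign_gate list_all_iff ok_gate_inv)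

lemma mat_of_cong: "(\<And>x x'. x \<in> labels \<Longrightarrow> x' \<in> labels \<Longrightarrow> g x x' = h x x') \<Longrightarrow> mat_of g = mat_of h"
  unfolding mat_of_def by (intro cong_mat) auto

end

section \<open>Action of the gates on labelled states\<close>

locale circuit = layout N M R for N M R +
  fixes U A :: "complex mat"
  assumes U_unitary: "unitary_of_dim N U" and A_unitary: "unitary_of_dim N A"
begin

lemma unitary_rows:
  assumes "unitary_of_dim N V" "i < N" "i' < N"
  shows "(\<Sum>z<N. V $$ (i, z) * cnj (V $$ (i', z))) = of_bool (i = i')"
proof -
  have V: "V \<in> carrier_mat N N" "V * mat_adjoint V = 1\<^sub>m N" using assms by (auto simp: unitary_of_dim_def)
  have "(V * mat_adjoint V) $$ (i, i') = (\<Sum>z<N. V $$ (i, z) * cnj (V $$ (i', z)))"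
    using V(1) assms by (simp add: scalar_prod_def lessThan_atLeast0)
  then have "(\<Sum>z<N. V $$ (i, z) * cnj (V $$ (i', z))) = 1\<^sub>m N $$ (i, i')" unfolding V(2) by simp
  then show ?thesis using assms by simp
qed

lemma dims [simp]: "U \<in> carrier_mat N N" "A \<in> carrier_mat N N"
  using U_unitary A_unitary by (auto simp: unitary_of_dim_def)

abbreviation op :: "gate \<Rightarrow> complex mat" where
  "op \<equiv> gate_op N W U A"

lemma kron_unitary: "unitary_of_dim N V \<Longrightarrow> unitary_of_dim (N * W) (kron V (1\<^sub>m W))"
  by (subst kron_main) (simp_all add: unitary_of_dim_def[of N] main_kernel_unitary unitary_rows)

lemma controlled_unitary: "unitary_of_dim N V \<Longrightarrow> unitary_of_dim (N * W) (controlled N L 1 V)"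
proof -
  assume V: "unitary_of_dim N V"
  have row: "(\<Sum>z<N. of_bool (i = z) * cnj (of_bool (i' = z))) = of_bool (i = i')" if "i < N" for i i'
  proof -
    have "(\<Sum>z<N. of_bool (i = z) * cnj (of_bool (i' = z))) = (\<Sum>z<N. if i = z then of_bool (i = i') else 0)"
      by (intro sum.cong refl) auto
    then show ?thesis using that by (simp add: sum.delta')
  qed
  show ?thesis
  proof (subst controlled_main)
    show "V \<in> carrier_mat N N" using V by (simp add: unitary_of_dim_def)
    show "unitary_of_dim (N * W) (mat_of (main_kernel (\<lambda>(y, hs, c) i i'. if c = 0 then of_bool (i = i') else V $$ (i, i'))))"
    proof (rule main_kernel_unitary)
      fix r :: "nat \<times> (nat \<times> nat) list \<times> nat" and i i' assume i: "i < N" "i' < N"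
      obtain y hs c where e: "r = (y, hs, c)" by (cases r)
      show "(\<Sum>z<N. (case r of (y, hs, c) \<Rightarrow> \<lambda>i i'. if c = 0 then of_bool (i = i') else V $$ (i, i')) i z *
          cnj ((case r of (y, hs, c) \<Rightarrow> \<lambda>i i'. if c = 0 then of_bool (i = i') else V $$ (i, i')) i' z)) = of_bool (i = i')"
        using row[OF i(1), of i'] unitary_rows[OF V i] unfolding e by (cases "c = 0") (simp_all del: sum_of_bool_mult_eq sum_mult_of_bool_eq)
    qed
  qed
qed

lemma op_unitary: "ok_gate g \<Longrightarrow> unitary_of_dim (N * W) (op g)"
  by (cases g) (auto simp: kron_unitary controlled_unitary U_unitary A_unitary unitary_of_dim_adjoint simp del: One_nat_def)

lemma kron_adjoint: "V \<in> carrier_mat N N \<Longrightarrow> kron (mat_adjoint V) (1\<^sub>m W) = mat_adjoint (kron V (1\<^sub>m W))"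
  by (simp add: kron_main mat_of_adjoint) (auto intro!: mat_of_cong simp: main_kernel_def labels_def)

lemma controlled_adjoint: "V \<in> carrier_mat N N \<Longrightarrow> controlled N L 1 (mat_adjoint V) = mat_adjoint (controlled N L 1 V)"
  by (simp add: controlled_main mat_of_adjoint del: One_nat_def) (auto intro!: mat_of_cong simp: main_kernel_def labels_def)

lemma op_inv: "ok_gate g \<Longrightarrow> op (gate_inv g) = mat_adjoint (op g)"
  by (cases g) (auto simp: kron_adjoint controlled_adjoint simp del: One_nat_def)

definition evolve :: "gate list \<Rightarrow> complex vec \<Rightarrow> complex vec" where
  "evolve gs v = fold (\<lambda>g \<psi>. op g *\<^sub>v \<psi>) gs v"

lemma evolve_simps [simp]:
  "evolve [] v = v" "evolve (g # gs) v = evolve gs (op g *\<^sub>v v)"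
  "evolve (gs @ hs) v = evolve hs (evolve gs v)"
  by (simp_all add: evolve_def)

lemma op_carrier: "ok_gate g \<Longrightarrow> op g \<in> carrier_mat (N * W) (N * W)"
  using op_unitary by (auto simp: unitary_of_dim_def)

lemma evolve_carrier: "list_all ok_gate gs \<Longrightarrow> v \<in> carrier_vec (N * W) \<Longrightarrow> evolve gs v \<in> carrier_vec (N * W)"
  by (induction gs arbitrary: v) (auto simp: op_carrier mult_mat_vec_carrier[of _ "N * W" "N * W"])

lemma evolve_lincomb:
  assumes "list_all ok_gate gs" "v \<in> carrier_vec (N * W)" "w \<in> carrier_vec (N * W)"
  shows "evolve gs (c \<cdot>\<^sub>v v + d \<cdot>\<^sub>v w) = c \<cdot>\<^sub>v evolve gs v + d \<cdot>\<^sub>v evolve gs w"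
  using assms
proof (induction gs arbitrary: v w)
  case (Cons g gs)
  have g: "op g \<in> carrier_mat (N * W) (N * W)" using Cons op_carrier by simp
  have "op g *\<^sub>v (c \<cdot>\<^sub>v v + d \<cdot>\<^sub>v w) = c \<cdot>\<^sub>v (op g *\<^sub>v v) + d \<cdot>\<^sub>v (op g *\<^sub>v w)"
    using g Cons.prems by (simp add: mult_add_distrib_mat_vec[OF g] mult_mat_vec[OF g])
  then show ?case using Cons g by (simp add: mult_mat_vec_carrier[OF g])
qed simp

lemma evolve_cscalar_prod:
  assumes "list_all ok_gate gs" "v \<in> carrier_vec (N * W)" "w \<in> carrier_vec (N * W)"
  shows "evolve gs v \<bullet>c evolve gs w = v \<bullet>c w"
  using assms
proof (induction gs arbitrary: v w)
  case (Cons g gs)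
  have g: "op g \<in> carrier_mat (N * W) (N * W)" using Cons op_carrier by simp
  show ?case
    using Cons.IH[of "op g *\<^sub>v v" "op g *\<^sub>v w"] Cons.prems unitary_cscalar_prod[OF op_unitary, of g v w]
    by (simp add: mult_mat_vec_carrier[OF g])
qed simp

lemma evolve_inv:
  assumes "list_all ok_gate gs" "v \<in> carrier_vec (N * W)"
  shows "evolve gs (evolve (rev (map gate_inv gs)) v) = v"
  using assms
proof (induction gs arbitrary: v)
  case (Cons g gs)
  have g: "op g \<in> carrier_mat (N * W) (N * W)" "op g * mat_adjoint (op g) = 1\<^sub>m (N * W)"
    using op_unitary[of g] Cons.prems by (auto simp: unitary_of_dim_def)
  define w where "w = evolve (rev (map gate_inv gs)) v"
  have "list_all ok_gate (rev (map gate_inv gs))"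
    using Cons.prems ok_gate_inv by (auto simp: list_all_iff)
  then have w: "w \<in> carrier_vec (N * W)" unfolding w_def using Cons.prems by (intro evolve_carrier)
  have "op g *\<^sub>v (mat_adjoint (op g) *\<^sub>v w) = w"
    using g w by (subst assoc_mult_mat_vec[symmetric, of _ "N * W" "N * W" _ "N * W"]) auto
  moreover have "evolve (rev (map gate_inv (g # gs))) v = mat_adjoint (op g) *\<^sub>v w"
    using Cons.prems op_inv[of g] by (simp add: w_def)
  ultimately show ?case using Cons by (simp add: w_def)
qed simp

lemma evolve_phase:
  "op (phase_gate V) *\<^sub>v vec_of \<Psi> = vec_of (\<lambda>(i, y, hs, c). \<Sum>y'<M. V y y' * \<Psi> (i, y', hs, c))"
  unfolding phase_gate_def gate_op.simps mat_of_mult_vec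
  by (rule vec_of_cong) (auto simp: phase_kernel_sum)

lemma evolve_toggle:
  "op (toggle_gate s) *\<^sub>v vec_of \<Psi> = vec_of (\<lambda>x. \<Psi> (toggle s x))"
  unfolding toggle_gate_def gate_op.simps mat_of_mult_vec
  by (rule vec_of_cong) (auto simp: perm_kernel_sum toggle_in)

lemma evolve_sign:
  "op (sign_gate Q) *\<^sub>v vec_of \<Psi> = vec_of (\<lambda>x. if Q x then - \<Psi> x else \<Psi> x)"
  unfolding sign_gate_def gate_op.simps mat_of_mult_vec
  by (rule vec_of_cong) (auto simp: diag_kernel_sum)

lemma evolve_advice:
  "op Advice *\<^sub>v vec_of \<Psi> = vec_of (\<lambda>(i, r). \<Sum>i'<N. A $$ (i, i') * \<Psi> (i', r))"
  unfolding gate_op.simps kron_main[OF dims(2)] mat_of_mult_vec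
proof (rule vec_of_cong)
  fix x assume x: "x \<in> labels"
  obtain i r where e: "x = (i, r)" by (cases x)
  have "r \<in> rest" using x e by (simp add: labels_def)
  then show "(\<Sum>x'\<in>labels. main_kernel (\<lambda>r i i'. A $$ (i, i')) x x' * \<Psi> x')
    = (case x of (i, r) \<Rightarrow> \<Sum>i'<N. A $$ (i, i') * \<Psi> (i', r))"
    unfolding e by (simp add: main_kernel_sum)
qed

lemma evolve_ctrl:
  "op (CtrlU L 1) *\<^sub>v vec_of \<Psi>
    = vec_of (\<lambda>(i, y, hs, c). if c = 0 then \<Psi> (i, y, hs, c) else \<Sum>i'<N. U $$ (i, i') * \<Psi> (i', y, hs, c))"
  unfolding gate_op.simps controlled_main[OF dims(1)] mat_of_mult_vec
proof (rule vec_of_cong)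
  fix x assume x: "x \<in> labels"
  obtain i y hs c where e: "x = (i, y, hs, c)" by (cases x)
  have r: "i < N" "(y, hs, c) \<in> rest" using x e by (auto simp: labels_def)
  have "(\<Sum>i'<N. of_bool (i = i') * \<Psi> (i', y, hs, c)) = (\<Sum>i'<N. if i = i' then \<Psi> (i, y, hs, c) else 0)"
    by (intro sum.cong refl) auto
  also have "\<dots> = \<Psi> (i, y, hs, c)" using r by (simp add: sum.delta')
  finally show "(\<Sum>x'\<in>labels. main_kernel (\<lambda>(y, hs, c) i i'. if c = 0 then of_bool (i = i') else U $$ (i, i')) x x' * \<Psi> x')
    = (case x of (i, y, hs, c) \<Rightarrow> if c = 0 then \<Psi> (i, y, hs, c) else \<Sum>i'<N. U $$ (i, i') * \<Psi> (i', y, hs, c))"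
    unfolding e main_kernel_sum[OF r(2)] by (cases "c = 0") (simp_all del: sum_of_bool_mult_eq)
qed

fun power_state :: "nat \<Rightarrow> nat \<Rightarrow> complex" where
  "power_state 0 i = A $$ (i, 0)"
| "power_state (Suc k) i = (\<Sum>i'<N. U $$ (i, i') * power_state k i')"

text \<open>After step \<open>k\<close>, the branch with phase register \<open>y\<close> has
  received \<open>min k y\<close> applications of \<open>U\<close>. For \<open>k = M\<close> this is
  \<open>y\<close>, as the register stays below \<open>M\<close>.\<close>

lemma evolve_power_gates:
  "evolve (power_gates k) (vec_of (\<lambda>(i, y, hs, c). if c = 0 then f y hs * power_state 0 i else 0))
    = vec_of (\<lambda>(i, y, hs, c). if c = 0 then f y hs * power_state (min k y) i else 0)"
proof (induction k)
  case (Suc k)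
  let ?\<Psi> = "\<lambda>k (i, y, hs, c). if c = 0 then f y hs * power_state (min k y) i else 0"
  have "power_gates (Suc k) = power_gates k @ [toggle_gate k, CtrlU L 1, toggle_gate k]"
    by (simp add: power_gates_def)
  then have "evolve (power_gates (Suc k)) (vec_of (\<lambda>(i, y, hs, c). if c = 0 then f y hs * power_state 0 i else 0))
    = op (toggle_gate k) *\<^sub>v (op (CtrlU L 1) *\<^sub>v (op (toggle_gate k) *\<^sub>v vec_of (?\<Psi> k)))"
    unfolding Suc.IH[symmetric] by simp
  also have "\<dots> = vec_of (?\<Psi> (Suc k))"
    unfolding evolve_toggle evolve_ctrl
  proof (rule vec_of_cong)
    fix x assume x: "x \<in> labels"
    obtain i y hs c where e: "x = (i, y, hs, c)" by (cases x)
    have c: "c < 2" using x e by (auto simp: labels_def rest_def)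
    show "(case toggle k x of (i, y, hs, c) \<Rightarrow> if c = 0 then ?\<Psi> k (toggle k (i, y, hs, c))
        else \<Sum>i'<N. U $$ (i, i') * ?\<Psi> k (toggle k (i', y, hs, c))) = ?\<Psi> (Suc k) x"
    proof (cases "k < y")
      case True
      then have "min k y = k" "min (Suc k) y = Suc k" by auto
      then show ?thesis using True c unfolding e toggle_def
        by (auto simp: sum_distrib_left mult_ac less_2_cases_iff)
    next
      case False
      then have "min k y = y" "min (Suc k) y = y" by auto
      then show ?thesis using False c unfolding e toggle_def by auto
    qed
  qed
  finally show ?case .
qed (auto simp: power_gates_def intro!: vec_of_cong)

end

section \<open>Phase estimation as a state preparation, and the reflection about its state\<close>

locale search = circuit N M R U A for N M R U A +
  fixes a :: "nat \<Rightarrow> real"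
  assumes a_norm: "(\<Sum>k<M. (a k)\<^sup>2) = 1"
begin

definition \<beta> :: "nat \<Rightarrow> nat \<Rightarrow> complex" where
  "\<beta> i y = (\<Sum>z<M. dft M y z * (of_real (a z) * power_state z i))"

text \<open>The two shapes that states take within a round: \<open>ground\<close> has both registers
  reset and all information in the amplitudes of the record, while \<open>spread\<close> has the
  registers in the prepared state \<open>\<beta>\<close>, reweighted by a factor depending on record
  and outcome.\<close>

definition ground :: "((nat \<times> nat) list \<Rightarrow> complex) \<Rightarrow> label \<Rightarrow> complex" where
  "ground \<chi> = (\<lambda>(i, y, hs, c). if i = 0 \<and> y = 0 \<and> c = 0 then \<chi> hs else 0)"

definition spread :: "((nat \<times> nat) list \<Rightarrow> nat \<Rightarrow> complex) \<Rightarrow> label \<Rightarrow> complex" where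
  "spread f = (\<lambda>(i, y, hs, c). if c = 0 then f hs y * \<beta> i y else 0)"

lemma evolve_prep: "evolve (prep a) (vec_of (ground \<chi>)) = vec_of (spread (\<lambda>hs y. \<chi> hs))"
proof -
  have 1: "op (phase_gate (\<lambda>y z. of_real (householder M a y z))) *\<^sub>v vec_of (ground \<chi>)
    = vec_of (\<lambda>(i, y, hs, c). if i = 0 \<and> c = 0 then of_real (a y) * \<chi> hs else 0)"
    unfolding evolve_phase
  proof (rule vec_of_cong)
    fix x assume x: "x \<in> labels"
    obtain i y hs c where e: "x = (i, y, hs, c)" by (cases x)
    have y: "y < M" using x e by (auto simp: labels_def rest_def)
    have "(\<Sum>y'<M. of_real (householder M a y y') * ground \<chi> (i, y', hs, c))
      = (\<Sum>y'<M. if y' = 0 then if i = 0 \<and> c = 0 then of_real (householder M a y 0) * \<chi> hs else 0 else 0)"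
      by (intro sum.cong refl) (auto simp: ground_def)
    also have "\<dots> = (if i = 0 \<and> c = 0 then of_real (a y) * \<chi> hs else 0)"
      using M_pos householder_0[OF a_norm y] by (simp add: sum.delta)
    finally show "(case x of (i, y, hs, c) \<Rightarrow> \<Sum>y'<M. of_real (householder M a y y') * ground \<chi> (i, y', hs, c))
      = (case x of (i, y, hs, c) \<Rightarrow> if i = 0 \<and> c = 0 then of_real (a y) * \<chi> hs else 0)"
      unfolding e by simp
  qed
  have 2: "op Advice *\<^sub>v vec_of (\<lambda>(i, y, hs, c). if i = 0 \<and> c = 0 then of_real (a y) * \<chi> hs else 0)
    = vec_of (\<lambda>(i, y, hs, c). if c = 0 then (of_real (a y) * \<chi> hs) * power_state 0 i else 0)"
    unfolding evolve_advice
  proof (rule vec_of_cong)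
    fix x assume x: "x \<in> labels"
    obtain i y hs c where e: "x = (i, y, hs, c)" by (cases x)
    have "(\<Sum>i'<N. A $$ (i, i') * (if i' = 0 \<and> c = 0 then of_real (a y) * \<chi> hs else 0))
      = (\<Sum>i'<N. if i' = 0 then if c = 0 then (of_real (a y) * \<chi> hs) * A $$ (i, 0) else 0 else 0)"
      by (intro sum.cong refl) auto
    also have "\<dots> = (if c = 0 then (of_real (a y) * \<chi> hs) * A $$ (i, 0) else 0)"
      using N_pos by (simp add: sum.delta)
    finally show "(case x of (i, r) \<Rightarrow> \<Sum>i'<N. A $$ (i, i') * (case (i', r) of (i, y, hs, c) \<Rightarrow> if i = 0 \<and> c = 0 then of_real (a y) * \<chi> hs else 0))
      = (case x of (i, y, hs, c) \<Rightarrow> if c = 0 then (of_real (a y) * \<chi> hs) * power_state 0 i else 0)"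
      unfolding e by simp
  qed
  have 3: "evolve (power_gates M) (vec_of (\<lambda>(i, y, hs, c). if c = 0 then (of_real (a y) * \<chi> hs) * power_state 0 i else 0))
    = vec_of (\<lambda>(i, y, hs, c). if c = 0 then (of_real (a y) * \<chi> hs) * power_state (min M y) i else 0)"
    by (rule evolve_power_gates)
  have 4: "op (phase_gate (dft M)) *\<^sub>v vec_of (\<lambda>(i, y, hs, c). if c = 0 then (of_real (a y) * \<chi> hs) * power_state (min M y) i else 0)
    = vec_of (spread (\<lambda>hs y. \<chi> hs))"
    unfolding evolve_phase
    by (rule vec_of_cong) (auto simp: spread_def \<beta>_def sum_distrib_left min_absorb2 mult_ac intro!: sum.cong)
  show ?thesis unfolding prep_def by (simp only: append_Cons append_Nil evolve_simps 1 2 3 4)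
qed

lemma sum_labels_control:
  "(\<Sum>x\<in>labels. case x of (i, y, hs, c) \<Rightarrow> if c = 0 then f i y hs else 0)
    = (\<Sum>hs\<in>Hist. \<Sum>y<M. \<Sum>i<N. f i y hs)"
proof -
  have "(\<Sum>x\<in>labels. case x of (i, y, hs, c) \<Rightarrow> if c = 0 then f i y hs else 0)
    = (\<Sum>i<N. \<Sum>y<M. \<Sum>hs\<in>Hist. f i y hs)"
    unfolding sum_labels sum_rest by (simp add: numeral_2_eq_2)
  also have "\<dots> = (\<Sum>y<M. \<Sum>i<N. \<Sum>hs\<in>Hist. f i y hs)" by (rule sum.swap)
  also have "\<dots> = (\<Sum>y<M. \<Sum>hs\<in>Hist. \<Sum>i<N. f i y hs)" by (intro sum.cong refl sum.swap)
  also have "\<dots> = (\<Sum>hs\<in>Hist. \<Sum>y<M. \<Sum>i<N. f i y hs)" by (rule sum.swap)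
  finally show ?thesis .
qed

lemma spread_cscalar_prod:
  "vec_of \<Psi> \<bullet>c vec_of (spread (\<lambda>hs' y. of_bool (hs' = hs)))
    = (if hs \<in> Hist then \<Sum>y<M. \<Sum>i<N. \<Psi> (i, y, hs, 0) * cnj (\<beta> i y) else 0)"
proof -
  have "vec_of \<Psi> \<bullet>c vec_of (spread (\<lambda>hs' y. of_bool (hs' = hs)))
    = (\<Sum>x\<in>labels. case x of (i, y, hs', c) \<Rightarrow> if c = 0 then \<Psi> (i, y, hs', 0) * cnj (of_bool (hs' = hs) * \<beta> i y) else 0)"
    unfolding vec_of_cscalar_prod by (intro sum.cong refl) (auto simp: spread_def)
  also have "\<dots> = (\<Sum>hs'\<in>Hist. \<Sum>y<M. \<Sum>i<N. \<Psi> (i, y, hs', 0) * cnj (of_bool (hs' = hs) * \<beta> i y))"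
    by (rule sum_labels_control)
  also have "\<dots> = (\<Sum>hs'\<in>Hist. if hs' = hs then \<Sum>y<M. \<Sum>i<N. \<Psi> (i, y, hs, 0) * cnj (\<beta> i y) else 0)"
    by (intro sum.cong refl) auto
  finally show ?thesis by (simp add: sum.delta)
qed

lemma ground_cscalar_prod:
  assumes "hs \<in> Hist"
  shows "vec_of \<Psi> \<bullet>c vec_of (ground (\<lambda>hs'. of_bool (hs' = hs))) = \<Psi> (0, 0, hs, 0)"
proof -
  have "vec_of \<Psi> \<bullet>c vec_of (ground (\<lambda>hs'. of_bool (hs' = hs)))
    = (\<Sum>x\<in>labels. if x = (0, 0, hs, 0) then \<Psi> x else 0)"
    unfolding vec_of_cscalar_prod by (intro sum.cong refl) (auto simp: ground_def split: if_splits)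
  then show ?thesis using assms N_pos M_pos by (simp add: sum.delta labels_def rest_def)
qed

text \<open>The preparation is unitary, so applying it to the initial record gives the normalisation
  without any computation with \<open>\<beta>\<close>.\<close>

lemma \<beta>_norm: "(\<Sum>y<M. \<Sum>i<N. (cmod (\<beta> i y))\<^sup>2) = 1"
proof -
  let ?e = "\<lambda>hs'. of_bool (hs' = hist0) :: complex"
  have "vec_of (spread (\<lambda>hs y. ?e hs)) \<bullet>c vec_of (spread (\<lambda>hs y. ?e hs)) = vec_of (ground ?e) \<bullet>c vec_of (ground ?e)"
    unfolding evolve_prep[symmetric] by (rule evolve_cscalar_prod[OF ok_prep]) auto
  then have "(\<Sum>y<M. \<Sum>i<N. \<beta> i y * cnj (\<beta> i y)) = 1"
    unfolding spread_cscalar_prod ground_cscalar_prod[OF hist0_in] by (simp add: spread_def ground_def)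
  then have "complex_of_real (\<Sum>y<M. \<Sum>i<N. (cmod (\<beta> i y))\<^sup>2) = of_real 1"
    by (simp only: of_real_sum complex_norm_square of_real_1)
  then show ?thesis by (simp only: of_real_eq_iff)
qed

text \<open>In each record branch this is 2 |\<beta>><\<beta>| - 1. The inverse preparation is never
  evaluated: the state is named \<open>\<Phi>\<close> before the final preparation, and its
  amplitude at the origin is the overlap of \<open>\<Psi>\<close> with the prepared state, because
  inner products are preserved.\<close>

lemma evolve_reflect:
  "evolve (reflect a) (vec_of \<Psi>)
    = vec_of (\<lambda>x. spread (\<lambda>hs y. 2 * (\<Sum>y<M. \<Sum>i<N. \<Psi> (i, y, hs, 0) * cnj (\<beta> i y))) x - \<Psi> x)"
proof -
  define v where "v = evolve (rev (map gate_inv (prep a))) (vec_of \<Psi>)"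
  have "v \<in> carrier_vec (N * W)"
    unfolding v_def using ok_prep[of a] by (intro evolve_carrier) (auto simp: list_all_iff ok_gate_inv)
  then obtain \<Phi> where \<Phi>: "v = vec_of \<Phi>" by (rule vec_of_exists)
  have fwd: "evolve (prep a) (vec_of \<Phi>) = vec_of \<Psi>"
    unfolding \<Phi>[symmetric] v_def by (rule evolve_inv[OF ok_prep]) simp
  define \<chi> where "\<chi> hs = \<Phi> (0, 0, hs, 0)" for hs
  have \<chi>: "\<chi> hs = (\<Sum>y<M. \<Sum>i<N. \<Psi> (i, y, hs, 0) * cnj (\<beta> i y))" if hs: "hs \<in> Hist" for hs
  proof -
    have "\<chi> hs = vec_of \<Phi> \<bullet>c vec_of (ground (\<lambda>hs'. of_bool (hs' = hs)))"
      unfolding ground_cscalar_prod[OF hs] \<chi>_def ..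
    also have "\<dots> = evolve (prep a) (vec_of \<Phi>) \<bullet>c evolve (prep a) (vec_of (ground (\<lambda>hs'. of_bool (hs' = hs))))"
      by (rule evolve_cscalar_prod[OF ok_prep, symmetric]) auto
    also have "\<dots> = (\<Sum>y<M. \<Sum>i<N. \<Psi> (i, y, hs, 0) * cnj (\<beta> i y))"
      unfolding fwd evolve_prep spread_cscalar_prod using hs by simp
    finally show ?thesis .
  qed
  have "evolve (reflect a) (vec_of \<Psi>) = evolve (prep a) (op (sign_gate (\<lambda>x. \<not> at_origin x)) *\<^sub>v vec_of \<Phi>)"
    unfolding reflect_def \<Phi>[symmetric] v_def by simp
  also have "op (sign_gate (\<lambda>x. \<not> at_origin x)) *\<^sub>v vec_of \<Phi> = 2 \<cdot>\<^sub>v vec_of (ground \<chi>) + (- 1) \<cdot>\<^sub>v vec_of \<Phi>"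
    unfolding evolve_sign vec_of_smult vec_of_add
    by (rule vec_of_cong) (auto simp: ground_def at_origin_def \<chi>_def split: if_splits)
  also have "evolve (prep a) \<dots> = 2 \<cdot>\<^sub>v vec_of (spread (\<lambda>hs y. \<chi> hs)) + (- 1) \<cdot>\<^sub>v vec_of \<Psi>"
    by (subst evolve_lincomb[OF ok_prep]) (simp_all add: evolve_prep fwd)
  also have "\<dots> = vec_of (\<lambda>x. spread (\<lambda>hs y. 2 * (\<Sum>y<M. \<Sum>i<N. \<Psi> (i, y, hs, 0) * cnj (\<beta> i y))) x - \<Psi> x)"
    unfolding vec_of_smult vec_of_add
    by (rule vec_of_cong) (auto simp: spread_def \<chi> labels_def rest_def)
  finally show ?thesis .
qed

end

section \<open>Measurement records\<close>

definition threshold :: "(nat \<Rightarrow> real) \<Rightarrow> (nat \<times> nat) list \<Rightarrow> real" where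
  "threshold est hs = foldr (\<lambda>(i, y) m. max m (est y)) hs 0"

lemma threshold_simps [simp]:
  "threshold est [] = 0"
  "threshold est ((i, y) # hs) = max (threshold est hs) (est y)"
  by (simp_all add: threshold_def)

lemma threshold_snoc_0: "est 0 = 0 \<Longrightarrow> threshold est (hs @ [(i, 0)]) = threshold est hs"
  by (simp add: threshold_def)

lemma threshold_replicate_0: "est 0 = 0 \<Longrightarrow> threshold est (replicate n (0, 0)) = 0"
  by (induction n) auto

context layout
begin

text \<open>Instead of measuring, a round stores the content of the two registers at the front of the
  record and continues with the last entry, which is still in its initial state.\<close>

definition rotate :: "label \<Rightarrow> label" where
  "rotate = (\<lambda>(i, y, hs, c). let q = hs @ [(i, y)] in (fst (hd q), snd (hd q), tl q, c))"

text \<open>Since \<open>perm_kernel\<close> pulls amplitudes back, the gate undoes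
  \<open>rotate\<close> on basis states: the registers move to the front of the record and its last
  entry moves into the registers.\<close>

definition rotate_gate :: gate where
  "rotate_gate = Free (mat_of (perm_kernel rotate))"

definition above :: "(nat \<Rightarrow> real) \<Rightarrow> label \<Rightarrow> bool" where
  "above est = (\<lambda>(i, y, hs, c). threshold est hs < est y)"

definition grover_gates :: "(nat \<Rightarrow> real) \<Rightarrow> (nat \<Rightarrow> real) \<Rightarrow> gate list" where
  "grover_gates a est = [sign_gate (above est)] @ reflect a"

definition round_gates :: "(nat \<Rightarrow> real) \<Rightarrow> (nat \<Rightarrow> real) \<Rightarrow> nat \<Rightarrow> gate list" where
  "round_gates a est j = prep a @ concat (replicate j (grover_gates a est)) @ [rotate_gate]"

definition finder :: "(nat \<Rightarrow> real) \<Rightarrow> (nat \<Rightarrow> real) \<Rightarrow> nat list \<Rightarrow> qalg" where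
  "finder a est js = \<lparr>work_dim = W, gates = concat (map (round_gates a est) js), num_outcomes = N * W,
     povm = \<lambda>k. mat (N * W) (N * W) (\<lambda>(i, j). of_bool (i = k \<and> j = k)),
     out_val = \<lambda>k. case decode k of (i, y, hs, c) \<Rightarrow> threshold est hs\<rparr>"

lemma rotate_in: "x \<in> labels \<Longrightarrow> rotate x \<in> labels"
proof -
  assume x: "x \<in> labels"
  obtain i y hs c where e: "x = (i, y, hs, c)" by (cases x)
  have h: "i < N" "y < M" "set hs \<subseteq> {..<N} \<times> {..<M}" "length hs = R" "c < 2"
    using x e by (auto simp: labels_def rest_def Hist_def)
  obtain p q where pq: "hs @ [(i, y)] = p # q" by (cases "hs @ [(i, y)]") auto
  have "set (p # q) \<subseteq> {..<N} \<times> {..<M}" "length (p # q) = Suc R" using h unfolding pq[symmetric] by auto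
  then show ?thesis using h by (auto simp: e rotate_def pq labels_def rest_def Hist_def)
qed

lemma rotate_inj: "inj rotate"
proof (rule injI)
  fix x x' assume eq: "rotate x = rotate x'"
  obtain i y hs c i' y' hs' c' where e: "x = (i, y, hs, c)" "x' = (i', y', hs', c')" by (cases x; cases x')
  have "hd (hs @ [(i, y)]) = hd (hs' @ [(i', y')])" "tl (hs @ [(i, y)]) = tl (hs' @ [(i', y')])" "c = c'"
    using eq by (auto simp: e rotate_def Let_def prod_eq_iff)
  then have "hs @ [(i, y)] = hs' @ [(i', y')]" by (metis list.collapse snoc_eq_iff_butlast)
  then show "x = x'" using \<open>c = c'\<close> by (simp add: e)
qed

lemma ok_rotate_gate: "ok_gate rotate_gate"
  unfolding rotate_gate_def ok_gate.simps
  by (intro perm_kernel_unitary image_subsetI rotate_in inj_on_subset[OF rotate_inj]) auto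

lemma ok_round_gates: "list_all ok_gate (round_gates a est j)"
  using ok_prep[of a] ok_reflect[of a]
  by (auto simp: round_gates_def grover_gates_def ok_rotate_gate ok_sign_gate list_all_iff)

lemma count_concat_replicate:
  "length (filter Q (concat (replicate j xs))) = j * length (filter Q xs)"
  by (induction j) auto

lemma query_counts:
  "length (filter is_U_query (prep a)) = M" "length (filter is_advice_query (prep a)) = 1"
proof -
  have "length (filter is_U_query (power_gates k)) = k" "filter is_advice_query (power_gates k) = []" for k
    by (induction k) (auto simp: power_gates_def toggle_gate_def)
  then show "length (filter is_U_query (prep a)) = M" "length (filter is_advice_query (prep a)) = 1"
    by (simp_all add: prep_def phase_gate_def)
qed

lemma filter_gate_inv:
  "length (filter is_U_query (rev (map gate_inv gs))) = length (filter is_U_query gs)"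
  "length (filter is_advice_query (rev (map gate_inv gs))) = length (filter is_advice_query gs)"
  by (simp_all add: rev_filter[symmetric] filter_map o_def)

text \<open>One initial preparation, and a preparation together with its inverse in each
  reflection.\<close>

lemma round_counts:
  "length (filter is_U_query (round_gates a est j)) = (2 * j + 1) * M"
  "length (filter is_advice_query (round_gates a est j)) = 2 * j + 1"
  using query_counts[of a]
  by (simp_all add: round_gates_def grover_gates_def reflect_def count_concat_replicate filter_gate_inv
      rotate_gate_def sign_gate_def algebra_simps)

lemma finder_cost:
  "cost (finder a est js) = (\<Sum>j\<leftarrow>js. 2 * j + 1) * M"
  "advice_uses (finder a est js) = (\<Sum>j\<leftarrow>js. 2 * j + 1)"
  unfolding cost_def advice_uses_def finder_def qalg.simps
  by (induction js) (simp_all add: round_counts algebra_simps)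

lemma povm_psd: "k < N * W \<Longrightarrow> psd_of_dim (N * W) (mat (N * W) (N * W) (\<lambda>(i, j). of_bool (i = k \<and> j = k)))"
  and povm_value: "k < N * W \<Longrightarrow> v \<in> carrier_vec (N * W) \<Longrightarrow>
    Re ((mat (N * W) (N * W) (\<lambda>(i, j). of_bool (i = k \<and> j = k)) *\<^sub>v v) \<bullet>c v) = (cmod (v $ k))\<^sup>2"
proof -
  show val: "Re ((mat (N * W) (N * W) (\<lambda>(i, j). of_bool (i = k \<and> j = k)) *\<^sub>v v) \<bullet>c v) = (cmod (v $ k))\<^sup>2"
    if k: "k < N * W" and v: "v \<in> carrier_vec (N * W)" for v
  proof -
    let ?E = "mat (N * W) (N * W) (\<lambda>(i, j). of_bool (i = k \<and> j = k)) :: complex mat"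
    have d: "dim_vec v = N * W" using v by simp
    have ev: "(?E *\<^sub>v v) $ i = (if i = k then v $ k else 0)" if i: "i < N * W" for i
    proof -
      have "(?E *\<^sub>v v) $ i = (\<Sum>j<N * W. ?E $$ (i, j) * v $ j)" using i d by (subst mult_vec_index) auto
      also have "\<dots> = (\<Sum>j<N * W. if j = k then if i = k then v $ k else 0 else 0)"
        using i by (intro sum.cong refl) auto
      finally show ?thesis using k by (simp add: sum.delta)
    qed
    have "(?E *\<^sub>v v) \<bullet>c v = (\<Sum>i<N * W. (?E *\<^sub>v v) $ i * cnj (v $ i))"
      using d by (subst cscalar_prod_sum) auto
    also have "\<dots> = (\<Sum>i<N * W. if i = k then v $ k * cnj (v $ k) else 0)"
    proof (rule sum.cong[OF refl])
      fix i assume "i \<in> {..<N * W}"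
      then have "i < N * W" by simp
      then show "(?E *\<^sub>v v) $ i * cnj (v $ i) = (if i = k then v $ k * cnj (v $ k) else 0)"
        unfolding ev[OF \<open>i < N * W\<close>] by simp
    qed
    also have "\<dots> = v $ k * cnj (v $ k)" using k by (simp add: sum.delta)
    also have "\<dots> = of_real ((cmod (v $ k))\<^sup>2)" by (simp only: complex_norm_square)
    finally show ?thesis by simp
  qed
  show "psd_of_dim (N * W) (mat (N * W) (N * W) (\<lambda>(i, j). of_bool (i = k \<and> j = k)))" if "k < N * W"
    unfolding psd_of_dim_def using val[OF that] by (auto intro!: eq_matI)
qed

lemma finder_wf: "wf_qalg N (finder a est js)"
proof -
  have "ok_gate g" if "g \<in> set (concat (map (round_gates a est) js))" for g
    using that ok_round_gates by (auto simp: list_all_iff)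
  then have "\<forall>g\<in>set (concat (map (round_gates a est) js)). wf_gate N W g"
    using ok_gate_wf by blast
  moreover have "(\<Sum>k<n. of_bool (i = k \<and> j = k)) = (of_bool (i = j) :: complex)" if "i < n" for i j n :: nat
  proof -
    have "(\<Sum>k<n. of_bool (i = k \<and> j = k)) = (\<Sum>k<n. if i = k then of_bool (i = j) else (0::complex))"
      by (intro sum.cong refl) auto
    then show ?thesis using that by (simp add: sum.delta')
  qed
  then have "is_povm (N * W) (N * W) (\<lambda>k. mat (N * W) (N * W) (\<lambda>(i, j). of_bool (i = k \<and> j = k)))"
    unfolding is_povm_def using povm_psd by (auto intro!: eq_matI)
  ultimately show ?thesis
    unfolding wf_qalg_def finder_def qalg.simps using W_pos by blast
qed

end

section \<open>The circuit reproduces the classical process\<close>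

locale max_search = search N M R U A a for N M R U A a +
  fixes est :: "nat \<Rightarrow> real"
  assumes est_0: "est 0 = 0"
begin

definition P :: "nat \<Rightarrow> real" where
  "P y = (\<Sum>i<N. (cmod (\<beta> i y))\<^sup>2)"

sublocale max_finding P est M
  by unfold_locales (auto simp: P_def \<beta>_norm intro: sum_nonneg)

abbreviation thr :: "(nat \<times> nat) list \<Rightarrow> real" where
  "thr \<equiv> threshold est"

lemma tail_as_sum: "(\<Sum>y<M. P y * (if t < est y then x else z)) = tail t * x + (1 - tail t) * z"
proof -
  have "(\<Sum>y<M. P y * (if t < est y then x else z))
    = (\<Sum>y | y < M \<and> t < est y. P y * (if t < est y then x else z))
      + (\<Sum>y | y < M \<and> \<not> t < est y. P y * (if t < est y then x else z))"
    by (subst sum.union_disjoint[symmetric]) (auto intro: sum.cong)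
  also have "(\<Sum>y | y < M \<and> t < est y. P y * (if t < est y then x else z)) = (\<Sum>y | y < M \<and> t < est y. P y * x)"
    by (intro sum.cong) auto
  also have "(\<Sum>y | y < M \<and> \<not> t < est y. P y * (if t < est y then x else z)) = (\<Sum>y | y < M \<and> \<not> t < est y. P y * z)"
    by (intro sum.cong) auto
  finally show ?thesis unfolding tail_compl[symmetric] unfolding tail_def by (simp add: sum_distrib_right)
qed

text \<open>Within a record branch the threshold is fixed, so the iterations stay in the plane
  spanned by the parts of the prepared state above and below it. Each iteration acts on the two
  factors by the recurrence of \<open>grov\<close>, with p = \<open>tail (thr hs)\<close>.\<close>

lemma evolve_grover:
  "evolve (concat (replicate s (grover_gates a est))) (vec_of (spread (\<lambda>hs y. \<chi> hs)))
    = vec_of (spread (\<lambda>hs y. \<chi> hs * of_real (amp s (thr hs) y)))"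
proof (induction s)
  case 0
  have "amp 0 t y = 1" for t y by (simp add: amp_def)
  then show ?case by simp
next
  case (Suc s)
  define f where "f hs y = \<chi> hs * of_real ((if thr hs < est y then -1 else 1) * amp s (thr hs) y)" for hs y
  have snoc: "concat (replicate (Suc s) G) = concat (replicate s G) @ G" for G :: "gate list"
    by (induction s) auto
  have sgn: "op (sign_gate (above est)) *\<^sub>v vec_of (spread (\<lambda>hs y. \<chi> hs * of_real (amp s (thr hs) y))) = vec_of (spread f)"
    unfolding evolve_sign by (rule vec_of_cong) (auto simp: above_def spread_def f_def)
  have new: "2 * (\<Sum>y<M. \<Sum>i<N. spread f (i, y, hs, 0) * cnj (\<beta> i y)) - f hs y
    = \<chi> hs * of_real (amp (Suc s) (thr hs) y)" for hs y
  proof -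
    obtain x z where xz: "grov (tail (thr hs)) s = (x, z)" by fastforce
    have f: "f hs y = \<chi> hs * of_real (if thr hs < est y then - x else z)" for y
      by (simp add: f_def amp_def xz)
    have "(\<Sum>y<M. \<Sum>i<N. spread f (i, y, hs, 0) * cnj (\<beta> i y)) = (\<Sum>y<M. f hs y * of_real (P y))"
      unfolding spread_def P_def of_real_sum complex_norm_square
      by (simp add: sum_distrib_left mult_ac)
    also have "\<dots> = \<chi> hs * of_real (\<Sum>y<M. P y * (if thr hs < est y then - x else z))"
      unfolding f of_real_sum sum_distrib_left of_real_mult by (simp add: mult_ac)
    also have "\<dots> = \<chi> hs * of_real (tail (thr hs) * (- x) + (1 - tail (thr hs)) * z)"
      unfolding tail_as_sum ..
    finally have k: "(\<Sum>y<M. \<Sum>i<N. spread f (i, y, hs, 0) * cnj (\<beta> i y)) = \<chi> hs * of_real (tail (thr hs) * (- x) + (1 - tail (thr hs)) * z)" .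
    have "2 * (\<chi> hs * of_real (tail (thr hs) * (- x) + (1 - tail (thr hs)) * z)) - f hs y
      = \<chi> hs * of_real (2 * (tail (thr hs) * (- x) + (1 - tail (thr hs)) * z) - (if thr hs < est y then - x else z))"
      unfolding f by (simp add: right_diff_distrib mult.left_commute)
    also have "2 * (tail (thr hs) * (- x) + (1 - tail (thr hs)) * z) - (if thr hs < est y then - x else z) = amp (Suc s) (thr hs) y"
      by (simp add: amp_def xz algebra_simps)
    finally show ?thesis unfolding k .
  qed
  have "evolve (concat (replicate (Suc s) (grover_gates a est))) (vec_of (spread (\<lambda>hs y. \<chi> hs)))
    = evolve (reflect a) (vec_of (spread f))"
    unfolding snoc evolve_simps(3) Suc.IH unfolding grover_gates_def by (simp add: sgn)
  also have "\<dots> = vec_of (spread (\<lambda>hs y. \<chi> hs * of_real (amp (Suc s) (thr hs) y)))"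
    unfolding evolve_reflect new[symmetric]
    by (rule vec_of_cong) (auto simp: spread_def algebra_simps)
  finally show ?case .
qed

text \<open>After \<open>t\<close> rounds the last \<open>R - t\<close> entries are still initial,
  so a further rotation brings clean registers.\<close>

definition fresh :: "nat \<Rightarrow> ((nat \<times> nat) list \<Rightarrow> complex) \<Rightarrow> bool" where
  "fresh t \<chi> \<longleftrightarrow> (\<forall>hs\<in>Hist. \<chi> hs \<noteq> 0 \<longrightarrow> drop t hs = replicate (R - t) (0, 0))"

definition advance :: "nat \<Rightarrow> ((nat \<times> nat) list \<Rightarrow> complex) \<Rightarrow> (nat \<times> nat) list \<Rightarrow> complex" where
  "advance j \<chi> hs = \<chi> (tl hs @ [(0, 0)]) * of_real (amp j (thr (tl hs)) (snd (hd hs))) * \<beta> (fst (hd hs)) (snd (hd hs))"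

definition weight :: "((nat \<times> nat) list \<Rightarrow> complex) \<Rightarrow> (real \<Rightarrow> real) \<Rightarrow> real" where
  "weight \<chi> g = (\<Sum>hs\<in>Hist. (cmod (\<chi> hs))\<^sup>2 * g (thr hs))"

lemma fresh_last:
  assumes "fresh t \<chi>" "t < R" "hs @ [p] \<in> Hist" "\<chi> (hs @ [p]) \<noteq> 0"
  shows "p = (0, 0)"
proof -
  have d: "drop t (hs @ [p]) = replicate (R - t) (0, 0)" using assms by (auto simp: fresh_def)
  have "length hs \<ge> t" using assms by (auto simp: Hist_def)
  then have "drop t (hs @ [p]) = drop t hs @ [p]" by simp
  then have "p \<in> set (replicate (R - t) (0, 0))" unfolding d[symmetric] by simp
  then show ?thesis by simp
qed

lemma tl_snoc_Hist: "hs \<in> Hist \<Longrightarrow> 0 < R \<Longrightarrow> p \<in> {..<N} \<times> {..<M} \<Longrightarrow> tl hs @ [p] \<in> Hist"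
  by (cases hs) (auto simp: Hist_def)

text \<open>The entry rotated into the registers is (0, 0) wherever the amplitude is nonzero, so the
  state is again of the form \<open>ground\<close> and the next round can start from it.\<close>

lemma evolve_round:
  assumes "fresh t \<chi>" "t < R"
  shows "evolve (round_gates a est j) (vec_of (ground \<chi>)) = vec_of (ground (advance j \<chi>))"
proof -
  have "evolve (round_gates a est j) (vec_of (ground \<chi>))
    = op rotate_gate *\<^sub>v vec_of (spread (\<lambda>hs y. \<chi> hs * of_real (amp j (thr hs) y)))"
    unfolding round_gates_def evolve_simps(3) evolve_prep evolve_grover by simp
  also have "\<dots> = vec_of (\<lambda>x. spread (\<lambda>hs y. \<chi> hs * of_real (amp j (thr hs) y)) (rotate x))"
    unfolding rotate_gate_def gate_op.simps mat_of_mult_vec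
    by (rule vec_of_cong) (simp add: perm_kernel_sum rotate_in)
  also have "\<dots> = vec_of (ground (advance j \<chi>))"
  proof (rule vec_of_cong)
    fix x assume x: "x \<in> labels"
    obtain i y hs c where e: "x = (i, y, hs, c)" by (cases x)
    have h: "i < N" "y < M" "hs \<in> Hist" using x e by (auto simp: labels_def rest_def)
    have "hs \<noteq> []" using h assms(2) by (auto simp: Hist_def)
    then have rot: "rotate x = (fst (hd hs), snd (hd hs), tl hs @ [(i, y)], c)" by (simp add: e rotate_def)
    have zero: "\<chi> (tl hs @ [(i, y)]) = 0" if "(i, y) \<noteq> (0, 0)"
      using fresh_last[OF assms tl_snoc_Hist[of hs "(i, y)"]] h assms(2) that by auto
    show "spread (\<lambda>hs y. \<chi> hs * of_real (amp j (thr hs) y)) (rotate x) = ground (advance j \<chi>) x"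
    proof (cases "(i, y) = (0, 0)")
      case True
      then show ?thesis unfolding rot unfolding e spread_def ground_def advance_def
        by (simp add: threshold_snoc_0[of est] est_0)
    next
      case False
      then show ?thesis unfolding rot unfolding e spread_def ground_def using zero by auto
    qed
  qed
  finally show ?thesis .
qed

lemma fresh_advance:
  assumes "fresh t \<chi>" "t < R"
  shows "fresh (Suc t) (advance j \<chi>)"
  unfolding fresh_def
proof (intro ballI impI)
  fix hs assume hs: "hs \<in> Hist" and nz: "advance j \<chi> hs \<noteq> 0"
  have "tl hs @ [(0, 0)] \<in> Hist" using tl_snoc_Hist[OF hs] assms(2) N_pos M_pos by auto
  then have d: "drop t (tl hs @ [(0, 0)]) = replicate (R - t) (0, 0)"
    using assms(1) nz by (auto simp: fresh_def advance_def)
  have "t \<le> length (tl hs)" using hs assms(2) by (auto simp: Hist_def)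
  then have "drop t (tl hs @ [(0, 0)]) = drop (Suc t) hs @ [(0, 0)]" by (simp add: drop_Suc)
  moreover have "replicate (R - t) (0, 0) = replicate (R - Suc t) (0, 0) @ [(0::nat, 0::nat)]"
    using assms(2) by (simp add: replicate_append_same Suc_diff_Suc flip: replicate_Suc)
  ultimately show "drop (Suc t) hs = replicate (R - Suc t) (0, 0)" using d by simp
qed

text \<open>Deferred measurement: distinct stored outcomes label orthogonal states, so branches
  contribute probabilities without interference, and summing over the main register leaves
  \<open>P\<close>. Freshness identifies the old records with those ending in (0, 0).\<close>

lemma weight_advance:
  assumes "fresh t \<chi>" "t < R"
  shows "weight (advance j \<chi>) g = weight \<chi> (step j g)"
proof -
  define T where "T = {ts. set ts \<subseteq> {..<N} \<times> {..<M} \<and> length ts = R - 1}"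
  have finT: "finite T" unfolding T_def by (rule finite_lists_length_eq) simp
  have "weight (advance j \<chi>) g
    = (\<Sum>(p, ts)\<in>({..<N} \<times> {..<M}) \<times> T. (cmod (advance j \<chi> (p # ts)))\<^sup>2 * g (thr (p # ts)))"
    unfolding weight_def
  proof (rule sum.reindex_bij_witness[of _ "\<lambda>(p, ts). p # ts" "\<lambda>hs. (hd hs, tl hs)"], goal_cases)
    case (1 hs)
    then show ?case using assms(2) by (cases hs) (auto simp: Hist_def)
  next
    case (2 hs)
    then show ?case using assms(2) by (cases hs) (auto simp: Hist_def T_def)
  next
    case (5 hs)
    then show ?case using assms(2) by (cases hs) (auto simp: Hist_def)
  qed (use assms(2) in \<open>auto simp: Hist_def T_def\<close>)
  also have "\<dots> = (\<Sum>p\<in>{..<N} \<times> {..<M}. \<Sum>ts\<in>T. (cmod (advance j \<chi> (p # ts)))\<^sup>2 * g (thr (p # ts)))"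
    by (simp only: sum.cartesian_product)
  also have "\<dots> = (\<Sum>ts\<in>T. \<Sum>p\<in>{..<N} \<times> {..<M}. (cmod (advance j \<chi> (p # ts)))\<^sup>2 * g (thr (p # ts)))"
    by (rule sum.swap)
  also have "\<dots> = (\<Sum>ts\<in>T. (cmod (\<chi> (ts @ [(0, 0)])))\<^sup>2 * step j g (thr ts))"
  proof (intro sum.cong refl)
    fix ts
    have "(\<Sum>p\<in>{..<N} \<times> {..<M}. (cmod (advance j \<chi> (p # ts)))\<^sup>2 * g (thr (p # ts)))
      = (\<Sum>i<N. \<Sum>y<M. (cmod (\<chi> (ts @ [(0, 0)])))\<^sup>2 * ((cmod (\<beta> i y))\<^sup>2 * (amp j (thr ts) y)\<^sup>2 * g (max (thr ts) (est y))))"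
      unfolding sum.cartesian_product
      by (intro sum.cong refl) (auto simp: advance_def norm_mult power_mult_distrib mult_ac)
    also have "\<dots> = (\<Sum>y<M. \<Sum>i<N. (cmod (\<chi> (ts @ [(0, 0)])))\<^sup>2 * ((cmod (\<beta> i y))\<^sup>2 * (amp j (thr ts) y)\<^sup>2 * g (max (thr ts) (est y))))"
      by (rule sum.swap)
    also have "\<dots> = (cmod (\<chi> (ts @ [(0, 0)])))\<^sup>2 * step j g (thr ts)"
      unfolding step_def P_def by (simp only: sum_distrib_left sum_distrib_right)
    finally show "(\<Sum>p\<in>{..<N} \<times> {..<M}. (cmod (advance j \<chi> (p # ts)))\<^sup>2 * g (thr (p # ts)))
      = (cmod (\<chi> (ts @ [(0, 0)])))\<^sup>2 * step j g (thr ts)" .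
  qed
  also have "\<dots> = (\<Sum>hs\<in>(\<lambda>ts. ts @ [(0, 0)]) ` T. (cmod (\<chi> hs))\<^sup>2 * step j g (thr hs))"
    by (subst sum.reindex) (auto simp: inj_on_def threshold_snoc_0[of est] est_0)
  also have "\<dots> = weight \<chi> (step j g)"
    unfolding weight_def
  proof (rule sum.mono_neutral_left)
    show "(\<lambda>ts. ts @ [(0, 0)]) ` T \<subseteq> Hist" using assms(2) N_pos M_pos by (auto simp: T_def Hist_def)
    show "\<forall>hs\<in>Hist - (\<lambda>ts. ts @ [(0, 0)]) ` T. (cmod (\<chi> hs))\<^sup>2 * step j g (thr hs) = 0"
    proof
      fix hs assume hs: "hs \<in> Hist - (\<lambda>ts. ts @ [(0, 0)]) ` T"
      show "(cmod (\<chi> hs))\<^sup>2 * step j g (thr hs) = 0"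
      proof (rule ccontr)
        assume "(cmod (\<chi> hs))\<^sup>2 * step j g (thr hs) \<noteq> 0"
        then have nz: "\<chi> hs \<noteq> 0" by auto
        obtain ts p where tp: "hs = ts @ [p]"
          using hs assms(2) by (cases hs rule: rev_cases) (auto simp: Hist_def)
        have "p = (0, 0)" using fresh_last[OF assms, of ts p] hs nz tp by auto
        moreover have "ts \<in> T" using hs tp by (auto simp: T_def Hist_def)
        ultimately show False using hs tp by auto
      qed
    qed
  qed simp
  finally show ?thesis .
qed

text \<open>The circuit runs forwards and \<open>step\<close> acts backwards. Appending a round at
  the end extends the circuit and replaces \<open>g\<close> by \<open>step j g\<close>, hence the
  reverse induction with \<open>g\<close> universally quantified.\<close>

lemma evolve_finder:
  assumes "length js \<le> R"
  shows "\<exists>\<chi>. evolve (concat (map (round_gates a est) js)) (vec_of (ground (\<lambda>hs. of_bool (hs = hist0)))) = vec_of (ground \<chi>)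
    \<and> fresh (length js) \<chi> \<and> (\<forall>g. weight \<chi> g = run js g 0)"
  using assms
proof (induction js rule: rev_induct)
  case Nil
  have "fresh 0 (\<lambda>hs. of_bool (hs = hist0))" by (auto simp: fresh_def hist0_def)
  moreover have "weight (\<lambda>hs. of_bool (hs = hist0)) g = g 0" for g
  proof -
    have "weight (\<lambda>hs. of_bool (hs = hist0)) g = (\<Sum>hs\<in>Hist. if hs = hist0 then g (thr hist0) else 0)"
      unfolding weight_def by (intro sum.cong refl) auto
    moreover have "thr hist0 = 0" unfolding hist0_def using est_0 by (rule threshold_replicate_0)
    ultimately show ?thesis by (simp add: sum.delta)
  qed
  ultimately show ?case by (intro exI[of _ "\<lambda>hs. of_bool (hs = hist0)"]) simp
next
  case (snoc j js)
  then obtain \<chi> where \<chi>: "evolve (concat (map (round_gates a est) js)) (vec_of (ground (\<lambda>hs. of_bool (hs = hist0)))) = vec_of (ground \<chi>)"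
    "fresh (length js) \<chi>" "\<And>g. weight \<chi> g = run js g 0"
    by auto
  have l: "length js < R" using snoc by simp
  show ?case
    using evolve_round[OF \<chi>(2) l, of j] fresh_advance[OF \<chi>(2) l, of j] weight_advance[OF \<chi>(2) l, of j] \<chi>
    by (intro exI[of _ "advance j \<chi>"]) simp
qed

lemma prob_finder:
  assumes "length js \<le> R"
  shows "prob_output N (finder a est js) U A Y = run js (\<lambda>t. of_bool (t \<in> Y)) 0"
proof -
  obtain \<chi> where \<chi>: "evolve (concat (map (round_gates a est) js)) (vec_of (ground (\<lambda>hs. of_bool (hs = hist0)))) = vec_of (ground \<chi>)"
    "\<And>g. weight \<chi> g = run js g 0"
    using evolve_finder[OF assms] by auto
  \<comment> \<open>Basis vector 0, the prescribed start, is the label with all registers and the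
    whole record initial.\<close>
  have "code (0, 0, hist0, 0) = 0" by (simp add: rest_code.simps hist_code)
  then have d0: "decode 0 = (0, 0, hist0, 0)"
    using decode_code[of "(0, 0, hist0, 0)"] N_pos M_pos by (simp add: labels_def rest_def)
  have d0': "k = 0" if "k < N * W" "decode k = (0, 0, hist0, 0)" for k
    using that code_decode[of k] code_decode[of 0] d0 N_pos W_pos by simp
  have "unit_vec (N * W) 0 = vec_of (ground (\<lambda>hs. of_bool (hs = hist0)))"
  proof (rule eq_vecI)
    fix k assume "k < dim_vec (vec_of (ground (\<lambda>hs. of_bool (hs = hist0))))"
    then show "unit_vec (N * W) 0 $ k = vec_of (ground (\<lambda>hs. of_bool (hs = hist0))) $ k"
      using d0 d0'[of k] by (cases "decode k") (auto simp: unit_vec_def ground_def)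
  qed simp
  then have fin: "final_state N (finder a est js) U A = vec_of (ground \<chi>)"
    using \<chi>(1) unfolding final_state_def finder_def qalg.simps evolve_def by simp
  have "prob_output N (finder a est js) U A Y
    = (\<Sum>k | k < N * W \<and> (case decode k of (i, y, hs, c) \<Rightarrow> thr hs) \<in> Y. (cmod (ground \<chi> (decode k)))\<^sup>2)"
    unfolding prob_output_def fin Let_def unfolding finder_def qalg.simps
    by (intro sum.cong refl) (simp add: povm_value)
  also have "\<dots> = (\<Sum>k<N * W. of_bool ((case decode k of (i, y, hs, c) \<Rightarrow> thr hs) \<in> Y) * (cmod (ground \<chi> (decode k)))\<^sup>2)"
    by (intro sum.mono_neutral_cong_left) auto
  also have "\<dots> = (\<Sum>x\<in>labels. of_bool ((case x of (i, y, hs, c) \<Rightarrow> thr hs) \<in> Y) * (cmod (ground \<chi> x))\<^sup>2)"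
    by (rule sum_decode)
  also have "\<dots> = (\<Sum>i<N. \<Sum>y<M. \<Sum>hs\<in>Hist. \<Sum>c<(2::nat). if c = 0 then if y = 0 then if i = 0 then (cmod (\<chi> hs))\<^sup>2 * of_bool (thr hs \<in> Y) else 0 else 0 else 0)"
    unfolding sum_labels sum_rest by (intro sum.cong refl) (auto simp: ground_def)
  also have "\<dots> = weight \<chi> (\<lambda>t. of_bool (t \<in> Y))"
  proof -
    have inner: "(\<Sum>hs\<in>Hist. \<Sum>c<(2::nat). if c = 0 then if y = 0 then if i = 0 then F hs else 0 else 0 else 0)
      = (if y = 0 then if i = 0 then sum F Hist else 0 else 0)" for y i :: nat and F :: "_ \<Rightarrow> real"
      by (auto simp: numeral_2_eq_2)
    show ?thesis unfolding inner weight_def using N_pos M_pos by (simp only: sum.delta finite_lessThan lessThan_iff if_True)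
  qed
  finally show ?thesis unfolding \<chi>(2) .
qed

end

section \<open>The spectral decomposition\<close>

locale spectral =
  fixes N :: nat and U :: "complex mat" and \<theta> :: "nat \<Rightarrow> real" and u :: "nat \<Rightarrow> complex vec"
  assumes decomp: "spectral_decomp N U \<theta> u" and dim_pos: "0 < N"
begin

lemma \<theta>_range: "j < N \<Longrightarrow> 0 \<le> \<theta> j" "j < N \<Longrightarrow> \<theta> j < 2 * pi"
  using decomp by (auto simp: spectral_decomp_def)

lemma u_carrier: "j < N \<Longrightarrow> u j \<in> carrier_vec N"
  using decomp by (auto simp: spectral_decomp_def)

lemma U_index:
  assumes "i < N" "i' < N"
  shows "U $$ (i, i') = (\<Sum>j<N. cis (\<theta> j) * (u j $ i) * cnj (u j $ i'))"
proof -
  have "U = mat N N (\<lambda>(a, b). \<Sum>j<N. exp (\<i> * complex_of_real (\<theta> j)) * (u j $ a) * cnj (u j $ b))"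
    using decomp unfolding spectral_decomp_def by blast
  from arg_cong[OF this, of "\<lambda>V. V $$ (i, i')"] show ?thesis
    using assms by (simp add: cis_conv_exp)
qed

lemma u_orthonormal:
  assumes "j < N" "k < N"
  shows "(\<Sum>i<N. u j $ i * cnj (u k $ i)) = of_bool (j = k)"
proof -
  have "u j \<bullet>c u k = (if j = k then 1 else 0)" using decomp assms unfolding spectral_decomp_def by blast
  moreover have "u j \<bullet>c u k = (\<Sum>i<N. u j $ i * cnj (u k $ i))"
    using u_carrier[OF assms(1)] u_carrier[OF assms(2)] by (subst cscalar_prod_sum) auto
  ultimately show ?thesis by simp
qed

text \<open>The square matrix with rows \<open>u j\<close> has a one-sided inverse, its adjoint,
  which is therefore two-sided.\<close>

lemma u_complete:
  assumes "i < N" "i' < N"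
  shows "(\<Sum>j<N. u j $ i * cnj (u j $ i')) = of_bool (i = i')"
proof -
  define Q where "Q = mat N N (\<lambda>(j, i). u j $ i)"
  have Q: "Q \<in> carrier_mat N N" by (simp add: Q_def)
  have "Q * mat_adjoint Q = 1\<^sub>m N"
  proof (rule eq_matI)
    fix j k assume jk: "j < dim_row (1\<^sub>m N :: complex mat)" "k < dim_col (1\<^sub>m N :: complex mat)"
    then have "(Q * mat_adjoint Q) $$ (j, k) = (\<Sum>i<N. u j $ i * cnj (u k $ i))"
      by (simp add: Q_def scalar_prod_def lessThan_atLeast0)
    then show "(Q * mat_adjoint Q) $$ (j, k) = 1\<^sub>m N $$ (j, k)"
      using jk u_orthonormal[of j k] by simp
  qed (auto simp: Q_def)
  then have "mat_adjoint Q * Q = 1\<^sub>m N"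
    using mat_mult_left_right_inverse[OF Q mat_adjoint_carrier[OF Q]] by simp
  from arg_cong[OF this, of "\<lambda>V. V $$ (i', i)"]
  have "(\<Sum>j<N. cnj (u j $ i') * u j $ i) = of_bool (i = i')"
    using assms by (auto simp: Q_def scalar_prod_def lessThan_atLeast0)
  then show ?thesis by (simp add: mult.commute)
qed

lemma U_eigen_sum:
  assumes "i < N"
  shows "(\<Sum>i'<N. U $$ (i, i') * (\<Sum>j<N. d j * u j $ i')) = (\<Sum>j<N. (cis (\<theta> j) * d j) * u j $ i)"
proof -
  have "(\<Sum>i'<N. U $$ (i, i') * (\<Sum>j<N. d j * u j $ i'))
    = (\<Sum>i'<N. \<Sum>k<N. \<Sum>j<N. cis (\<theta> k) * (u k $ i) * d j * (u j $ i' * cnj (u k $ i')))"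
  proof (rule sum.cong[OF refl])
    fix i' assume "i' \<in> {..<N}"
    then have "U $$ (i, i') = (\<Sum>k<N. cis (\<theta> k) * (u k $ i) * cnj (u k $ i'))" using assms by (simp add: U_index)
    then show "U $$ (i, i') * (\<Sum>j<N. d j * u j $ i')
      = (\<Sum>k<N. \<Sum>j<N. cis (\<theta> k) * (u k $ i) * d j * (u j $ i' * cnj (u k $ i')))"
      by (simp only: sum_product) (simp only: mult_ac)
  qed
  also have "\<dots> = (\<Sum>k<N. \<Sum>i'<N. \<Sum>j<N. cis (\<theta> k) * (u k $ i) * d j * (u j $ i' * cnj (u k $ i')))"
    by (rule sum.swap)
  also have "\<dots> = (\<Sum>k<N. \<Sum>j<N. \<Sum>i'<N. cis (\<theta> k) * (u k $ i) * d j * (u j $ i' * cnj (u k $ i')))"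
    by (intro sum.cong refl sum.swap)
  also have "\<dots> = (\<Sum>k<N. \<Sum>j<N. if j = k then cis (\<theta> k) * (u k $ i) * d k else 0)"
    by (intro sum.cong refl) (auto simp: u_orthonormal simp flip: sum_distrib_left)
  finally show ?thesis by (simp add: sum.delta mult_ac)
qed

lemma unitary: "unitary_of_dim N U"
proof (rule unitary_of_dimI)
  show c: "U \<in> carrier_mat N N" using decomp unfolding spectral_decomp_def by auto
  show "U * mat_adjoint U = 1\<^sub>m N"
  proof (rule eq_matI)
    fix i k assume "i < dim_row (1\<^sub>m N :: complex mat)" "k < dim_col (1\<^sub>m N :: complex mat)"
    then have ik: "i < N" "k < N" by auto
    have "(U * mat_adjoint U) $$ (i, k) = (\<Sum>i'<N. U $$ (i, i') * cnj (U $$ (k, i')))"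
      using c ik by (simp add: scalar_prod_def lessThan_atLeast0)
    also have "\<dots> = (\<Sum>i'<N. U $$ (i, i') * (\<Sum>j<N. (cnj (cis (\<theta> j)) * cnj (u j $ k)) * u j $ i'))"
      using ik by (intro sum.cong refl) (simp add: U_index mult_ac)
    also have "\<dots> = (\<Sum>j<N. (cis (\<theta> j) * (cnj (cis (\<theta> j)) * cnj (u j $ k))) * u j $ i)"
      by (rule U_eigen_sum[OF ik(1)])
    also have "\<dots> = (\<Sum>j<N. u j $ i * cnj (u j $ k))"
      by (intro sum.cong refl) (simp add: cis_cnj cis_mult flip: mult.assoc)
    finally show "(U * mat_adjoint U) $$ (i, k) = 1\<^sub>m N $$ (i, k)"
      using ik by (simp add: u_complete)
  qed (use c in auto)
qed

lemma theta_max_ge: "j < N \<Longrightarrow> \<theta> j \<le> theta_max N \<theta>"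
  unfolding theta_max_def by (intro Max_ge) auto

lemma theta_max_attained: "\<exists>j<N. \<theta> j = theta_max N \<theta>"
proof -
  have "theta_max N \<theta> \<in> \<theta> ` {..<N}" unfolding theta_max_def using dim_pos by (intro Max_in) auto
  then show ?thesis by force
qed

lemma theta_max_nonneg: "0 \<le> theta_max N \<theta>"
proof -
  obtain j where "j < N" "\<theta> j = theta_max N \<theta>" using theta_max_attained by blast
  then show ?thesis using \<theta>_range(1)[of j] by simp
qed

lemma norm_sq_expand:
  assumes "v \<in> carrier_vec N"
  shows "norm_sq v = (\<Sum>j<N. (cmod (v \<bullet>c u j))\<^sup>2)"
proof -
  have "(\<Sum>j<N. (cmod (\<Sum>i<N. cnj (u j $ i) * v $ i))\<^sup>2) = (\<Sum>i<N. (cmod (v $ i))\<^sup>2)"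
  proof (rule isometry_sum)
    fix i i' assume "i \<in> {..<N}" "i' \<in> {..<N}"
    then show "(\<Sum>j<N. cnj (u j $ i) * cnj (cnj (u j $ i'))) = of_bool (i = i')"
      using u_complete[of i' i] by (auto simp: mult.commute)
  qed simp
  moreover have "v \<bullet>c u j = (\<Sum>i<N. cnj (u j $ i) * v $ i)" if "j < N" for j
    using assms u_carrier[OF that] by (subst cscalar_prod_sum) (auto simp: mult.commute)
  ultimately show ?thesis using assms by (simp add: norm_sq_def)
qed

text \<open>Turns the promise on the projection into one on eigenbasis coefficients. The projector
  fixes the top eigenvectors, which lie in its range; every vector of its range is a combination of
  them and so orthogonal to the other eigenvectors.\<close>

lemma top_space_overlap:
  assumes P: "is_orth_proj N P (top_space N \<theta> u)" and v: "v \<in> carrier_vec N"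
  shows "norm_sq (P *\<^sub>v v) = (\<Sum>j | j < N \<and> \<theta> j = theta_max N \<theta>. (cmod (v \<bullet>c u j))\<^sup>2)"
proof -
  interpret vs: vec_space "TYPE(complex)" N .
  define X where "X = {u j | j. j < N \<and> \<theta> j = theta_max N \<theta>}"
  have X: "X \<subseteq> carrier_vec N" using u_carrier by (auto simp: X_def)
  have S: "top_space N \<theta> u = vs.span X" by (simp add: top_space_def cspan_def X_def)
  have Pc: "P \<in> carrier_mat N N" "P * P = P" "mat_adjoint P = P" "(\<lambda>v. P *\<^sub>v v) ` carrier_vec N = vs.span X"
    using P unfolding is_orth_proj_def S by auto
  have Pv: "P *\<^sub>v v \<in> carrier_vec N" using Pc v by (auto intro: mult_mat_vec_carrier)
  have move: "(P *\<^sub>v v) \<bullet>c u j = v \<bullet>c (P *\<^sub>v u j)" if "j < N" for j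
    using mat_adjoint_cscalar_prod[OF Pc(1) v u_carrier[OF that]] Pc(3) by simp
  have off: "(P *\<^sub>v v) \<bullet>c u k = 0" if k: "k < N" "\<theta> k \<noteq> theta_max N \<theta>" for k
  proof -
    have "P *\<^sub>v v \<in> vs.span X" using Pc(4) v by blast
    then obtain a F where F: "P *\<^sub>v v = vs.lincomb a F" "finite F" "F \<subseteq> X"
      unfolding vs.span_def by blast
    have "(P *\<^sub>v v) \<bullet>c u k = (\<Sum>i<N. (\<Sum>x\<in>F. a x * x $ i) * cnj (u k $ i))"
      using Pv u_carrier[OF k(1)] vs.lincomb_index[of _ F a] F X
      by (subst cscalar_prod_sum) (auto intro!: sum.cong)
    also have "\<dots> = (\<Sum>i<N. \<Sum>x\<in>F. a x * (x $ i * cnj (u k $ i)))"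
      by (simp add: sum_distrib_right mult.assoc)
    also have "\<dots> = (\<Sum>x\<in>F. \<Sum>i<N. a x * (x $ i * cnj (u k $ i)))" by (rule sum.swap)
    also have "\<dots> = (\<Sum>x\<in>F. a x * (\<Sum>i<N. x $ i * cnj (u k $ i)))" by (simp only: sum_distrib_left)
    also have "\<dots> = 0"
    proof (rule sum.neutral, rule ballI)
      fix x assume "x \<in> F"
      then obtain j where "x = u j" "j < N" "\<theta> j = theta_max N \<theta>" using F(3) by (auto simp: X_def)
      then show "a x * (\<Sum>i<N. x $ i * cnj (u k $ i)) = 0" using u_orthonormal[of j k] k by auto
    qed
    finally show ?thesis .
  qed
  have on: "(P *\<^sub>v v) \<bullet>c u j = v \<bullet>c u j" if j: "j < N" "\<theta> j = theta_max N \<theta>" for j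
  proof -
    have "u j \<in> vs.span X" using vs.in_own_span[OF X] j by (auto simp: X_def)
    then obtain w where w: "w \<in> carrier_vec N" "u j = P *\<^sub>v w" using Pc(4) by blast
    have "P *\<^sub>v u j = (P * P) *\<^sub>v w" using Pc(1) w by (simp add: assoc_mult_mat_vec[of _ N N _ N])
    then have "P *\<^sub>v u j = u j" using Pc(2) w by simp
    then show ?thesis using move[OF j(1)] by simp
  qed
  have "norm_sq (P *\<^sub>v v) = (\<Sum>j<N. (cmod ((P *\<^sub>v v) \<bullet>c u j))\<^sup>2)" by (rule norm_sq_expand[OF Pv])
  also have "\<dots> = (\<Sum>j | j < N \<and> \<theta> j = theta_max N \<theta>. (cmod (v \<bullet>c u j))\<^sup>2)"
    using off on by (intro sum.mono_neutral_cong_right) auto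
  finally show ?thesis .
qed

end

section \<open>Correctness of maximum finding\<close>

text \<open>Readings within \<delta> of 2 pi are replaced by 0, as they may come from a small
  eigenphase across the wrap-around. Under the promise no reading within \<delta> of its eigenphase
  on the line is affected, because it stays below 2 pi - \<delta>.\<close>

definition estimate :: "real \<Rightarrow> nat \<Rightarrow> nat \<Rightarrow> real" where
  "estimate \<delta> M y = (let v = 2 * pi * real y / real M in if v \<ge> 2 * pi - \<delta> then 0 else v)"

locale spectral_search = max_search N M R U A a "estimate \<delta> M" + spectral N U \<theta> u
  for N M R U A a \<delta> \<theta> u +
  assumes \<delta>: "0 < \<delta>" "\<delta> < pi"
begin

definition coef :: "nat \<Rightarrow> complex" where
  "coef j = (\<Sum>i<N. A $$ (i, 0) * cnj (u j $ i))"

definition phase_amp :: "nat \<Rightarrow> nat \<Rightarrow> complex" where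
  "phase_amp j y = (\<Sum>z<M. dft M y z * (of_real (a z) * cis (\<theta> j) ^ z))"

lemma power_state_eigen: "i < N \<Longrightarrow> power_state k i = (\<Sum>j<N. (cis (\<theta> j) ^ k * coef j) * u j $ i)"
proof (induction k arbitrary: i)
  case 0
  have "(\<Sum>j<N. coef j * u j $ i) = (\<Sum>j<N. \<Sum>i'<N. A $$ (i', 0) * (u j $ i * cnj (u j $ i')))"
    by (simp add: coef_def sum_distrib_left sum_distrib_right mult_ac)
  also have "\<dots> = (\<Sum>i'<N. \<Sum>j<N. A $$ (i', 0) * (u j $ i * cnj (u j $ i')))" by (rule sum.swap)
  also have "\<dots> = (\<Sum>i'<N. if i = i' then A $$ (i, 0) else 0)"
    using 0 by (intro sum.cong refl) (auto simp: u_complete simp flip: sum_distrib_left)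
  finally show ?case using 0 by (simp add: sum.delta')
next
  case (Suc k)
  have "power_state (Suc k) i = (\<Sum>i'<N. U $$ (i, i') * (\<Sum>j<N. (cis (\<theta> j) ^ k * coef j) * u j $ i'))"
    using Suc.IH by simp
  then show ?case unfolding U_eigen_sum[OF Suc.prems] by (simp add: mult_ac)
qed

text \<open>The reading is a mixture of the phase estimation distributions of the single
  eigenphases, weighted by the overlaps of the advice state: orthogonality of the eigenvectors
  removes the cross terms.\<close>

lemma P_eq: "P y = (\<Sum>j<N. (cmod (coef j))\<^sup>2 * (cmod (phase_amp j y))\<^sup>2)"
proof -
  have "\<beta> i y = (\<Sum>j<N. u j $ i * (coef j * phase_amp j y))" if "i < N" for i
  proof -
    have "\<beta> i y = (\<Sum>z<M. \<Sum>j<N. u j $ i * (coef j * (dft M y z * (of_real (a z) * cis (\<theta> j) ^ z))))"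
      unfolding \<beta>_def using that by (simp add: power_state_eigen sum_distrib_left mult_ac)
    also have "\<dots> = (\<Sum>j<N. \<Sum>z<M. u j $ i * (coef j * (dft M y z * (of_real (a z) * cis (\<theta> j) ^ z))))"
      by (rule sum.swap)
    finally show ?thesis unfolding phase_amp_def by (simp only: sum_distrib_left)
  qed
  then have "P y = (\<Sum>i<N. (cmod (\<Sum>j<N. u j $ i * (coef j * phase_amp j y)))\<^sup>2)"
    by (simp add: P_def)
  also have "\<dots> = (\<Sum>j<N. (cmod (coef j * phase_amp j y))\<^sup>2)"
    by (rule isometry_sum) (auto simp: u_orthonormal)
  finally show ?thesis by (simp add: norm_mult power_mult_distrib)
qed

lemma coef_norm: "(\<Sum>j<N. (cmod (coef j))\<^sup>2) = 1"
proof -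
  have "(\<Sum>j<N. (cmod (coef j))\<^sup>2) = (\<Sum>j<N. (cmod (\<Sum>i<N. cnj (u j $ i) * A $$ (i, 0)))\<^sup>2)"
    by (simp add: coef_def mult.commute)
  also have "\<dots> = (\<Sum>i<N. (cmod (A $$ (i, 0)))\<^sup>2)"
  proof (rule isometry_sum)
    fix i i' assume "i \<in> {..<N}" "i' \<in> {..<N}"
    then show "(\<Sum>j<N. cnj (u j $ i) * cnj (cnj (u j $ i'))) = of_bool (i = i')"
      using u_complete[of i' i] by (auto simp: mult.commute)
  qed simp
  also have "\<dots> = 1"
  proof -
    have "mat_adjoint A * A = 1\<^sub>m N" using A_unitary by (simp add: unitary_of_dim_def)
    from arg_cong[OF this, of "\<lambda>V. V $$ (0, 0)"]
    have "(\<Sum>i<N. cnj (A $$ (i, 0)) * A $$ (i, 0)) = 1"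
      using dims(2) N_pos by (simp add: scalar_prod_def lessThan_atLeast0)
    then have "complex_of_real (\<Sum>i<N. (cmod (A $$ (i, 0)))\<^sup>2) = of_real 1"
      by (simp only: of_real_sum complex_norm_square of_real_1 mult.commute)
    then show ?thesis by (simp only: of_real_eq_iff)
  qed
  finally show ?thesis .
qed

lemma phase_amp_norm: "(\<Sum>y<M. (cmod (phase_amp j y))\<^sup>2) = 1"
proof -
  have "(\<Sum>y<M. (cmod (phase_amp j y))\<^sup>2) = (\<Sum>z<M. (cmod (of_real (a z) * cis (\<theta> j) ^ z))\<^sup>2)"
    unfolding phase_amp_def by (rule isometry_sum) (auto simp: dft_orthonormal)
  then show ?thesis using a_norm by (simp add: norm_mult norm_power)
qed

definition inaccurate :: "nat \<Rightarrow> nat set" where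
  "inaccurate j = {y. y < M \<and> \<delta> \<le> \<bar>\<theta> j - 2 * pi * real y / real M\<bar> \<and> \<bar>\<theta> j - 2 * pi * real y / real M\<bar> \<le> 2 * pi - \<delta>}"

text \<open>An accurate reading is within \<delta> of the eigenphase on the line, or across the
  wrap-around. The latter means an eigenphase below \<delta> read as nearly 2 pi: its estimate 0 is
  not too high, and for the maximal eigenphase not too low either.\<close>

lemma estimate_accurate:
  assumes "j < N" "theta_max N \<theta> < 2 * pi - 2 * \<delta>" "y < M" "y \<notin> inaccurate j"
  shows "estimate \<delta> M y \<le> theta_max N \<theta> + \<delta>"
    and "\<theta> j = theta_max N \<theta> \<Longrightarrow> theta_max N \<theta> - \<delta> \<le> estimate \<delta> M y"
proof -
  define v where "v = 2 * pi * real y / real M"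
  have v: "0 \<le> v" "v < 2 * pi" using assms(3) by (auto simp: v_def field_simps)
  have j: "0 \<le> \<theta> j" "\<theta> j \<le> theta_max N \<theta>" using assms(1) \<theta>_range theta_max_ge by auto
  have acc: "\<bar>\<theta> j - v\<bar> < \<delta> \<or> 2 * pi - \<delta> < \<bar>\<theta> j - v\<bar>"
    using assms(3,4) by (auto simp: inaccurate_def v_def)
  have est: "estimate \<delta> M y = (if 2 * pi - \<delta> \<le> v then 0 else v)" by (simp add: estimate_def v_def)
  show "estimate \<delta> M y \<le> theta_max N \<theta> + \<delta>"
    using acc j v \<delta> assms(2) unfolding est by (auto simp: abs_if split: if_splits)
  show "theta_max N \<theta> - \<delta> \<le> estimate \<delta> M y" if "\<theta> j = theta_max N \<theta>"
    using acc j v \<delta> assms(2) that unfolding est by (auto simp: abs_if split: if_splits)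
qed

lemma finder_correct:
  assumes window: "\<And>j. (\<Sum>y\<in>inaccurate j. (cmod (phase_amp j y))\<^sup>2) \<le> 1 / 4 ^ (K + 5)"
    and promise: "theta_max N \<theta> < 2 * pi - 2 * \<delta>"
    and advice: "valid_advice N \<gamma> (top_space N \<theta> u) A"
    and \<gamma>: "1 / 4 ^ K \<le> \<gamma>\<^sup>2 / 4" and R: "R = length (schedule K K)"
  shows "2 / 3 \<le> prob_output N (finder a (estimate \<delta> M) (schedule K K)) U A (correct_outputs \<delta> (theta_max N \<theta>))"
proof -
  let ?t = "theta_max N \<theta>" and ?est = "estimate \<delta> M"
  have fin: "finite (inaccurate j)" for j by (simp add: inaccurate_def)
  have "tail (?t + \<delta>) = (\<Sum>y | y < M \<and> ?t + \<delta> < ?est y. \<Sum>j<N. (cmod (coef j))\<^sup>2 * (cmod (phase_amp j y))\<^sup>2)"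
    by (simp add: tail_def P_eq)
  also have "\<dots> = (\<Sum>j<N. \<Sum>y | y < M \<and> ?t + \<delta> < ?est y. (cmod (coef j))\<^sup>2 * (cmod (phase_amp j y))\<^sup>2)"
    by (rule sum.swap)
  also have "\<dots> \<le> (\<Sum>j<N. (cmod (coef j))\<^sup>2 * (1 / 4 ^ (K + 5)))"
  proof (rule sum_mono)
    fix j assume j: "j \<in> {..<N}"
    have sub: "{y. y < M \<and> ?t + \<delta> < ?est y} \<subseteq> inaccurate j"
      using estimate_accurate(1)[OF _ promise, of j] j by force
    have "(\<Sum>y | y < M \<and> ?t + \<delta> < ?est y. (cmod (phase_amp j y))\<^sup>2) \<le> (\<Sum>y\<in>inaccurate j. (cmod (phase_amp j y))\<^sup>2)"
      by (rule sum_mono2[OF fin sub]) simp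
    then have "(\<Sum>y | y < M \<and> ?t + \<delta> < ?est y. (cmod (phase_amp j y))\<^sup>2) \<le> 1 / 4 ^ (K + 5)"
      using window[of j] by (rule order_trans)
    then show "(\<Sum>y | y < M \<and> ?t + \<delta> < ?est y. (cmod (coef j))\<^sup>2 * (cmod (phase_amp j y))\<^sup>2) \<le> (cmod (coef j))\<^sup>2 * (1 / 4 ^ (K + 5))"
      unfolding sum_distrib_left[symmetric] by (intro mult_left_mono) auto
  qed
  also have "\<dots> = 1 / 4 ^ (K + 5)" unfolding sum_distrib_right[symmetric] coef_norm by simp
  finally have hi: "tail (?t + \<delta>) \<le> 1 / 4 ^ (K + 5)" .
  define T where "T = {j. j < N \<and> \<theta> j = ?t}"
  have "\<gamma>\<^sup>2 \<le> (\<Sum>j\<in>T. (cmod (coef j))\<^sup>2)"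
  proof -
    obtain Q where Q: "is_orth_proj N Q (top_space N \<theta> u)" "\<gamma>\<^sup>2 \<le> norm_sq (Q *\<^sub>v (A *\<^sub>v unit_vec N 0))"
      using advice by (auto simp: valid_advice_def)
    have v: "A *\<^sub>v unit_vec N 0 \<in> carrier_vec N" using dims(2) by (intro mult_mat_vec_carrier[of _ N N]) auto
    have "(A *\<^sub>v unit_vec N 0) $ i = A $$ (i, 0)" if "i < N" for i
    proof -
      have "(A *\<^sub>v unit_vec N 0) $ i = (\<Sum>k<N. A $$ (i, k) * unit_vec N 0 $ k)"
        using carrier_matD[OF dims(2)] that by (subst mult_vec_index) auto
      also have "\<dots> = (\<Sum>k<N. if k = 0 then A $$ (i, 0) else 0)"
        by (intro sum.cong refl) (auto simp: unit_vec_def)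
      finally show ?thesis using N_pos by (simp add: sum.delta)
    qed
    then have "(A *\<^sub>v unit_vec N 0) \<bullet>c u j = coef j" if "j < N" for j
      unfolding coef_def using v u_carrier[OF that] carrier_matD[OF dims(2)] by (subst cscalar_prod_sum) (auto simp del: index_mult_mat_vec intro!: sum.cong)
    then show ?thesis using Q(2) unfolding top_space_overlap[OF Q(1) v] T_def by simp
  qed
  also have "\<dots> * (3/4) \<le> (\<Sum>y | y < M \<and> ?t - \<delta> \<le> ?est y. P y)"
  proof -
    have "(\<Sum>j\<in>T. (cmod (coef j))\<^sup>2) * (3/4)
      \<le> (\<Sum>j\<in>T. \<Sum>y | y < M \<and> ?t - \<delta> \<le> ?est y. (cmod (coef j))\<^sup>2 * (cmod (phase_amp j y))\<^sup>2)"
      unfolding sum_distrib_right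
    proof (rule sum_mono)
      fix j assume j: "j \<in> T"
      have sub: "{..<M} - inaccurate j \<subseteq> {y. y < M \<and> ?t - \<delta> \<le> ?est y}"
        using estimate_accurate(2)[OF _ promise, of j] j by (auto simp: T_def)
      have "(4::real) ^ 1 \<le> 4 ^ (K + 5)" by (intro power_increasing) auto
      then have "1 / 4 ^ (K + 5) \<le> (1/4 :: real)" by (simp add: field_simps)
      \<comment> \<open>The window error is far below 1/4, so each top eigenvector keeps at least
        3/4 of its mass on acceptable readings.\<close>
      then have "3/4 \<le> (\<Sum>y<M. (cmod (phase_amp j y))\<^sup>2) - (\<Sum>y\<in>inaccurate j. (cmod (phase_amp j y))\<^sup>2)"
        using window[of j] unfolding phase_amp_norm by linarith
      also have "\<dots> = (\<Sum>y\<in>{..<M} - inaccurate j. (cmod (phase_amp j y))\<^sup>2)"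
        by (rule sum_diff[symmetric]) (auto simp: inaccurate_def)
      also have "\<dots> \<le> (\<Sum>y | y < M \<and> ?t - \<delta> \<le> ?est y. (cmod (phase_amp j y))\<^sup>2)"
        by (rule sum_mono2[OF _ sub]) auto
      finally show "(cmod (coef j))\<^sup>2 * (3/4) \<le> (\<Sum>y | y < M \<and> ?t - \<delta> \<le> ?est y. (cmod (coef j))\<^sup>2 * (cmod (phase_amp j y))\<^sup>2)"
        unfolding sum_distrib_left[symmetric] by (intro mult_left_mono) auto
    qed
    also have "\<dots> \<le> (\<Sum>j<N. \<Sum>y | y < M \<and> ?t - \<delta> \<le> ?est y. (cmod (coef j))\<^sup>2 * (cmod (phase_amp j y))\<^sup>2)"
      by (rule sum_mono2) (auto simp: T_def intro!: sum_nonneg)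
    also have "\<dots> = (\<Sum>y | y < M \<and> ?t - \<delta> \<le> ?est y. P y)"
      unfolding P_eq by (rule sum.swap)
    finally show ?thesis .
  qed
  finally have mass: "\<gamma>\<^sup>2 * (3/4) \<le> (\<Sum>y | y < M \<and> ?t - \<delta> \<le> ?est y. P y)" by simp
  \<comment> \<open>Positivity supplies the strict inequality: 4^-K \<le> \<gamma>^2 / 4, while the
    mass is at least 3 \<gamma>^2 / 4.\<close>
  have "0 < 1 / (4::real) ^ K" by simp
  then have lo: "1 / 4 ^ K < (\<Sum>y | y < M \<and> ?t - \<delta> \<le> ?est y. P y)" using mass \<gamma> by linarith
  have "2 / 3 \<le> run (schedule K K) (\<lambda>t. of_bool (?t - \<delta> \<le> t \<and> t \<le> ?t + \<delta>)) 0"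
    using hi lo theta_max_nonneg \<delta> by (intro run_schedule_correct) auto
  also have "\<dots> \<le> run (schedule K K) (\<lambda>t. of_bool (t \<in> correct_outputs \<delta> ?t)) 0"
  proof (rule run_mono)
    fix s
    have "s \<in> correct_outputs \<delta> ?t" if "?t - \<delta> \<le> s \<and> s \<le> ?t + \<delta>"
      unfolding correct_outputs_def using that by (intro CollectI exI[of _ 0]) (auto simp: abs_le_iff)
    then show "of_bool (?t - \<delta> \<le> s \<and> s \<le> ?t + \<delta>) \<le> (of_bool (s \<in> correct_outputs \<delta> ?t) :: real)" by auto
  qed
  also have "\<dots> = prob_output N (finder a ?est (schedule K K)) U A (correct_outputs \<delta> ?t)"
    using R by (intro prob_finder[symmetric]) simp
  finally show ?thesis .
qed

end

section \<open>Choice of parameters and cost\<close>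

lemma solves_maxQPE_adviceI:
  assumes "\<And>U \<theta> u A. spectral_decomp N U \<theta> u \<Longrightarrow> theta_max N \<theta> < 2 * pi - 2 * \<delta> \<Longrightarrow>
    valid_advice N \<gamma> (top_space N \<theta> u) A \<Longrightarrow>
    2 / 3 \<le> prob_output N alg U A (correct_outputs \<delta> (theta_max N \<theta>))"
  shows "solves_maxQPE_advice e N \<delta> \<gamma> alg"
  using assms unfolding solves_maxQPE_advice_def by blast

lemma ceiling_bounds:
  assumes "0 \<le> x" shows "x \<le> real (nat \<lceil>x\<rceil>)" "real (nat \<lceil>x\<rceil>) \<le> x + 1"
  using assms by linarith+

theorem lemma4p5:
  shows "\<exists>C::real. C > 0 \<and>
    (\<forall>(N::nat) (\<gamma>::real) (\<delta>::real).
       N \<ge> 2 \<longrightarrow> 1 / sqrt (real N) \<le> \<gamma> \<longrightarrow> \<gamma> \<le> 1 \<longrightarrow> \<delta> > 0 \<longrightarrow>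
       (\<exists>alg. wf_qalg N alg \<and>
          real (advice_uses alg) \<le> C / \<gamma> \<and>
          real (cost alg) \<le> C * (max 1 (log 2 (1 / \<gamma>)) / (\<gamma> * \<delta>)) \<and>
          solves_maxQPE_advice Unknown N \<delta> \<gamma> alg \<and>
          solves_maxQPE_advice Known N \<delta> \<gamma> alg))"
\<comment> \<open>516096 = 2048 * 9 * 28: at most 2048/\<gamma> preparations, each with at most 9
  \<Lambda> * 28/\<delta> queries.\<close>
proof (intro exI[of _ "516096::real"] conjI allI impI)
  fix N :: nat and \<gamma> \<delta> :: real
  assume N2: "N \<ge> 2" and "1 / sqrt (real N) \<le> \<gamma>" and \<gamma>1: "\<gamma> \<le> 1" and \<delta>: "\<delta> > 0"
  moreover have "0 < 1 / sqrt (real N)" using N2 by simp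
  ultimately have \<gamma>: "0 < \<gamma>" by linarith
  define \<Lambda> where "\<Lambda> = max 1 (log 2 (1 / \<gamma>))"
  have \<Lambda>: "1 \<le> \<Lambda>" "log 2 (1 / \<gamma>) \<le> \<Lambda>" by (auto simp: \<Lambda>_def)
  show "\<exists>alg. wf_qalg N alg \<and>
          real (advice_uses alg) \<le> 516096 / \<gamma> \<and>
          real (cost alg) \<le> 516096 * (max 1 (log 2 (1 / \<gamma>)) / (\<gamma> * \<delta>)) \<and>
          solves_maxQPE_advice Unknown N \<delta> \<gamma> alg \<and>
          solves_maxQPE_advice Known N \<delta> \<gamma> alg"
  proof (cases "\<delta> < pi")
    case False
    \<comment> \<open>For \<delta> \<ge> pi the promise would make the largest eigenphase negative,
      so an algorithm without gates is vacuously correct.\<close>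
    interpret layout N 1 0 using N2 by unfold_locales auto
    have "solves_maxQPE_advice e N \<delta> \<gamma> alg" for e alg
    proof (rule solves_maxQPE_adviceI)
      fix U \<theta> u A
      assume "spectral_decomp N U \<theta> u" and t: "theta_max N \<theta> < 2 * pi - 2 * \<delta>"
      then interpret spectral N U \<theta> u using N2 by unfold_locales auto
      show "2 / 3 \<le> prob_output N alg U A (correct_outputs \<delta> (theta_max N \<theta>))"
        using t theta_max_nonneg False by linarith
    qed
    then show ?thesis
      using \<gamma> \<delta> finder_wf[of "\<lambda>_. 0" "\<lambda>_. 0" "[]"] finder_cost[of "\<lambda>_. 0" "\<lambda>_. 0" "[]"]
      by (intro exI[of _ "finder (\<lambda>_. 0) (\<lambda>_. 0) []"]) auto
  next
    case True
    \<comment> \<open>The factor 2 makes 4^-K \<le> \<gamma>^2 / 4, below the mass of acceptable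
      readings.\<close>
    define K where "K = nat \<lceil>log 2 (2 / \<gamma>)\<rceil>"
    define n where "n = nat \<lceil>24 / \<delta>\<rceil>"
    \<comment> \<open>The window exponent \<open>K + 5\<close> gives the error 4^-(K+5) that the
      overshoot bound asks for.\<close>
    define M where "M = Suc (K + 5) * n"
    have "1 \<le> 2 / \<gamma>" using \<gamma> \<gamma>1 by simp
    then have lg0: "0 \<le> log 2 (2 / \<gamma>)" using \<gamma> by (subst zero_le_log_cancel_iff) auto
    have lg: "log 2 (2 / \<gamma>) = 1 + log 2 (1 / \<gamma>)" using \<gamma> by (simp add: log_divide)
    have K: "log 2 (2 / \<gamma>) \<le> real K" "real K \<le> log 2 (2 / \<gamma>) + 1"
      unfolding K_def by (rule ceiling_bounds[OF lg0])+
    have n: "24 / \<delta> \<le> real n" "real n \<le> 24 / \<delta> + 1"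
      unfolding n_def using \<delta> by (intro ceiling_bounds; simp)+
    have K_lower: "2 / \<gamma> \<le> 2 ^ K"
    proof -
      have "2 / \<gamma> = 2 powr (log 2 (2 / \<gamma>))" using \<gamma> by simp
      also have "\<dots> \<le> 2 powr (real K)" using K by (intro powr_mono) auto
      finally show ?thesis by (simp add: powr_realpow)
    qed
    have K_upper: "2 ^ K \<le> 4 / \<gamma>"
    proof -
      have "2 ^ K = 2 powr (real K)" by (simp add: powr_realpow)
      also have "\<dots> \<le> 2 powr (log 2 (2 / \<gamma>) + 1)" using K by (intro powr_mono) auto
      also have "\<dots> = 4 / \<gamma>" using \<gamma> by (simp add: powr_add)
      finally show ?thesis .
    qed
    have \<gamma>K: "1 / 4 ^ K \<le> \<gamma>\<^sup>2 / 4"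
    proof -
      have "(2 / \<gamma>)\<^sup>2 \<le> (2 ^ K)\<^sup>2" using K_lower \<gamma> by (intro power_mono) auto
      also have "(2 ^ K)\<^sup>2 = (4 ^ K :: real)" by (simp add: power2_eq_square flip: power_mult_distrib)
      finally show ?thesis using \<gamma> by (simp add: power_divide field_simps)
    qed
    have "0 < 24 / \<delta>" using \<delta> by simp
    then have "0 < real n" using n by linarith
    then have "0 < M" unfolding M_def by simp
    then interpret layout N M "length (schedule K K)" using N2 by unfold_locales auto
    obtain a where a: "(\<Sum>k<M. (a k)\<^sup>2) = 1"
      "\<And>\<theta>. (\<Sum>y | y < M \<and> \<delta> \<le> \<bar>\<theta> - 2 * pi * real y / real M\<bar> \<and> \<bar>\<theta> - 2 * pi * real y / real M\<bar> \<le> 2 * pi - \<delta>.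
         (cmod (\<Sum>k<M. dft M y k * (of_real (a k) * cis \<theta> ^ k)))\<^sup>2) \<le> 1 / 4 ^ (K + 5)"
      using qpe_window[OF \<delta> True n(1) M_def] by auto
    let ?alg = "finder a (estimate \<delta> M) (schedule K K)"
    have sol: "solves_maxQPE_advice e N \<delta> \<gamma> ?alg" for e
    proof (rule solves_maxQPE_adviceI)
      fix U \<theta> u A
      assume dec: "spectral_decomp N U \<theta> u" and t: "theta_max N \<theta> < 2 * pi - 2 * \<delta>"
        and adv: "valid_advice N \<gamma> (top_space N \<theta> u) A"
      interpret sp: spectral N U \<theta> u using dec N2 by unfold_locales auto
      interpret ss: spectral_search N M "length (schedule K K)" U A a \<delta> \<theta> u
      proof unfold_locales
        show "unitary_of_dim N U" by (rule sp.unitary)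
        show "unitary_of_dim N A" using adv by (simp add: valid_advice_def)
        show "estimate \<delta> M 0 = 0" using True by (simp add: estimate_def)
      qed (use a \<delta> True in auto)
      show "2 / 3 \<le> prob_output N ?alg U A (correct_outputs \<delta> (theta_max N \<theta>))"
        using a(2) t adv \<gamma>K
        by (intro ss.finder_correct) (auto simp: ss.phase_amp_def ss.inaccurate_def)
    qed
    define s where "s = real (\<Sum>j\<leftarrow>schedule K K. 2 * j + 1)"
    have "s = (\<Sum>j\<leftarrow>schedule K K. 2 * real j + 1)"
      unfolding s_def by (simp add: o_def flip: sum_list_of_nat) (simp add: add.commute)
    \<comment> \<open>512 * 2^K with 2^K \<le> 4/\<gamma>.\<close>
    then have s: "s \<le> 2048 / \<gamma>" using sum_schedule[of K] K_upper by simp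
    have "real M = (real K + 6) * real n" unfolding M_def by (simp add: algebra_simps)
    also have "\<dots> \<le> (9 * \<Lambda>) * (28 / \<delta>)"
    proof (rule mult_mono)
      \<comment> \<open>K \<le> \<Lambda> + 2, and the additive constant 8 is absorbed because
        \<Lambda> \<ge> 1; likewise \<delta> < 4 absorbs the rounding of \<open>n\<close>
        below.\<close>
      show "real K + 6 \<le> 9 * \<Lambda>" using K lg \<Lambda> by linarith
      have "1 \<le> 4 / \<delta>" using True pi_less_4 \<delta> by simp
      then show "real n \<le> 28 / \<delta>" using n by simp
    qed (use \<Lambda> in auto)
    finally have "s * real M \<le> (2048 / \<gamma>) * ((9 * \<Lambda>) * (28 / \<delta>))"
      using s \<gamma> by (intro mult_mono) auto
    also have "\<dots> = 516096 * (\<Lambda> / (\<gamma> * \<delta>))" by simp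
    finally have "real (cost ?alg) \<le> 516096 * (\<Lambda> / (\<gamma> * \<delta>))"
      unfolding finder_cost s_def by simp
    moreover have "real (advice_uses ?alg) \<le> 516096 / \<gamma>"
    proof -
      have "2048 / \<gamma> \<le> 516096 / \<gamma>" using \<gamma> by (intro divide_right_mono) auto
      then show ?thesis unfolding finder_cost using s unfolding s_def by linarith
    qed
    ultimately show ?thesis using finder_wf sol unfolding \<Lambda>_def by blast
  qed
qed simp

end
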